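(* Let $J\subset\mathbb{R}$ be a bounded open interval, $x_0\in\overline{J}$, and let $f\in W^{1,2}(J)$ be complex-valued with $f(x)\neq0$ for all $x\in\overline{J}$ and $f(x_0)=1$. For $\rho\in\mathbb{C}$, let $e_f(\rho,\cdot)\in\mathscr{D}_2(\mathbf{S}_f)$ be the unique solution of $\mathbf{S}_f y=\rho^2y$ on $J$ with $e_f(\rho,x_0)=1$ and $\mathbf{D}_f e_f(\rho,x_0)=i\rho$. Then $$e_f(\rho,x)=\sum_{k=0}^\infty\frac{(i\rho)^k\varphi_f^{(k)}(x)}{k!}.$$ The series converges with respect to $x$ in the norm of $W^{1,2}(J)$, and the series of its (distributional) second derivatives converges in $W^{-1,2}(J)$. The series converges absolutely and uniformly with respect to the parameter $\rho$ on compact subsets of the complex plane.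
   Context: All functions are complex-valued. $\mathbf{D}_f y:=f(y/f)'=y'-\frac{f'}{f}y$ and $\mathbf{D}_{\frac1f}y:=\frac1f(fy)'=y'+\frac{f'}{f}y$ for $y\in W^{1,2}(J)$. $\mathbf{S}_f$ is the Schrödinger operator $-y''+q_fy$ with distributional potential $q_f=\frac{f''}{f}\in W^{-1,2}(J)$, $(q_f|\phi)=\int_J\{(f'/f)^2\phi-(f'/f)\phi'\}dx$ for $\phi\in W^{1,2}_0(J)$, i.e. $(\mathbf{S}_fy|\phi)=\int_Jy'\phi'\,dx+(q_f|y\phi)$; its domain $\mathscr{D}_2(\mathbf{S}_f)$ is the set of $y\in W^{1,2}(J)$ for which the distribution $\mathbf{S}_fy$ is given by an $L^2(J)$ function. Equivalently, $\mathscr{D}_2(\mathbf{S}_f)=\{y\in W^{1,2}(J):\mathbf{D}_fy\in W^{1,2}(J)\}$ and $\mathbf{S}_fy=-\mathbf{D}_{\frac1f}\mathbf{D}_fy$. The formal powers $\{\varphi_f^{(k)}\}_{k\ge0}$ are: $\varphi_f^{(0)}=f$, $\varphi_f^{(1)}(x)=f(x)\int_{x_0}^x\frac{dt}{f^2(t)}$, and for $k\ge2$, $\varphi_f^{(k)}(x)=k(k-1)f(x)\int_{x_0}^x\frac1{f^2(t)}\left[\int_{x_0}^tf(s)\varphi_f^{(k-2)}(s)\,ds\right]dt$. $W^{-1,2}(J)$ is the topological dual of $W^{1,2}_0(J)$. *)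

theory Defs
  imports "HOL-Analysis.Analysis"
begin

text \<open>
  Throughout, \<open>J\<close> is the bounded open interval \<open>{a<..<b}\<close>. Functions are total functions
  \<open>real \<Rightarrow> complex\<close>; only their values on the closure \<open>{a..b}\<close> matter. All dual pairings are
  bilinear (no complex conjugation).
\<close>

definition L2 :: "real \<Rightarrow> real \<Rightarrow> (real \<Rightarrow> complex) set" where
  "L2 a b = {g. g \<in> borel_measurable (lebesgue_on {a<..<b}) \<and>
                integrable (lebesgue_on {a<..<b}) (\<lambda>x. (norm (g x))\<^sup>2)}"

definition L2_norm :: "real \<Rightarrow> real \<Rightarrow> (real \<Rightarrow> complex) \<Rightarrow> real" where
  "L2_norm a b g = sqrt (integral\<^sup>L (lebesgue_on {a<..<b}) (\<lambda>x. (norm (g x))\<^sup>2))"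

definition smooth :: "(real \<Rightarrow> complex) \<Rightarrow> bool" where
  "smooth \<phi> \<longleftrightarrow> (\<exists>F :: nat \<Rightarrow> real \<Rightarrow> complex. F 0 = \<phi> \<and>
     (\<forall>n x. (F n has_vector_derivative F (Suc n) x) (at x)))"

definition test_functions :: "real \<Rightarrow> real \<Rightarrow> (real \<Rightarrow> complex) set" where
  "test_functions a b = {\<phi>. smooth \<phi> \<and> closure {x. \<phi> x \<noteq> 0} \<subseteq> {a<..<b}}"

definition weak_deriv :: "real \<Rightarrow> real \<Rightarrow> (real \<Rightarrow> complex) \<Rightarrow> (real \<Rightarrow> complex) \<Rightarrow> bool" where
  "weak_deriv a b y g \<longleftrightarrow> (\<forall>\<phi>\<in>test_functions a b.
     integral\<^sup>L (lebesgue_on {a<..<b}) (\<lambda>x. y x * vector_derivative \<phi> (at x)) =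
     - integral\<^sup>L (lebesgue_on {a<..<b}) (\<lambda>x. g x * \<phi> x))"

text \<open>
  An element of \<open>W\<^sup>1\<^sup>,\<^sup>2(J)\<close> is represented by its representative that is continuous on the
  closure of \<open>J\<close>, so that point values on the closure (end points included) make sense.
\<close>

definition W12 :: "real \<Rightarrow> real \<Rightarrow> (real \<Rightarrow> complex) set" where
  "W12 a b = {y. continuous_on {a..b} y \<and> y \<in> L2 a b \<and> (\<exists>g\<in>L2 a b. weak_deriv a b y g)}"

text \<open>For \<open>y\<close> in \<open>W12 a b\<close> the weak derivative is unique only up to null sets; this picks one.\<close>

definition wderiv :: "real \<Rightarrow> real \<Rightarrow> (real \<Rightarrow> complex) \<Rightarrow> real \<Rightarrow> complex" where
  "wderiv a b y = (SOME g. g \<in> L2 a b \<and> weak_deriv a b y g)"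

definition W12_norm :: "real \<Rightarrow> real \<Rightarrow> (real \<Rightarrow> complex) \<Rightarrow> real" where
  "W12_norm a b y = sqrt ((L2_norm a b y)\<^sup>2 + (L2_norm a b (wderiv a b y))\<^sup>2)"

definition W12_0 :: "real \<Rightarrow> real \<Rightarrow> (real \<Rightarrow> complex) set" where
  "W12_0 a b = {\<phi> \<in> W12 a b. \<exists>\<psi> :: nat \<Rightarrow> real \<Rightarrow> complex. (\<forall>n. \<psi> n \<in> test_functions a b) \<and>
     (\<lambda>n. W12_norm a b (\<lambda>x. \<psi> n x - \<phi> x)) \<longlonglongrightarrow> 0}"

text \<open>The topological dual of \<open>W12_0 a b\<close>, with its dual norm.\<close>

definition Wm12 :: "real \<Rightarrow> real \<Rightarrow> ((real \<Rightarrow> complex) \<Rightarrow> complex) set" where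
  "Wm12 a b = {T.
     (\<forall>\<phi>\<in>W12_0 a b. \<forall>\<psi>\<in>W12_0 a b. T (\<lambda>x. \<phi> x + \<psi> x) = T \<phi> + T \<psi>) \<and>
     (\<forall>c. \<forall>\<phi>\<in>W12_0 a b. T (\<lambda>x. c * \<phi> x) = c * T \<phi>) \<and>
     (\<exists>C. \<forall>\<phi>\<in>W12_0 a b. norm (T \<phi>) \<le> C * W12_norm a b \<phi>)}"

definition Wm12_norm :: "real \<Rightarrow> real \<Rightarrow> ((real \<Rightarrow> complex) \<Rightarrow> complex) \<Rightarrow> real" where
  "Wm12_norm a b T = (SUP \<phi>\<in>{\<phi> \<in> W12_0 a b. W12_norm a b \<phi> \<le> 1}. norm (T \<phi>))"

text \<open>The distributional second derivative of an element \<open>y\<close> of \<open>W12 a b\<close>: the functional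
  sending \<open>\<phi>\<close> to minus the integral of \<open>y' \<phi>'\<close>.\<close>

definition second_deriv :: "real \<Rightarrow> real \<Rightarrow> (real \<Rightarrow> complex) \<Rightarrow> (real \<Rightarrow> complex) \<Rightarrow> complex" where
  "second_deriv a b y \<phi> =
     - integral\<^sup>L (lebesgue_on {a<..<b}) (\<lambda>x. wderiv a b y x * wderiv a b \<phi> x)"

definition potential :: "real \<Rightarrow> real \<Rightarrow> (real \<Rightarrow> complex) \<Rightarrow> (real \<Rightarrow> complex) \<Rightarrow> complex" where
  "potential a b f \<phi> = integral\<^sup>L (lebesgue_on {a<..<b})
     (\<lambda>x. (wderiv a b f x / f x)\<^sup>2 * \<phi> x - (wderiv a b f x / f x) * wderiv a b \<phi> x)"

definition Sop :: "real \<Rightarrow> real \<Rightarrow> (real \<Rightarrow> complex) \<Rightarrow> (real \<Rightarrow> complex) \<Rightarrow> (real \<Rightarrow> complex) \<Rightarrow> complex" where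
  "Sop a b f y \<phi> =
     integral\<^sup>L (lebesgue_on {a<..<b}) (\<lambda>x. wderiv a b y x * wderiv a b \<phi> x) +
     potential a b f (\<lambda>x. y x * \<phi> x)"

definition given_by :: "real \<Rightarrow> real \<Rightarrow> ((real \<Rightarrow> complex) \<Rightarrow> complex) \<Rightarrow> (real \<Rightarrow> complex) \<Rightarrow> bool" where
  "given_by a b T h \<longleftrightarrow> h \<in> L2 a b \<and>
     (\<forall>\<phi>\<in>W12_0 a b. T \<phi> = integral\<^sup>L (lebesgue_on {a<..<b}) (\<lambda>x. h x * \<phi> x))"

definition Sop_domain :: "real \<Rightarrow> real \<Rightarrow> (real \<Rightarrow> complex) \<Rightarrow> (real \<Rightarrow> complex) set" where
  "Sop_domain a b f = {y \<in> W12 a b. \<exists>h. given_by a b (Sop a b f y) h}"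

definition Dop :: "real \<Rightarrow> real \<Rightarrow> (real \<Rightarrow> complex) \<Rightarrow> (real \<Rightarrow> complex) \<Rightarrow> real \<Rightarrow> complex" where
  "Dop a b f y x = f x * wderiv a b (\<lambda>t. y t / f t) x"

text \<open>\<open>Dop a b f y\<close> is only determined almost everywhere; its value at a point of the closure
  is that of its continuous representative in \<open>W12 a b\<close>.\<close>

definition Dop_value :: "real \<Rightarrow> real \<Rightarrow> (real \<Rightarrow> complex) \<Rightarrow> (real \<Rightarrow> complex) \<Rightarrow> real \<Rightarrow> complex \<Rightarrow> bool" where
  "Dop_value a b f y x v \<longleftrightarrow> (\<exists>u\<in>W12 a b.
     (AE t in lebesgue_on {a<..<b}. u t = Dop a b f y t) \<and> u x = v)"

definition ef_solution ::
  "real \<Rightarrow> real \<Rightarrow> (real \<Rightarrow> complex) \<Rightarrow> real \<Rightarrow> complex \<Rightarrow> (real \<Rightarrow> complex) \<Rightarrow> bool" where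
  "ef_solution a b f x0 \<rho> y \<longleftrightarrow> y \<in> Sop_domain a b f \<and>
     given_by a b (Sop a b f y) (\<lambda>x. \<rho>\<^sup>2 * y x) \<and>
     y x0 = 1 \<and> Dop_value a b f y x0 (\<i> * \<rho>)"

text \<open>The value 0 outside the closure is a mere normalisation: it makes the solution unique as a
  total function.\<close>

definition ef :: "real \<Rightarrow> real \<Rightarrow> (real \<Rightarrow> complex) \<Rightarrow> real \<Rightarrow> complex \<Rightarrow> real \<Rightarrow> complex" where
  "ef a b f x0 \<rho> = (THE y. ef_solution a b f x0 \<rho> y \<and> (\<forall>x. x \<notin> {a..b} \<longrightarrow> y x = 0))"

fun formal_power :: "(real \<Rightarrow> complex) \<Rightarrow> real \<Rightarrow> nat \<Rightarrow> real \<Rightarrow> complex" where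
  "formal_power f x0 0 x = f x"
| "formal_power f x0 (Suc 0) x = f x * (LBINT t=x0..x. 1 / (f t)\<^sup>2)"
| "formal_power f x0 (Suc (Suc k)) x =
     of_nat (Suc (Suc k)) * of_nat (Suc k) * f x *
       (LBINT t=x0..x. 1 / (f t)\<^sup>2 * (LBINT s=x0..t. f s * formal_power f x0 k s))"

definition ef_term :: "(real \<Rightarrow> complex) \<Rightarrow> real \<Rightarrow> complex \<Rightarrow> nat \<Rightarrow> real \<Rightarrow> complex" where
  "ef_term f x0 \<rho> k x = (\<i> * \<rho>) ^ k * formal_power f x0 k x / fact k"

text \<open>Absolute and uniform convergence over the parameter set \<open>K\<close>, with respect to the norm \<open>N\<close>
  on a space of complex-valued functions, of the series of the \<open>t \<rho> k\<close> to \<open>s \<rho>\<close>: both the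
  series of norms and the series itself converge uniformly in \<open>\<rho>\<close>.\<close>

definition abs_uniform_series ::
  "(('x \<Rightarrow> complex) \<Rightarrow> real) \<Rightarrow> complex set \<Rightarrow> (complex \<Rightarrow> nat \<Rightarrow> 'x \<Rightarrow> complex) \<Rightarrow>
   (complex \<Rightarrow> 'x \<Rightarrow> complex) \<Rightarrow> bool" where
  "abs_uniform_series N K t s \<longleftrightarrow>
     uniformly_convergent_on K (\<lambda>n \<rho>. \<Sum>k<n. N (t \<rho> k)) \<and>
     uniform_limit K (\<lambda>n \<rho>. N (\<lambda>x. s \<rho> x - (\<Sum>k<n. t \<rho> k x))) (\<lambda>_. 0) sequentially"

end

theory Submission
  imports Defs
begin

text \<open>
  Write \<open>y = f Y\<close> and \<open>U = f \<cdot> D\<^sub>f y\<close>. Weakly, \<open>S\<^sub>f y = \<rho>\<^sup>2 y\<close> is the first-order system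
  \<open>Y' = U / f\<^sup>2\<close>, \<open>U' = - \<rho>\<^sup>2 f\<^sup>2 Y\<close> with continuous coefficients, so Gronwall's lemma gives
  uniqueness and Picard iteration gives the solution as a power series in \<open>\<i> \<rho>\<close> whose
  coefficients are iterated integrals with the alternating weights \<open>1 / f\<^sup>2\<close> and \<open>f\<^sup>2\<close>: the formal
  powers divided by \<open>k! f\<close>. The \<open>k\<close>-th iterated integral and its derivative are bounded by
  \<open>B ^ k / k!\<close> for some constant \<open>B\<close>, multiplication by \<open>f\<close> is bounded from \<open>W\<^sup>1\<^sup>,\<^sup>\<infinity>\<close> to \<open>W\<^sup>1\<^sup>,\<^sup>2\<close>, and
  \<open>y \<mapsto> y''\<close> has norm at most one from \<open>W\<^sup>1\<^sup>,\<^sup>2\<close> to its dual; hence all modes of convergence follow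
  from the Weierstrass test. Weak derivatives are handled by identifying \<open>W\<^sup>1\<^sup>,\<^sup>2\<close>, through the
  Du Bois-Reymond lemma, with the primitives of square integrable functions.
\<close>

section \<open>Absolutely continuous functions\<close>

text \<open>The obstacle is the low regularity of \<open>f\<close>: its derivative is only square
  integrable, so \<open>(f' / f)\<^sup>2\<close> is merely integrable and no equation involving it
  has bounded coefficients. Dividing by \<open>f\<close> removes \<open>f'\<close> from the system;
  it returns only in the final multiplication by \<open>f\<close>, where it is measured in L2. All
  calculus therefore rests on one relation, \<open>AC u g\<close>. Its product rule is Fubini's
  theorem, its reciprocal rule is uniqueness for a linear equation, and weak derivatives fall under
  it once there are enough test functions; these are differences of shifted smooth steps. The base
  point \<open>x0\<close> may be interior or an end point, hence oriented primitives and absolute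
  values in the estimates. The majorant has to control a term and its derivative together.
  Differentiation costs one integration, that is a factor \<open>k\<close> and one power of the
  length; this is why the constant contains a 2 and the length \<open>b - a + 1\<close> in place of
  \<open>b - a\<close>.\<close>

locale bounded_interval =
  fixes a b :: real
  assumes a_less_b: "a < b"
begin

abbreviation M :: "real measure" where
  "M \<equiv> lebesgue_on {a<..<b}"

sublocale M: finite_measure M
  by (rule finite_measure_lebesgue_on) auto

section \<open>Integrability over the bounded interval\<close>

lemma measurable_ident_M [measurable]: "(\<lambda>x. x) \<in> borel_measurable M"
  using id_borel_measurable_lebesgue_on[of "{a<..<b}"] by (simp add: id_def)

text \<open>Points are null sets, so strict and weak inequalities in a cut-off integrand can be
  exchanged.\<close>

lemma AE_M_neq: "AE t in M. t \<noteq> x"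
proof -
  have "AE t in lebesgue. t \<noteq> x"
    by (rule AE_I'[of "{x}"]) auto
  then show ?thesis
    by (auto simp: AE_restrict_space_iff)
qed

lemma AE_M_I: "(\<And>t. t \<in> {a<..<b} \<Longrightarrow> Q t) \<Longrightarrow> AE t in M. Q t"
  by (auto intro!: AE_I2)

lemma cont_measurable_M:
  fixes h :: "real \<Rightarrow> 'a::euclidean_space"
  shows "continuous_on {a..b} h \<Longrightarrow> h \<in> borel_measurable M"
  by (rule continuous_imp_measurable_on_sets_lebesgue)
    (auto elim: continuous_on_subset)

lemma continuous_bound:
  fixes h :: "real \<Rightarrow> 'a::real_normed_vector"
  assumes h: "continuous_on {a..b} h"
  obtains B where "B \<ge> 0" "\<And>t. t \<in> {a..b} \<Longrightarrow> norm (h t) \<le> B"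
proof -
  obtain B where "\<forall>y\<in>h ` {a..b}. norm y \<le> B"
    using compact_imp_bounded[OF compact_continuous_image[OF h compact_Icc]]
    unfolding bounded_iff by blast
  then show ?thesis by (intro that[of "max B 0"]) (auto intro: max.coboundedI1)
qed

lemma integrable_mult_cont:
  fixes g h :: "real \<Rightarrow> 'a::{euclidean_space, real_normed_field}"
  assumes g: "integrable M g" and h: "continuous_on {a..b} h"
  shows "integrable M (\<lambda>t. g t * h t)"
proof -
  obtain B where B: "\<And>t. t \<in> {a..b} \<Longrightarrow> norm (h t) \<le> B"
    using continuous_bound[OF h] by metis
  have [measurable]: "h \<in> borel_measurable M" "g \<in> borel_measurable M"
    using h g by (auto intro: cont_measurable_M)
  show ?thesis
  proof (rule Bochner_Integration.integrable_bound)
    show "integrable M (\<lambda>t. B * norm (g t))"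
      using g by auto
    show "AE t in M. norm (g t * h t) \<le> norm (B * norm (g t))"
    proof (rule AE_M_I)
      fix t assume "t \<in> {a<..<b}"
      then have "norm (h t) \<le> B" by (intro B) auto
      moreover have "B \<le> \<bar>B\<bar>" by simp
      ultimately have "norm (h t) \<le> \<bar>B\<bar>" by linarith
      then show "norm (g t * h t) \<le> norm (B * norm (g t))"
        by (simp add: norm_mult abs_mult mult.commute[of "norm (g t)"] mult_right_mono)
    qed
  qed simp
qed

lemma integrable_cont:
  fixes h :: "real \<Rightarrow> 'a::{euclidean_space, real_normed_field}"
  assumes h: "continuous_on {a..b} h"
  shows "integrable M h"
  using integrable_mult_cont[of "\<lambda>_. 1", OF _ h] by simp

lemma integrable_if:
  fixes g :: "real \<Rightarrow> 'a::{banach, second_countable_topology}"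
  assumes g: "integrable M g" and "Measurable.pred M Q"
  shows "integrable M (\<lambda>t. if Q t then g t else 0)"
proof (rule Bochner_Integration.integrable_bound[OF g])
  show "(\<lambda>t. if Q t then g t else 0) \<in> borel_measurable M"
    using assms by measurable
qed auto

section \<open>Primitives of integrable functions\<close>

text \<open>The cut-off sits inside the integrand rather than in the domain of integration. This
  makes \<open>prim g\<close> a total function and lets dominated convergence and Fubini's theorem
  act on a fixed measure.\<close>

definition prim :: "(real \<Rightarrow> 'a::{banach, second_countable_topology}) \<Rightarrow> real \<Rightarrow> 'a" where
  "prim g x = (LINT t|M. (if t \<le> x then g t else 0))"

text \<open>As a difference it carries the sign of an oriented integral, so \<open>x\<close> may lie
  on either side of \<open>c\<close>.\<close>

definition prim_from :: "real \<Rightarrow> (real \<Rightarrow> 'a::{banach, second_countable_topology}) \<Rightarrow> real \<Rightarrow> 'a" where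
  "prim_from c g x = prim g x - prim g c"

lemma prim_a [simp]: "prim g a = 0"
  unfolding prim_def by (rule integral_eq_zero_AE) (auto intro: AE_M_I)

lemma prim_b: "prim g b = integral\<^sup>L M g"
  unfolding prim_def by (rule Bochner_Integration.integral_cong) auto

lemma prim_from_self [simp]: "prim_from c g c = 0"
  by (simp add: prim_from_def)

lemma prim_from_a: "prim_from a g x = prim g x"
  by (simp add: prim_from_def)

lemma integrable_le:
  "integrable M g \<Longrightarrow> integrable M (\<lambda>t. if t \<le> x then g t else (0::'a::{banach, second_countable_topology}))"
  by (rule integrable_if) measurable

lemma prim_add: "integrable M g \<Longrightarrow> integrable M h \<Longrightarrow> prim (\<lambda>t. g t + h t) x = prim g x + prim h x"
  unfolding prim_def
  by (subst Bochner_Integration.integral_add[symmetric])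
    (auto intro: integrable_le intro!: Bochner_Integration.integral_cong)

lemma prim_cmult:
  fixes g :: "real \<Rightarrow> 'a::{banach, second_countable_topology, real_normed_field}"
  shows "prim (\<lambda>t. c * g t) x = c * prim g x"
proof -
  have "(\<lambda>t. if t \<le> x then c * g t else 0) = (\<lambda>t. c * (if t \<le> x then g t else 0))" by auto
  then show ?thesis by (simp add: prim_def)
qed

lemma prim_cong_AE:
  assumes "AE t in M. g t = h t" "g \<in> borel_measurable M" "h \<in> borel_measurable M"
  shows "prim g x = prim h x"
  unfolding prim_def
proof (rule Bochner_Integration.integral_cong_AE)
  show "AE t in M. (if t \<le> x then g t else 0) = (if t \<le> x then h t else 0)"
    using assms(1) by eventually_elim auto
qed (use assms(2,3) in measurable)

lemma prim_continuous: "integrable M g \<Longrightarrow> continuous_on UNIV (prim g)"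
proof (rule continuous_on_sequentiallyI)
  fix u :: "nat \<Rightarrow> real" and x
  assume g: "integrable M g" and u: "u \<longlonglongrightarrow> x"
  show "(\<lambda>n. prim g (u n)) \<longlonglongrightarrow> prim g x"
    unfolding prim_def
  proof (rule integral_dominated_convergence)
    show "integrable M (\<lambda>t. norm (g t))" using g by simp
    show "AE t in M. (\<lambda>n. if t \<le> u n then g t else 0) \<longlonglongrightarrow> (if t \<le> x then g t else 0)"
      using AE_M_neq[of x]
    proof eventually_elim
      case (elim t)
      show ?case
      proof (cases "t < x")
        case True
        have "\<forall>\<^sub>F n in sequentially. t < u n" using u True by (rule order_tendstoD(1))
        then have "\<forall>\<^sub>F n in sequentially. (if t \<le> u n then g t else 0) = (if t \<le> x then g t else 0)"
          by (rule eventually_mono) (use True in auto)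
        then show ?thesis by (rule tendsto_eventually)
      next
        case False
        then have "x < t" using elim by auto
        then have "\<forall>\<^sub>F n in sequentially. u n < t" using u by (intro order_tendstoD(2))
        then have "\<forall>\<^sub>F n in sequentially. (if t \<le> u n then g t else 0) = (if t \<le> x then g t else 0)"
          by (rule eventually_mono) (use \<open>x < t\<close> in auto)
        then show ?thesis by (rule tendsto_eventually)
      qed
    qed
  qed (use g in \<open>auto intro: borel_measurable_integrable integrable_le\<close>)
qed

lemma prim_from_le:
  assumes g: "integrable M g" and "c \<le> x"
  shows "prim_from c g x = (LINT t|M. (if c < t \<and> t \<le> x then g t else 0))"
  unfolding prim_from_def prim_def using assms
  by (subst Bochner_Integration.integral_diff[symmetric])
    (auto intro: integrable_le intro!: Bochner_Integration.integral_cong)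

lemma prim_from_swap: "prim_from c g x = - prim_from x g c"
  by (simp add: prim_from_def)

text \<open>The absolute value accounts for \<open>x < c\<close>, where the primitive of a
  nonnegative function is nonpositive. The majorant is asked for only between \<open>c\<close> and
  \<open>x\<close>, because \<open>prim_from_iterate\<close> has one that is correct on a single
  side of \<open>c\<close>.\<close>

lemma prim_from_bound:
  assumes g: "integrable M g" and k: "integrable M k"
    and le: "\<And>t. t \<in> {a<..<b} \<Longrightarrow> min c x \<le> t \<Longrightarrow> t \<le> max c x \<Longrightarrow> norm (g t) \<le> k t"
  shows "norm (prim_from c g x) \<le> \<bar>prim_from c k x\<bar>"
proof -
  have *: "norm (prim_from c g x) \<le> prim_from c k x"
    if "c \<le> x" and le: "\<And>t. t \<in> {a<..<b} \<Longrightarrow> c \<le> t \<Longrightarrow> t \<le> x \<Longrightarrow> norm (g t) \<le> k t" for c x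
  proof -
    have "norm (LINT t|M. (if c < t \<and> t \<le> x then g t else 0))
        \<le> (LINT t|M. (if c < t \<and> t \<le> x then k t else 0))"
    proof (rule Bochner_Integration.integral_norm_bound_integral)
      show "integrable M (\<lambda>t. if c < t \<and> t \<le> x then g t else 0)"
        using g by (rule integrable_if) measurable
      show "integrable M (\<lambda>t. if c < t \<and> t \<le> x then k t else 0)"
        using k by (rule integrable_if) measurable
    qed (use le in auto)
    then show ?thesis using that g k by (simp add: prim_from_le)
  qed
  show ?thesis
  proof (cases "c \<le> x")
    case True
    then show ?thesis using *[of c x] le by fastforce
  next
    case False
    then have "norm (prim_from x g c) \<le> prim_from x k c" using *[of x c] le by fastforce
    then show ?thesis
      by (metis abs_ge_self abs_minus norm_minus_cancel order.trans prim_from_swap)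
  qed
qed

section \<open>Comparison with oriented interval integrals\<close>

lemma lborel_eq_M:
  fixes h :: "real \<Rightarrow> 'a::{banach, second_countable_topology}"
  assumes "h \<in> borel_measurable borel" "\<And>t. t \<notin> {a<..<b} \<Longrightarrow> h t = 0"
  shows "(LINT t|lborel. h t) = (LINT t|M. h t)"
proof -
  have "(LINT t|M. h t) = (LINT t|lebesgue. indicator {a<..<b} t *\<^sub>R h t)"
    by (subst integral_restrict_space) auto
  also have "\<dots> = (LINT t|lebesgue. h t)"
    using assms(2) by (intro Bochner_Integration.integral_cong) (auto simp: indicator_def)
  also have "\<dots> = (LINT t|lborel. h t)"
    by (rule integral_completion) (use assms(1) in simp)
  finally show ?thesis ..
qed

text \<open>This connects the integrals in \<open>formal_power\<close> with
  \<open>prim_from\<close>. Both see the integrand only between \<open>c\<close> and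
  \<open>x\<close>; the end point included by one and excluded by the other is a null set.\<close>

lemma interval_integral_eq_prim_from:
  fixes h :: "real \<Rightarrow> 'a::{euclidean_space, real_normed_field}"
  assumes h: "continuous_on {a..b} h" and "c \<in> {a..b}" "x \<in> {a..b}"
  shows "(LBINT t=c..x. h t) = prim_from c h x"
proof -
  have *: "(LBINT t=c..x. h t) = prim_from c h x" if "c \<le> x" "c \<in> {a..b}" "x \<in> {a..b}" for c x
  proof -
    have "(LBINT t=c..x. h t) = (LINT t|lborel. indicator {c<..<x} t *\<^sub>R h t)"
      using that by (simp add: interval_lebesgue_integral_def set_lebesgue_integral_def einterval_eq)
    also have "\<dots> = (LINT t|M. indicator {c<..<x} t *\<^sub>R h t)"
    proof (rule lborel_eq_M)
      show "(\<lambda>t. indicat_real {c<..<x} t *\<^sub>R h t) \<in> borel_measurable borel"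
        by (rule borel_measurable_continuous_on_indicator)
          (use that in \<open>auto intro: continuous_on_subset[OF h]\<close>)
    qed (use that in \<open>auto simp: indicator_def\<close>)
    also have "\<dots> = (LINT t|M. (if c < t \<and> t \<le> x then h t else 0))"
    proof (rule Bochner_Integration.integral_cong_AE)
      show "AE t in M. indicat_real {c<..<x} t *\<^sub>R h t = (if c < t \<and> t \<le> x then h t else 0)"
        using AE_M_neq[of x] by eventually_elim (auto simp: indicator_def)
      have [measurable]: "h \<in> borel_measurable M" using h by (rule cont_measurable_M)
      have "(\<lambda>t. if c < t \<and> t < x then h t else 0) \<in> borel_measurable M" by measurable
      then show "(\<lambda>t. indicat_real {c<..<x} t *\<^sub>R h t) \<in> borel_measurable M"
        by (rule measurable_cong[THEN iffD1, rotated]) (auto simp: indicator_def)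
      show "(\<lambda>t. if c < t \<and> t \<le> x then h t else 0) \<in> borel_measurable M" by measurable
    qed
    also have "\<dots> = prim_from c h x"
      using that integrable_cont[OF h] by (simp add: prim_from_le)
    finally show ?thesis .
  qed
  show ?thesis
  proof (cases "c \<le> x")
    case False
    have "(LBINT t=c..x. h t) = - (LBINT t=x..c. h t)"
      by (rule interval_integral_endpoints_reverse)
    also have "\<dots> = prim_from c h x" using False *[of x c] assms prim_from_swap[of c h x] by auto
    finally show ?thesis .
  qed (use * assms in auto)
qed

lemma prim_from_const:
  assumes "c \<in> {a..b}" "x \<in> {a..b}"
  shows "prim_from c (\<lambda>_. k::real) x = k * (x - c)"
proof -
  have "prim_from c (\<lambda>_. k) x = (LBINT t=c..x. k)"
    using assms by (subst interval_integral_eq_prim_from) auto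
  then show ?thesis by simp
qed

section \<open>The product of two primitives\<close>

text \<open>The triangles below and above the diagonal are integrated in the two different orders.\<close>

lemma integral_mult_split:
  fixes g h :: "real \<Rightarrow> 'a::{banach, second_countable_topology, real_normed_field}"
  assumes g: "integrable M g" and h: "integrable M h"
  shows "integral\<^sup>L M g * integral\<^sup>L M h = (LINT t|M. g t * prim h t + prim g t * h t)"
    and "integrable M (\<lambda>t. g t * prim h t)" "integrable M (\<lambda>t. prim g t * h t)"
proof -
  interpret MM: pair_sigma_finite M M ..
  have [measurable]: "g \<in> borel_measurable M" "h \<in> borel_measurable M"
    using g h by auto
  have I: "integrable (M \<Otimes>\<^sub>M M) (\<lambda>(s,t). g s * h t)"
    by (rule MM.Fubini_integrable) (auto simp: norm_mult intro!: g h)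
  have I1: "integrable (M \<Otimes>\<^sub>M M) (\<lambda>(s,t). if t \<le> s then g s * h t else 0)"
    by (rule Bochner_Integration.integrable_bound[OF I]) (measurable, auto)
  have I2: "integrable (M \<Otimes>\<^sub>M M) (\<lambda>(s,t). if s < t then g s * h t else 0)"
    by (rule Bochner_Integration.integrable_bound[OF I]) (measurable, auto)
  have e1: "(LINT t|M. (if t \<le> s then g s * h t else 0)) = g s * prim h s" for s
  proof -
    have "(\<lambda>t. if t \<le> s then g s * h t else 0) = (\<lambda>t. g s * (if t \<le> s then h t else 0))" by auto
    then show ?thesis by (simp add: prim_def)
  qed
  \<comment> \<open>The triangles \<open>t \<le> s\<close> and \<open>s < t\<close> partition the
    square without overlap; here the diagonal, a null set for each fixed \<open>t\<close>, is put
    back to obtain \<open>prim\<close>.\<close>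
  have e2: "(LINT s|M. (if s < t then g s * h t else 0)) = prim g t * h t" for t
  proof -
    have "(LINT s|M. (if s < t then g s * h t else 0)) = (LINT s|M. (if s \<le> t then g s else 0) * h t)"
    proof (rule Bochner_Integration.integral_cong_AE)
      show "AE s in M. (if s < t then g s * h t else 0) = (if s \<le> t then g s else 0) * h t"
        using AE_M_neq[of t] by eventually_elim auto
    qed measurable
    then show ?thesis unfolding prim_def by simp
  qed
  show i1: "integrable M (\<lambda>t. g t * prim h t)"
    using MM.integrable_fst[OF I1] by (simp add: e1)
  show i2: "integrable M (\<lambda>t. prim g t * h t)"
    using MM.integrable_snd[OF I2] by (simp add: e2)
  have i3: "integrable M (\<lambda>s. LINT t|M. (if s < t then g s * h t else 0))"
    using MM.integrable_fst[OF I2] by simp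
  have gs: "g s * integral\<^sup>L M h = g s * prim h s + (LINT t|M. (if s < t then g s * h t else 0))" for s
  proof -
    have "g s * integral\<^sup>L M h = (LINT t|M. g s * h t)" by simp
    also have "\<dots> = (LINT t|M. (if t \<le> s then g s * h t else 0) + (if s < t then g s * h t else 0))"
      by (rule Bochner_Integration.integral_cong) auto
    also have "\<dots> = (LINT t|M. (if t \<le> s then g s * h t else 0)) + (LINT t|M. (if s < t then g s * h t else 0))"
      by (rule Bochner_Integration.integral_add) (auto intro!: integrable_if h)
    finally show ?thesis by (simp add: e1)
  qed
  have "integral\<^sup>L M g * integral\<^sup>L M h
     = (LINT s|M. g s * prim h s + (LINT t|M. (if s < t then g s * h t else 0)))"
    by (subst integral_mult_left_zero[symmetric]) (simp only: gs)
  also have "\<dots> = (LINT s|M. g s * prim h s) + (LINT s|M. LINT t|M. (if s < t then g s * h t else 0))"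
    using i1 i3 by simp
  also have "(LINT s|M. LINT t|M. (if s < t then g s * h t else 0))
     = (LINT t|M. LINT s|M. (if s < t then g s * h t else 0))"
    using MM.Fubini_integral[OF I2] by simp
  also have "\<dots> = (LINT t|M. prim g t * h t)" by (simp add: e2)
  finally show "integral\<^sup>L M g * integral\<^sup>L M h = (LINT t|M. g t * prim h t + prim g t * h t)"
    using i1 i2 by simp
qed

text \<open>The identity for total integrals is applied to integrands cut off at \<open>x\<close>:
  their totals are the primitives at \<open>x\<close>, and below \<open>x\<close> the cut-off does
  not change the inner primitives.\<close>

lemma prim_mult:
  fixes g h :: "real \<Rightarrow> 'a::{banach, second_countable_topology, real_normed_field}"
  assumes g: "integrable M g" and h: "integrable M h"
  shows "prim g x * prim h x = prim (\<lambda>t. g t * prim h t + prim g t * h t) x"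
proof -
  let ?g = "\<lambda>t. if t \<le> x then g t else 0" and ?h = "\<lambda>t. if t \<le> x then h t else 0"
  have p: "prim (\<lambda>t. if t \<le> x then k t else 0) t = prim k t" if "t \<le> x" for t and k :: "real \<Rightarrow> 'a"
    unfolding prim_def using that by (auto intro!: Bochner_Integration.integral_cong)
  have "prim g x * prim h x = (LINT t|M. ?g t * prim ?h t + prim ?g t * ?h t)"
    using integral_mult_split(1)[OF integrable_le[OF g] integrable_le[OF h], of x x]
    by (simp add: prim_def)
  also have "\<dots> = prim (\<lambda>t. g t * prim h t + prim g t * h t) x"
    unfolding prim_def[of _ x] by (rule Bochner_Integration.integral_cong) (auto simp: p)
  finally show ?thesis .
qed

section \<open>Calculus of absolutely continuous functions\<close>

text \<open>\<open>AC u g\<close>: on the closure of the interval, \<open>u\<close> is absolutely continuous with derivative \<open>g\<close>.\<close>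

definition AC :: "(real \<Rightarrow> 'a::{banach, second_countable_topology}) \<Rightarrow> (real \<Rightarrow> 'a) \<Rightarrow> bool" where
  "AC u g \<longleftrightarrow> integrable M g \<and> (\<forall>x\<in>{a..b}. u x - u a = prim g x)"

lemma AC_integrable: "AC u g \<Longrightarrow> integrable M g"
  by (simp add: AC_def)

lemma AC_prim_eq: "AC u g \<Longrightarrow> x \<in> {a..b} \<Longrightarrow> u x = u a + prim g x"
  unfolding AC_def by (metis add.commute diff_add_cancel)

lemma AC_from:
  assumes "AC u g" "c \<in> {a..b}" "x \<in> {a..b}"
  shows "u x = u c + prim_from c g x"
  using AC_prim_eq[OF assms(1,2)] AC_prim_eq[OF assms(1,3)] unfolding prim_from_def by simp

lemma ACI:
  assumes g: "integrable M g" and u: "\<And>x. x \<in> {a..b} \<Longrightarrow> u x = d + prim_from c g x"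
  shows "AC u g"
proof -
  have "u x - u a = prim g x" if x: "x \<in> {a..b}" for x
  proof -
    have "u a = d + prim_from c g a" by (rule u) (use a_less_b in simp)
    with u[OF x] show ?thesis by (simp add: prim_from_def)
  qed
  with g show ?thesis by (simp add: AC_def)
qed

lemma AC_cong:
  assumes "AC u g" "\<And>x. x \<in> {a..b} \<Longrightarrow> u x = v x"
  shows "AC v g"
  using assms a_less_b unfolding AC_def by auto

lemma AC_cong_AE:
  assumes "AC u g" "AE t in M. g t = h t" "h \<in> borel_measurable M"
  shows "AC u h"
proof -
  have [measurable]: "g \<in> borel_measurable M" using assms(1) by (auto simp: AC_def)
  have "integrable M h"
    using assms integrable_cong_AE[of g M h] by (auto simp: AC_def)
  moreover have "prim g x = prim h x" for x
    using assms by (intro prim_cong_AE) auto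
  ultimately show ?thesis using assms by (simp add: AC_def)
qed

lemma AC_cong_deriv:
  assumes "AC u g" "\<And>t. t \<in> {a<..<b} \<Longrightarrow> g t = h t"
  shows "AC u h"
proof (rule AC_cong_AE[OF assms(1)])
  have "g \<in> borel_measurable M" using assms(1) by (auto simp: AC_def)
  then show "h \<in> borel_measurable M"
    by (rule measurable_cong[THEN iffD1, rotated]) (auto simp: assms)
qed (auto intro: AE_M_I assms)

lemma AC_prim_from: "integrable M g \<Longrightarrow> AC (prim_from c g) g"
  by (simp add: AC_def prim_from_def)

lemma AC_prim: "integrable M g \<Longrightarrow> AC (prim g) g"
  by (simp add: AC_def)

lemma AC_const: "AC (\<lambda>_. k) (\<lambda>_. 0)"
  by (simp add: AC_def prim_def)

lemma AC_add: "AC u g \<Longrightarrow> AC v h \<Longrightarrow> AC (\<lambda>x. u x + v x) (\<lambda>x. g x + h x)"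
  unfolding AC_def by (simp add: prim_add add_diff_add)

lemma AC_cmult:
  fixes u :: "real \<Rightarrow> 'a::{banach, second_countable_topology, real_normed_field}"
  shows "AC u g \<Longrightarrow> AC (\<lambda>x. k * u x) (\<lambda>x. k * g x)"
  unfolding AC_def by (simp add: prim_cmult flip: right_diff_distrib)

lemma AC_diff:
  fixes u :: "real \<Rightarrow> 'a::{banach, second_countable_topology, real_normed_field}"
  shows "AC u g \<Longrightarrow> AC v h \<Longrightarrow> AC (\<lambda>x. u x - v x) (\<lambda>x. g x - h x)"
  using AC_add[of u g "\<lambda>x. -1 * v x" "\<lambda>x. -1 * h x"] AC_cmult[of v h "-1"] by simp

lemma AC_sum:
  fixes u :: "'i \<Rightarrow> real \<Rightarrow> 'a::{banach, second_countable_topology, real_normed_field}"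
  shows "(\<And>i. i \<in> A \<Longrightarrow> AC (u i) (g i)) \<Longrightarrow> AC (\<lambda>x. \<Sum>i\<in>A. u i x) (\<lambda>x. \<Sum>i\<in>A. g i x)"
  by (induction A rule: infinite_finite_induct) (simp_all add: AC_const AC_add)

lemma AC_continuous:
  assumes u: "AC u g"
  shows "continuous_on {a..b} u"
proof -
  have "continuous_on {a..b} (\<lambda>x. u a + prim g x)"
    using u by (intro continuous_intros continuous_on_subset[OF prim_continuous]) (auto simp: AC_def)
  then show ?thesis
    by (rule continuous_on_eq) (rule AC_prim_eq[OF u, symmetric])
qed

text \<open>Expanding both factors as initial value plus primitive leaves one nonlinear term, the
  product of the two primitives, which is \<open>prim_mult\<close>; the rest is a linear combination
  of \<open>u\<close>, \<open>v\<close> and a constant.\<close>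

lemma AC_mult:
  fixes u v :: "real \<Rightarrow> 'a::{euclidean_space, real_normed_field}"
  assumes u: "AC u g" and v: "AC v h"
  shows "AC (\<lambda>x. u x * v x) (\<lambda>x. g x * v x + u x * h x)"
proof -
  have [intro]: "integrable M g" "integrable M h" using assms by (auto simp: AC_def)
  have "AC (\<lambda>x. prim g x * prim h x) (\<lambda>t. g t * prim h t + prim g t * h t)"
    using integral_mult_split[of g h] by (simp add: AC_def prim_mult \<open>integrable M g\<close> \<open>integrable M h\<close>)
  from AC_add[OF this AC_add[OF AC_cmult[OF v, of "u a"] AC_cmult[OF u, of "v a"]]]
  have "AC (\<lambda>x. prim g x * prim h x + (u a * v x + v a * u x) - u a * v a)
     (\<lambda>t. g t * prim h t + prim g t * h t + (u a * h t + v a * g t) - 0)"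
    by (rule AC_diff[OF _ AC_const])
  then have "AC (\<lambda>x. u x * v x)
     (\<lambda>t. g t * prim h t + prim g t * h t + (u a * h t + v a * g t) - 0)"
  proof (rule AC_cong)
    fix x assume x: "x \<in> {a..b}"
    show "prim g x * prim h x + (u a * v x + v a * u x) - u a * v a = u x * v x"
      using AC_prim_eq[OF u x] AC_prim_eq[OF v x] by algebra
  qed
  then show ?thesis
  proof (rule AC_cong_deriv)
    fix t assume "t \<in> {a<..<b}"
    then have t: "t \<in> {a..b}" by simp
    show "g t * prim h t + prim g t * h t + (u a * h t + v a * g t) - 0 = g t * v t + u t * h t"
      using AC_prim_eq[OF u t] AC_prim_eq[OF v t] by algebra
  qed
qed

text \<open>Both boundary terms of the product contain \<open>v\<close>, so the end values of
  \<open>u\<close> are free. This is what pairing an arbitrary function with a test function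
  requires.\<close>

lemma AC_by_parts:
  fixes u v :: "real \<Rightarrow> 'a::{euclidean_space, real_normed_field}"
  assumes u: "AC u g" and v: "AC v h" and 0: "v a = 0" "v b = 0"
  shows "(LINT x|M. u x * h x) = - (LINT x|M. g x * v x)"
proof -
  have i: "integrable M (\<lambda>x. g x * v x)" "integrable M (\<lambda>x. u x * h x)"
    using integrable_mult_cont[OF AC_integrable[OF u] AC_continuous[OF v]]
      integrable_mult_cont[OF AC_integrable[OF v] AC_continuous[OF u]]
    by (auto simp: mult.commute)
  have "u b * v b = u a * v a + prim (\<lambda>x. g x * v x + u x * h x) b"
    using AC_prim_eq[OF AC_mult[OF u v], of b] a_less_b by simp
  then show ?thesis using i 0 by (simp add: prim_b eq_neg_iff_add_eq_0 add.commute)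
qed

lemma AC_power:
  fixes u :: "real \<Rightarrow> 'a::{euclidean_space, real_normed_field}"
  assumes u: "AC u g"
  shows "AC (\<lambda>x. u x ^ Suc n) (\<lambda>x. of_nat (Suc n) * (g x * u x ^ n))"
proof (induction n)
  case (Suc n)
  from AC_mult[OF u Suc] show ?case
  by (simp add: algebra_simps)
qed (use u in simp)

section \<open>Iterated estimates, Gronwall's lemma and reciprocals\<close>

text \<open>With \<open>K = prim_from c k\<close> the power rule says that \<open>k * K ^ n\<close>
  has primitive \<open>K ^ Suc n / Suc n\<close>; this is the source of the factorials. One such
  integration is the induction step both of Gronwall's lemma and of the bound on iterated
  integrals.\<close>

lemma prim_from_iterate:
  assumes g: "integrable M g" and k: "integrable M k" and c: "c \<in> {a..b}" and x: "x \<in> {a..b}"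
    and k0: "\<And>t. k t \<ge> 0" and B: "B \<ge> 0"
    and le: "\<And>t. t \<in> {a<..<b} \<Longrightarrow> norm (g t) \<le> k t * (B * \<bar>prim_from c k t\<bar> ^ n / fact n)"
  shows "norm (prim_from c g x) \<le> B * \<bar>prim_from c k x\<bar> ^ Suc n / fact (Suc n)"
proof -
  define K where "K = prim_from c k"
  \<comment> \<open>The sign of \<open>K\<close> between \<open>c\<close> and \<open>x\<close>:
    since \<open>k\<close> is nonnegative, \<open>K\<close> is nonnegative to the right of
    \<open>c\<close> and nonpositive to the left. It turns the power of
    \<open>\<bar>K t\<bar>\<close> into a power of \<open>K t\<close>, which can be
    integrated.\<close>
  define \<sigma> :: real where "\<sigma> = (if c \<le> x then 1 else -1)"
  have K: "AC K k" unfolding K_def using k by (rule AC_prim_from)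
  have cK: "continuous_on {a..b} K" using K by (rule AC_continuous)
  have ik: "integrable M (\<lambda>t. k t * K t ^ n)"
    by (rule integrable_mult_cont[OF k]) (intro continuous_intros cK)
  have Kge: "K t \<ge> 0" if "c \<le> t" for t
    unfolding K_def prim_from_le[OF k that] by (rule Bochner_Integration.integral_nonneg) (auto simp: k0)
  have Kle: "K t \<le> 0" if "t \<le> c" for t
  proof -
    have "prim_from t k c \<ge> 0"
      unfolding prim_from_le[OF k that] by (rule Bochner_Integration.integral_nonneg) (auto simp: k0)
    then show ?thesis unfolding K_def by (subst prim_from_swap) simp
  qed
  have s: "\<bar>K t\<bar> = \<sigma> * K t" if "min c x \<le> t" "t \<le> max c x" for t
    using that Kge[of t] Kle[of t] by (auto simp: \<sigma>_def min_def max_def split: if_splits)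
  have "norm (prim_from c g x) \<le> \<bar>prim_from c (\<lambda>t. (\<sigma> ^ n * B / fact n) * (k t * K t ^ n)) x\<bar>"
  proof (rule prim_from_bound[OF g])
    show "integrable M (\<lambda>t. (\<sigma> ^ n * B / fact n) * (k t * K t ^ n))"
      using ik by simp
    fix t assume t: "t \<in> {a<..<b}" "min c x \<le> t" "t \<le> max c x"
    have "norm (g t) \<le> k t * (B * \<bar>K t\<bar> ^ n / fact n)" using le[OF t(1)] by (simp add: K_def)
    also have "\<dots> = (\<sigma> ^ n * B / fact n) * (k t * K t ^ n)"
      unfolding s[OF t(2,3)] by (simp add: power_mult_distrib)
    finally show "norm (g t) \<le> (\<sigma> ^ n * B / fact n) * (k t * K t ^ n)" .
  qed
  also have "\<dots> = B / fact n * \<bar>prim_from c (\<lambda>t. k t * K t ^ n) x\<bar>"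
  proof -
    have "prim_from c (\<lambda>t. (\<sigma> ^ n * B / fact n) * (k t * K t ^ n)) x
       = (\<sigma> ^ n * B / fact n) * prim_from c (\<lambda>t. k t * K t ^ n) x"
      unfolding prim_from_def prim_cmult by (simp only: right_diff_distrib)
    moreover have "\<bar>\<sigma> ^ n\<bar> = 1" by (simp add: \<sigma>_def power_abs)
    ultimately show ?thesis using B by (simp add: abs_mult)
  qed
  also have "prim_from c (\<lambda>t. k t * K t ^ n) x = K x ^ Suc n / Suc n"
  proof -
    have "K x ^ Suc n = K c ^ Suc n + prim_from c (\<lambda>t. of_nat (Suc n) * (k t * K t ^ n)) x"
      using AC_from[OF AC_power[OF K] c x] .
    also have "prim_from c (\<lambda>t. of_nat (Suc n) * (k t * K t ^ n)) x
       = of_nat (Suc n) * prim_from c (\<lambda>t. k t * K t ^ n) x"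
      unfolding prim_from_def prim_cmult by (simp only: right_diff_distrib)
    finally show ?thesis by (simp add: K_def field_simps)
  qed
  also have "B / fact n * \<bar>K x ^ Suc n / Suc n\<bar> = B * \<bar>K x\<bar> ^ Suc n / fact (Suc n)"
    by (simp only: abs_divide power_abs) simp
  finally show ?thesis by (simp add: K_def)
qed

text \<open>Feeding the inequality into itself \<open>n\<close> times bounds \<open>m x\<close> by a
  term of an exponential series, which tends to 0. The weight \<open>k\<close> is merely integrable
  so that \<open>AC_inverse\<close> can use the norm of a logarithmic derivative.\<close>

lemma gronwall_zero:
  fixes k m :: "real \<Rightarrow> real"
  assumes k: "integrable M k" and k0: "\<And>t. k t \<ge> 0" and c: "c \<in> {a..b}"
    and m: "continuous_on {a..b} m" and m0: "\<And>t. m t \<ge> 0"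
    and le: "\<And>x. x \<in> {a..b} \<Longrightarrow> m x \<le> \<bar>prim_from c (\<lambda>t. k t * m t) x\<bar>"
    and x: "x \<in> {a..b}"
  shows "m x = 0"
proof -
  obtain B where B: "\<And>t. t \<in> {a..b} \<Longrightarrow> norm (m t) \<le> B" and B0: "B \<ge> 0"
    using continuous_bound[OF m] by metis
  have b: "m t \<le> B * \<bar>prim_from c k t\<bar> ^ n / fact n" if "t \<in> {a..b}" for n t
    using that
  proof (induction n arbitrary: t)
    case 0
    then show ?case using B[of t] by simp
  next
    case (Suc n)
    have "norm (prim_from c (\<lambda>t. k t * m t) t) \<le> B * \<bar>prim_from c k t\<bar> ^ Suc n / fact (Suc n)"
    proof (rule prim_from_iterate)
      show "integrable M (\<lambda>t. k t * m t)" using integrable_mult_cont[OF k m] .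
      fix t assume "t \<in> {a<..<b}"
      then have "m t \<le> B * \<bar>prim_from c k t\<bar> ^ n / fact n" by (intro Suc.IH) simp
      then show "norm (k t * m t) \<le> k t * (B * \<bar>prim_from c k t\<bar> ^ n / fact n)"
        using k0[of t] m0[of t] by (simp only: real_norm_def abs_mult abs_of_nonneg mult_left_mono)
    qed (use k c k0 Suc.prems B0 in auto)
    then show ?case using le[OF Suc.prems] by simp
  qed
  have "(\<lambda>n. B * (inverse (fact n) * \<bar>prim_from c k x\<bar> ^ n)) \<longlonglongrightarrow> B * 0"
    by (intro tendsto_intros summable_LIMSEQ_zero summable_exp)
  then have "m x \<le> B * 0"
    by (rule LIMSEQ_le_const) (use b[OF x] in \<open>auto simp: field_simps\<close>)
  then show ?thesis using m0[of x] by simp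
qed

text \<open>The reciprocal is recognised by uniqueness. Let \<open>r\<close> be the function with
  the expected derivative and initial value; by the product rule \<open>w = f * r - 1\<close> solves
  \<open>w' = (g / f) * w\<close> with \<open>w a = 0\<close>, so Gronwall's lemma makes it
  vanish.\<close>

lemma AC_inverse:
  fixes f :: "real \<Rightarrow> complex"
  assumes f: "AC f g" and nz: "\<And>x. x \<in> {a..b} \<Longrightarrow> f x \<noteq> 0"
  shows "AC (\<lambda>x. 1 / f x) (\<lambda>x. - g x / (f x)\<^sup>2)"
proof -
  have cf: "continuous_on {a..b} f" using f by (rule AC_continuous)
  have ab: "a \<in> {a..b}" using a_less_b by simp
  have "integrable M (\<lambda>x. g x * (- (1 / (f x)\<^sup>2)))"
    by (rule integrable_mult_cont[OF AC_integrable[OF f]]) (intro continuous_intros cf, use nz in auto)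
  then have ig: "integrable M (\<lambda>x. - g x / (f x)\<^sup>2)" by simp
  define r where "r x = 1 / f a + prim (\<lambda>x. - g x / (f x)\<^sup>2) x" for x
  have r: "AC r (\<lambda>x. - g x / (f x)\<^sup>2)"
    by (rule ACI[where d = "1 / f a" and c = a, OF ig]) (simp add: r_def prim_from_a)
  define w where "w x = f x * r x - 1" for x
  have "AC w (\<lambda>x. g x * r x + f x * (- g x / (f x)\<^sup>2) - 0)"
    unfolding w_def by (rule AC_diff[OF AC_mult[OF f r] AC_const])
  then have w: "AC w (\<lambda>x. g x / f x * w x)"
    by (rule AC_cong_deriv) (use nz in \<open>auto simp: w_def power2_eq_square field_simps\<close>)
  have wa: "w a = 0" using nz[OF ab] by (simp add: w_def r_def)
  have cw: "continuous_on {a..b} w" using w by (rule AC_continuous)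
  have "integrable M (\<lambda>t. g t * (1 / f t))"
    by (rule integrable_mult_cont[OF AC_integrable[OF f]]) (intro continuous_intros cf, use nz in auto)
  then have "integrable M (\<lambda>t. norm (g t * (1 / f t)))" by (rule integrable_norm)
  then have ik: "integrable M (\<lambda>t. norm (g t / f t))" by simp
  have "norm (w x) = 0" if x: "x \<in> {a..b}" for x
  proof (rule gronwall_zero[OF ik _ ab _ _ _ x])
    show cnw: "continuous_on {a..b} (\<lambda>x. norm (w x))" by (intro continuous_intros cw)
    fix x assume x: "x \<in> {a..b}"
    have "norm (prim_from a (\<lambda>x. g x / f x * w x) x)
        \<le> \<bar>prim_from a (\<lambda>t. norm (g t / f t) * norm (w t)) x\<bar>"
      by (rule prim_from_bound[OF AC_integrable[OF w] integrable_mult_cont[OF ik cnw]])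
        (simp add: norm_mult norm_divide)
    then show "norm (w x) \<le> \<bar>prim_from a (\<lambda>t. norm (g t / f t) * norm (w t)) x\<bar>"
      using AC_from[OF w ab x] wa by simp
  qed auto
  then have "r x = 1 / f x" if "x \<in> {a..b}" for x
    using that nz[OF that] by (simp add: w_def field_simps)
  with r show ?thesis by (rule AC_cong) auto
qed

end

section \<open>A smooth step function\<close>

text \<open>A class of functions closed under differentiation consists of smooth functions:
  iterating a choice of derivative inside the class yields the sequence that \<open>smooth\<close>
  asks for.\<close>

lemma smooth_coinduct:
  assumes f: "X f"
    and X: "\<And>f. X f \<Longrightarrow> \<exists>f'. X f' \<and> (\<forall>x. (f has_vector_derivative f' x) (at x))"
  shows "smooth f"
proof -
  obtain d where d: "\<And>f. X f \<Longrightarrow> X (d f)" "\<And>f x. X f \<Longrightarrow> (f has_vector_derivative d f x) (at x)"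
    using X by metis
  have "X ((d ^^ n) f)" for n
    by (induction n) (auto simp: f d)
  then have "\<forall>n x. ((d ^^ n) f has_vector_derivative (d ^^ Suc n) f x) (at x)"
    by (auto intro: d)
  then show ?thesis unfolding smooth_def by (intro exI[of _ "\<lambda>n. (d ^^ n) f"]) auto
qed

lemma smoothE:
  assumes "smooth f"
  obtains f' where "smooth f'" "\<And>x. (f has_vector_derivative f' x) (at x)"
proof -
  obtain F where F: "F 0 = f" "\<And>n x. (F n has_vector_derivative F (Suc n) x) (at x)"
    using assms unfolding smooth_def by auto
  have "smooth (F 1)" unfolding smooth_def by (rule exI[of _ "\<lambda>n. F (Suc n)"]) (use F in auto)
  then show ?thesis using that[of "F 1"] F(2)[of 0] F(1) by auto
qed

lemma smooth_antiderivative: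
  assumes "smooth f'" "\<And>x. (f has_vector_derivative f' x) (at x)"
  shows "smooth f"
  by (rule smooth_coinduct[where X = "\<lambda>g. g = f \<or> smooth g"]) (use assms in \<open>auto elim: smoothE\<close>)

lemma smooth_diff:
  assumes "smooth f" "smooth h" shows "smooth (\<lambda>x. f x - h x)"
proof (rule smooth_coinduct[where X = "\<lambda>g. \<exists>f h. smooth f \<and> smooth h \<and> g = (\<lambda>x. f x - h x)"])
  fix g assume "\<exists>f h. smooth f \<and> smooth h \<and> g = (\<lambda>x. f x - h x)"
  then obtain f h where g: "smooth f" "smooth h" "g = (\<lambda>x. f x - h x)" by auto
  obtain f' h' where "smooth f'" "\<And>x. (f has_vector_derivative f' x) (at x)"
    "smooth h'" "\<And>x. (h has_vector_derivative h' x) (at x)"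
    using g by (metis smoothE)
  then show "\<exists>f'. (\<exists>f h. smooth f \<and> smooth h \<and> f' = (\<lambda>x. f x - h x)) \<and> (\<forall>x. (g has_vector_derivative f' x) (at x))"
    by (intro exI[of _ "\<lambda>x. f' x - h' x"]) (auto simp: g intro!: derivative_eq_intros)
qed (use assms in auto)

lemma has_vector_derivative_affine:
  fixes f :: "real \<Rightarrow> complex"
  assumes "(f has_vector_derivative d) (at ((x - p) / e))"
  shows "((\<lambda>x. f ((x - p) / e)) has_vector_derivative (1 / e) *\<^sub>R d) (at x)"
proof -
  have "((\<lambda>x. (x - p) / e) has_vector_derivative 1 / e) (at x)"
    \<comment> \<open>For \<open>e = 0\<close> division returns 0, so the inner function is constant
      and the claimed derivative \<open>1 / 0 = 0\<close> is still right.\<close>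
    by (cases "e = 0") (auto intro!: derivative_eq_intros simp: has_real_derivative_iff_has_vector_derivative[symmetric])
  from vector_diff_chain_at[OF this assms] show ?thesis
    by (simp add: o_def)
qed

text \<open>The scalar \<open>c\<close> in the coinductive class absorbs the factor
  \<open>1 / e\<close> that each differentiation produces.\<close>

lemma smooth_affine:
  assumes "smooth f"
  shows "smooth (\<lambda>x. f ((x - p) / e))"
proof (rule smooth_coinduct[where X = "\<lambda>g. \<exists>c f. smooth f \<and> g = (\<lambda>x. c * f ((x - p) / e))"])
  fix g assume "\<exists>c f. smooth f \<and> g = (\<lambda>x. c * f ((x - p) / e))"
  then obtain c f where f: "smooth f" and g: "g = (\<lambda>x. c * f ((x - p) / e))" by auto
  obtain f' where f': "smooth f'" "\<And>x. (f has_vector_derivative f' x) (at x)" using f by (auto elim: smoothE)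
  have "(g has_vector_derivative (c * of_real (1 / e)) * f' ((x - p) / e)) (at x)" for x
    using has_vector_derivative_mult_right[OF has_vector_derivative_affine[OF f'(2)], of c]
    by (simp add: g scaleR_conv_of_real mult.assoc)
  with f' show "\<exists>f'. (\<exists>c f. smooth f \<and> f' = (\<lambda>x. c * f ((x - p) / e))) \<and> (\<forall>x. (g has_vector_derivative f' x) (at x))"
    by (intro exI[of _ "\<lambda>x. (c * of_real (1 / e)) * f' ((x - p) / e)"] conjI allI
        exI[of _ "c * of_real (1 / e)"] exI[of _ f'] refl)
qed (use assms in \<open>auto intro!: exI[of _ 1] exI[of _ f]\<close>)

text \<open>The classical flat functions: every derivative of \<open>exp (- 1 / x)\<close> is of this form.\<close>

definition flat :: "real poly \<Rightarrow> real \<Rightarrow> real" where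
  "flat p x = (if x > 0 then poly p (1 / x) * exp (- (1 / x)) else 0)"

lemma poly_mult_exp_tendsto_0: "((\<lambda>u. poly p u * exp (- u)) \<longlongrightarrow> (0::real)) at_top"
proof -
  have "((\<lambda>u. \<Sum>i\<le>degree p. coeff p i * (u ^ i / exp u)) \<longlongrightarrow> (\<Sum>i\<le>degree p. coeff p i * 0)) at_top"
    by (intro tendsto_intros tendsto_power_div_exp_0)
  then show ?thesis
    by (simp add: poly_altdef exp_minus divide_inverse sum_distrib_right mult.assoc)
qed

text \<open>In the variable \<open>u = 1 / x\<close> differentiation with respect to
  \<open>x\<close> is \<open>- u\<^sup>2\<close> times differentiation with respect to
  \<open>u\<close>, and the latter takes \<open>p * exp (- u)\<close> to
  \<open>(pderiv p - p) * exp (- u)\<close>. Hence the polynomial on the right.\<close>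

lemma DERIV_flat: "(flat p has_real_derivative flat ([:0, 0, 1:] * (p - pderiv p)) x) (at x)"
proof (cases x "0::real" rule: linorder_cases)
  case greater
  have "((\<lambda>x. poly p (1 / x) * exp (- (1 / x))) has_real_derivative
      flat ([:0, 0, 1:] * (p - pderiv p)) x) (at x)"
    using greater
    by (auto intro!: derivative_eq_intros simp: flat_def field_simps power2_eq_square)
  moreover have "\<forall>\<^sub>F y in nhds x. (0::real) < y"
    using greater by (intro eventually_nhds_in_open[of "{0<..}", simplified]) auto
  ultimately show ?thesis
    by (subst DERIV_cong_ev[OF refl _ refl]) (auto elim!: eventually_mono simp: flat_def)
next
  case less
  have "\<forall>\<^sub>F y in nhds x. y < (0::real)"
    using less by (intro eventually_nhds_in_open[of "{..<0}", simplified]) auto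
  then have "(flat p has_real_derivative 0) (at x)"
    by (subst DERIV_cong_ev[OF refl _ refl, of _ "\<lambda>_. 0"]) (auto elim!: eventually_mono simp: flat_def)
  then show ?thesis using less by (simp add: flat_def)
next
  case equal
  have "((\<lambda>h. flat p h / h) \<longlongrightarrow> 0) (at_right 0)"
  proof -
    \<comment> \<open>Dividing by \<open>h = 1 / u\<close> multiplies the polynomial by
      \<open>u\<close>, so the difference quotient at 0 is again a polynomial times
      \<open>exp (- u)\<close>.\<close>
    have "((\<lambda>u. poly ([:0, 1:] * p) u * exp (- u)) \<longlongrightarrow> 0) at_top"
      by (rule poly_mult_exp_tendsto_0)
    then have "((\<lambda>h. poly ([:0, 1:] * p) (inverse h) * exp (- inverse h)) \<longlongrightarrow> 0) (at_right (0::real))"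
      by (rule filterlim_compose[OF _ filterlim_inverse_at_top_right])
    moreover have "\<forall>\<^sub>F h in at_right 0. poly ([:0, 1:] * p) (inverse h) * exp (- inverse h) = flat p h / h"
      by (rule eventually_at_right_less[THEN eventually_mono]) (auto simp: flat_def field_simps)
    ultimately show ?thesis
      by (rule Lim_transform_eventually)
  qed
  moreover have "((\<lambda>h. flat p h / h) \<longlongrightarrow> 0) (at_left 0)"
  proof (rule tendsto_eventually)
    show "\<forall>\<^sub>F h in at_left 0. flat p h / h = 0"
      by (auto simp: eventually_at_filter flat_def)
  qed
  ultimately have "((\<lambda>h. flat p h / h) \<longlongrightarrow> 0) (at 0)"
    by (simp add: filterlim_split_at)
  then show ?thesis using equal
    by (simp add: has_field_derivative_iff flat_def)
qed

text \<open>Generators vanish outside the unit interval. Sums are included because the product rule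
  has two terms, and the scalar takes up the sign from differentiating \<open>1 - x\<close>.\<close>

inductive flat_span :: "(real \<Rightarrow> complex) \<Rightarrow> bool" where
  base: "flat_span (\<lambda>x. c * of_real (flat p x * flat q (1 - x)))"
| add: "flat_span f \<Longrightarrow> flat_span g \<Longrightarrow> flat_span (\<lambda>x. f x + g x)"

lemma flat_span_deriv:
  "flat_span f \<Longrightarrow> \<exists>f'. flat_span f' \<and> (\<forall>x. (f has_vector_derivative f' x) (at x))"
proof (induction rule: flat_span.induct)
  case (base c p q)
  let ?d = "\<lambda>p. [:0, 0, 1:] * (p - pderiv p)"
  let ?f' = "\<lambda>x. c * of_real (flat (?d p) x * flat q (1 - x)) + (-c) * of_real (flat p x * flat (?d q) (1 - x))"
  have "((\<lambda>x. flat p x * flat q (1 - x)) has_real_derivative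
      flat (?d p) x * flat q (1 - x) - flat p x * flat (?d q) (1 - x)) (at x)" for x
  proof -
    have "((\<lambda>x. flat q (1 - x)) has_real_derivative flat (?d q) (1 - x) * (-1)) (at x)"
      by (rule DERIV_chain2[OF DERIV_flat]) (auto intro!: derivative_eq_intros)
    from DERIV_mult[OF DERIV_flat[of p x] this] show ?thesis by (simp add: algebra_simps)
  qed
  then have "((\<lambda>x. c * complex_of_real (flat p x * flat q (1 - x))) has_vector_derivative ?f' x) (at x)" for x
    using has_vector_derivative_mult_right[OF has_vector_derivative_of_real, of _ _ "at x" c]
    by (fastforce simp: algebra_simps)
  moreover have "flat_span ?f'" by (intro flat_span.intros)
  ultimately show ?case by blast
next
  case (add f g)
  then obtain f' g' where "flat_span f'" "\<And>x. (f has_vector_derivative f' x) (at x)"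
    "flat_span g'" "\<And>x. (g has_vector_derivative g' x) (at x)" by blast
  then show ?case
    by (intro exI[of _ "\<lambda>x. f' x + g' x"]) (auto intro!: flat_span.add derivative_eq_intros)
qed

text \<open>\<open>B\<close> is an antiderivative of the bump \<open>\<beta>\<close>, constant on
  both sides of the unit interval; hence the difference of two translates of \<open>B\<close> has
  compact support. The height \<open>B 1\<close> is left unnormalised and is carried along as a
  positive factor.\<close>

lemma smooth_step_exists:
  "\<exists>(B :: real \<Rightarrow> real) (\<beta> :: real \<Rightarrow> real). smooth (\<lambda>x. of_real (B x)) \<and>
    (\<forall>x. (B has_real_derivative \<beta> x) (at x)) \<and> continuous_on UNIV \<beta> \<and>
    (\<forall>x. \<beta> x \<ge> 0) \<and> (\<forall>x. x \<notin> {0..1} \<longrightarrow> \<beta> x = 0) \<and>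
    (\<forall>x\<le>0. B x = 0) \<and> (\<forall>x\<ge>1. B x = B 1) \<and> B 1 > 0"
proof -
  define \<beta> where "\<beta> x = flat 1 x * flat 1 (1 - x)" for x
  have "flat_span (\<lambda>x. 1 * of_real (flat 1 x * flat 1 (1 - x)))" by (rule flat_span.base)
  then have s\<beta>: "smooth (\<lambda>x. of_real (\<beta> x))"
    unfolding \<beta>_def by (intro smooth_coinduct[of flat_span, OF _ flat_span_deriv]) auto
  have cflat: "continuous_on A (flat p)" for A p
    using DERIV_flat by (meson DERIV_continuous continuous_at_imp_continuous_on)
  have c\<beta>: "continuous_on UNIV \<beta>"
    unfolding \<beta>_def by (intro continuous_intros cflat continuous_on_compose2[OF cflat]) auto
  \<comment> \<open>Infinite end points give one antiderivative on the whole line.\<close>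
  have "\<exists>F. \<forall>x::real. -\<infinity> < ereal x \<longrightarrow> ereal x < \<infinity> \<longrightarrow> (F has_vector_derivative \<beta> x) (at x)"
    by (rule einterval_antiderivative) (use c\<beta> in \<open>auto simp: continuous_on_eq_continuous_at\<close>)
  then obtain F where F: "\<And>x. (F has_real_derivative \<beta> x) (at x)"
    by (auto simp: has_real_derivative_iff_has_vector_derivative)
  define B where "B x = F x - F 0" for x
  have B: "(B has_real_derivative \<beta> x) (at x)" for x
    unfolding B_def using F[of x] by (auto intro!: derivative_eq_intros)
  have \<beta>0: "\<beta> x \<ge> 0" for x by (simp add: \<beta>_def flat_def)
  have \<beta>out: "\<beta> x = 0" if "x \<le> 0 \<or> x \<ge> 1" for x using that by (auto simp: \<beta>_def flat_def)
  have le0: "B x = 0" if "x \<le> 0" for x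
  proof -
    have "DERIV B y :> 0" if "y < 0" for y using B[of y] \<beta>out[of y] that by simp
    then have "B x = B 0" if "x < 0" using that
      by (intro DERIV_isconst2[of x 0 B 0, symmetric])
        (auto intro!: continuous_at_imp_continuous_on DERIV_continuous[OF B])
    then have "B x = B 0" using \<open>x \<le> 0\<close> by (cases "x = 0") auto
    then show ?thesis by (simp add: B_def)
  qed
  have ge1: "B x = B 1" if "x \<ge> 1" for x
  proof (cases "x = 1")
    case False
    have "DERIV B y :> 0" if "1 < y" for y using B[of y] \<beta>out[of y] that by simp
    then show ?thesis using that False
      by (intro DERIV_isconst2[of 1 x B x])
        (auto intro!: continuous_at_imp_continuous_on DERIV_continuous[OF B])
  qed simp
  have "B 0 < B 1"
  proof (rule DERIV_pos_imp_increasing_open[of 0 1 B])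
    fix x :: real assume "0 < x" "x < 1"
    then have "\<beta> x > 0" by (simp add: \<beta>_def flat_def)
    with B[of x] show "\<exists>y. DERIV B x :> y \<and> y > 0" by blast
  qed (auto intro!: continuous_at_imp_continuous_on DERIV_continuous[OF B])
  then have Bpos: "B 1 > 0" by (simp add: B_def)
  have sB: "smooth (\<lambda>x. of_real (B x))"
    by (rule smooth_antiderivative[OF s\<beta>]) (intro has_vector_derivative_of_real B)
  show ?thesis
    by (rule exI[of _ B], rule exI[of _ \<beta>], intro conjI allI impI)
      (rule sB B c\<beta> \<beta>0 Bpos | erule le0 | erule ge1 | (rule \<beta>out, force))+
qed

section \<open>Square integrable functions and the Du Bois-Reymond lemma\<close>

context bounded_interval
begin

section \<open>Test functions are absolutely continuous\<close>

lemma AC_C1: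
  fixes \<phi> :: "real \<Rightarrow> 'a::{euclidean_space, real_normed_field}"
  assumes d: "\<And>x. (\<phi> has_vector_derivative \<phi>' x) (at x)" and c: "continuous_on UNIV \<phi>'"
  shows "AC \<phi> \<phi>'"
proof (rule ACI[where d = "\<phi> a" and c = a])
  have c': "continuous_on A \<phi>'" for A using c by (rule continuous_on_subset) simp
  show "integrable M \<phi>'" by (rule integrable_cont) (rule c')
  fix x assume x: "x \<in> {a..b}"
  have "(LBINT t=a..x. \<phi>' t) = \<phi> x - \<phi> a"
    by (rule interval_integral_FTC_finite) (auto intro: c' has_vector_derivative_at_within[OF d])
  then show "\<phi> x = \<phi> a + prim_from a \<phi>' x"
    using x a_less_b by (subst (asm) interval_integral_eq_prim_from) (auto intro: c')
qed

lemma test_function_AC: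
  assumes "\<phi> \<in> test_functions a b"
  shows "AC \<phi> (\<lambda>x. vector_derivative \<phi> (at x))"
    and "continuous_on UNIV (\<lambda>x. vector_derivative \<phi> (at x))" and "\<phi> a = 0" "\<phi> b = 0"
proof -
  have s: "smooth \<phi>" and supp: "closure {x. \<phi> x \<noteq> 0} \<subseteq> {a<..<b}"
    using assms by (auto simp: test_functions_def)
  obtain \<phi>' where \<phi>': "smooth \<phi>'" "\<And>x. (\<phi> has_vector_derivative \<phi>' x) (at x)"
    using s by (auto elim: smoothE)
  obtain \<phi>'' where "\<And>x. (\<phi>' has_vector_derivative \<phi>'' x) (at x)"
    using \<phi>'(1) by (auto elim: smoothE)
  then have c: "continuous_on UNIV \<phi>'"
    by (meson continuous_at_imp_continuous_on has_vector_derivative_continuous)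
  have eq: "(\<lambda>x. vector_derivative \<phi> (at x)) = \<phi>'"
    using \<phi>'(2) by (auto intro: vector_derivative_at)
  show "AC \<phi> (\<lambda>x. vector_derivative \<phi> (at x))"
    unfolding eq by (rule AC_C1[OF \<phi>'(2) c])
  show "continuous_on UNIV (\<lambda>x. vector_derivative \<phi> (at x))"
    unfolding eq by (rule c)
  have "{x. \<phi> x \<noteq> 0} \<subseteq> {a<..<b}" by (rule order_trans[OF closure_subset supp])
  then show "\<phi> a = 0" "\<phi> b = 0" by auto
qed

section \<open>Products, sums and norms in L2\<close>

lemma L2_measurable: "g \<in> L2 a b \<Longrightarrow> g \<in> borel_measurable M"
  by (simp add: L2_def)

lemma L2_mult_integrable:
  assumes "g \<in> L2 a b" "h \<in> L2 a b"
  shows "integrable M (\<lambda>x. norm (g x) * norm (h x))" and "integrable M (\<lambda>x. g x * h x)"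
proof -
  have [measurable]: "g \<in> borel_measurable M" "h \<in> borel_measurable M"
    using assms by (auto simp: L2_def)
  show *: "integrable M (\<lambda>x. norm (g x) * norm (h x))"
  proof (rule Bochner_Integration.integrable_bound)
    show "integrable M (\<lambda>x. (norm (g x))\<^sup>2 + (norm (h x))\<^sup>2)"
      using assms by (simp add: L2_def)
    have "\<bar>u * v\<bar> \<le> \<bar>u\<^sup>2 + v\<^sup>2\<bar>" for u v :: real
    proof -
      have "2 * \<bar>u * v\<bar> \<le> u\<^sup>2 + v\<^sup>2"
        using sum_squares_bound[of "\<bar>u\<bar>" "\<bar>v\<bar>"] by (simp add: abs_mult)
      then show ?thesis by linarith
    qed
    then show "AE x in M. norm (norm (g x) * norm (h x)) \<le> norm ((norm (g x))\<^sup>2 + (norm (h x))\<^sup>2)"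
      by (intro AE_I2) (simp only: real_norm_def)
  qed measurable
  show "integrable M (\<lambda>x. g x * h x)"
    by (rule Bochner_Integration.integrable_bound[OF *]) (auto simp: norm_mult)
qed

lemma L2_bounded_mult:
  assumes "g \<in> L2 a b" "h \<in> borel_measurable M" "\<And>x. x \<in> {a<..<b} \<Longrightarrow> norm (h x) \<le> C * norm (g x)"
  shows "h \<in> L2 a b"
proof -
  have "integrable M (\<lambda>x. (norm (h x))\<^sup>2)"
  proof (rule Bochner_Integration.integrable_bound)
    show "integrable M (\<lambda>x. C\<^sup>2 * (norm (g x))\<^sup>2)" using assms(1) by (simp add: L2_def)
    show "(\<lambda>x. (norm (h x))\<^sup>2) \<in> borel_measurable M" using assms(2) by measurable
    show "AE x in M. norm ((norm (h x))\<^sup>2) \<le> norm (C\<^sup>2 * (norm (g x))\<^sup>2)"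
    proof (rule AE_M_I)
      fix x assume "x \<in> {a<..<b}"
      then have "(norm (h x))\<^sup>2 \<le> (C * norm (g x))\<^sup>2" by (intro power_mono assms) auto
      then show "norm ((norm (h x))\<^sup>2) \<le> norm (C\<^sup>2 * (norm (g x))\<^sup>2)"
        by (simp add: power_mult_distrib)
    qed
  qed
  then show ?thesis using assms by (simp add: L2_def)
qed

lemma L2_cont:
  assumes "continuous_on {a..b} h"
  shows "h \<in> L2 a b"
proof -
  have "integrable M (\<lambda>x. (norm (h x))\<^sup>2)"
    by (rule integrable_cont) (intro continuous_intros assms)
  then show ?thesis using cont_measurable_M[OF assms] by (simp add: L2_def)
qed

lemma L2_integrable: "g \<in> L2 a b \<Longrightarrow> integrable M g"
  using L2_mult_integrable(2)[of g "\<lambda>_. 1"] L2_cont[of "\<lambda>_. 1"] by simp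

lemma L2_mult_cont:
  assumes g: "g \<in> L2 a b" and h: "continuous_on {a..b} h"
  shows "(\<lambda>x. g x * h x) \<in> L2 a b"
proof -
  obtain C where C: "\<And>t. t \<in> {a..b} \<Longrightarrow> norm (h t) \<le> C"
    using continuous_bound[OF h] by metis
  show ?thesis
  proof (rule L2_bounded_mult[OF g])
    show "(\<lambda>x. g x * h x) \<in> borel_measurable M"
      using L2_measurable[OF g] cont_measurable_M[OF h] by measurable
    fix x assume "x \<in> {a<..<b}"
    then show "norm (g x * h x) \<le> C * norm (g x)"
      using C[of x] by (simp add: norm_mult mult.commute[of "norm (g x)"] mult_right_mono)
  qed
qed

lemma L2_add:
  assumes "g \<in> L2 a b" "h \<in> L2 a b"
  shows "(\<lambda>x. g x + h x) \<in> L2 a b"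
proof -
  have [measurable]: "g \<in> borel_measurable M" "h \<in> borel_measurable M"
    using assms by (auto simp: L2_def)
  have "integrable M (\<lambda>x. (norm (g x + h x))\<^sup>2)"
  proof (rule Bochner_Integration.integrable_bound)
    show "integrable M (\<lambda>x. 2 * (norm (g x))\<^sup>2 + 2 * (norm (h x))\<^sup>2)"
      using assms by (simp add: L2_def)
    show "AE x in M. norm ((norm (g x + h x))\<^sup>2) \<le> norm (2 * (norm (g x))\<^sup>2 + 2 * (norm (h x))\<^sup>2)"
    proof (rule AE_I2)
      fix x
      have "(norm (g x + h x))\<^sup>2 \<le> (norm (g x) + norm (h x))\<^sup>2"
        by (intro power_mono norm_triangle_ineq) auto
      also have "\<dots> \<le> 2 * (norm (g x))\<^sup>2 + 2 * (norm (h x))\<^sup>2"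
        using sum_squares_bound[of "norm (g x)" "norm (h x)"] by (simp add: power2_sum)
      finally show "norm ((norm (g x + h x))\<^sup>2) \<le> norm (2 * (norm (g x))\<^sup>2 + 2 * (norm (h x))\<^sup>2)"
        by simp
    qed
  qed measurable
  then show ?thesis by (simp add: L2_def)
qed

lemma L2_cmult: "g \<in> L2 a b \<Longrightarrow> (\<lambda>x. c * g x) \<in> L2 a b"
  using L2_mult_cont[of g "\<lambda>_. c"] by (simp add: mult.commute)

lemma L2_diff: "g \<in> L2 a b \<Longrightarrow> h \<in> L2 a b \<Longrightarrow> (\<lambda>x. g x - h x) \<in> L2 a b"
  using L2_add[of g "\<lambda>x. -1 * h x"] L2_cmult[of h "-1"] by simp

lemma L2_sum: "(\<And>i. i \<in> A \<Longrightarrow> g i \<in> L2 a b) \<Longrightarrow> (\<lambda>x. \<Sum>i\<in>A. g i x) \<in> L2 a b"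
  by (induction A rule: infinite_finite_induct) (auto intro: L2_add L2_cont)

lemma L2_norm_nonneg [simp]: "L2_norm a b g \<ge> 0"
  by (simp add: L2_norm_def)

lemma L2_norm_sq: "(L2_norm a b g)\<^sup>2 = integral\<^sup>L M (\<lambda>x. (norm (g x))\<^sup>2)"
  by (simp add: L2_norm_def)

lemma L2_norm_mono:
  assumes "h \<in> L2 a b" "g \<in> L2 a b" "s \<ge> 0" "\<And>x. x \<in> {a<..<b} \<Longrightarrow> norm (g x) \<le> s * norm (h x)"
  shows "L2_norm a b g \<le> s * L2_norm a b h"
proof -
  have "integral\<^sup>L M (\<lambda>x. (norm (g x))\<^sup>2) \<le> integral\<^sup>L M (\<lambda>x. s\<^sup>2 * (norm (h x))\<^sup>2)"
  proof (rule integral_mono_AE)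
    show "AE x in M. (norm (g x))\<^sup>2 \<le> s\<^sup>2 * (norm (h x))\<^sup>2"
      by (rule AE_M_I) (auto simp: power_mult_distrib[symmetric] intro!: power_mono assms)
  qed (use assms in \<open>auto simp: L2_def\<close>)
  then have "sqrt (integral\<^sup>L M (\<lambda>x. (norm (g x))\<^sup>2)) \<le> sqrt (s\<^sup>2 * integral\<^sup>L M (\<lambda>x. (norm (h x))\<^sup>2))"
    by simp
  then show ?thesis using assms(3) by (simp add: L2_norm_def real_sqrt_mult)
qed

lemma L2_norm_cong_AE:
  assumes "g \<in> borel_measurable M" "h \<in> borel_measurable M" "AE x in M. g x = h x"
  shows "L2_norm a b g = L2_norm a b h"
  unfolding L2_norm_def
  by (intro arg_cong[where f = sqrt] Bochner_Integration.integral_cong_AE)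
    (use assms in \<open>auto elim!: eventually_mono\<close>)

text \<open>The inequality is transferred from extended nonnegative integrals: integrability of the
  product makes \<open>I\<close> the finite value of the left side, and the norm of the complex
  pairing is at most \<open>I\<close>.\<close>

lemma L2_Cauchy_Schwarz:
  assumes g: "g \<in> L2 a b" and h: "h \<in> L2 a b"
  shows "integral\<^sup>L M (\<lambda>x. norm (g x) * norm (h x)) \<le> L2_norm a b g * L2_norm a b h"
    and "norm (integral\<^sup>L M (\<lambda>x. g x * h x)) \<le> L2_norm a b g * L2_norm a b h"
proof -
  have [measurable]: "g \<in> borel_measurable M" "h \<in> borel_measurable M"
    using assms by (auto simp: L2_def)
  define I where "I = integral\<^sup>L M (\<lambda>x. norm (g x) * norm (h x))"
  have I0: "I \<ge> 0" unfolding I_def by (rule Bochner_Integration.integral_nonneg) auto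
  have sq: "(\<integral>\<^sup>+x. (ennreal (norm (k x)))\<^sup>2 \<partial>M) = ennreal ((L2_norm a b k)\<^sup>2)" if "k \<in> L2 a b" for k
    unfolding L2_norm_sq using that
    by (simp add: ennreal_power nn_integral_eq_integral L2_def)
  have "(\<integral>\<^sup>+x. ennreal (norm (g x)) * ennreal (norm (h x)) \<partial>M) = ennreal I"
    unfolding I_def using L2_mult_integrable(1)[OF g h]
    by (simp add: nn_integral_eq_integral flip: ennreal_mult)
  then have "(ennreal I)\<^sup>2 \<le> ennreal ((L2_norm a b g)\<^sup>2) * ennreal ((L2_norm a b h)\<^sup>2)"
    using Cauchy_Schwarz_nn_integral[of "\<lambda>x. ennreal (norm (g x))" M "\<lambda>x. ennreal (norm (h x))"]
    by (simp add: sq g h)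
  then have "ennreal (I\<^sup>2) \<le> ennreal ((L2_norm a b g)\<^sup>2 * (L2_norm a b h)\<^sup>2)"
    using I0 by (simp add: ennreal_power ennreal_mult)
  then have "I\<^sup>2 \<le> (L2_norm a b g * L2_norm a b h)\<^sup>2"
    by (subst (asm) ennreal_le_iff) (auto simp: power_mult_distrib)
  then have *: "I \<le> L2_norm a b g * L2_norm a b h"
    by (rule power2_le_imp_le) simp
  then show "integral\<^sup>L M (\<lambda>x. norm (g x) * norm (h x)) \<le> L2_norm a b g * L2_norm a b h"
    by (simp only: I_def)
  have "norm (integral\<^sup>L M (\<lambda>x. g x * h x)) \<le> I"
    unfolding I_def
    by (rule Bochner_Integration.integral_norm_bound_integral)
      (use L2_mult_integrable[OF g h] in \<open>auto simp: norm_mult\<close>)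
  with * show "norm (integral\<^sup>L M (\<lambda>x. g x * h x)) \<le> L2_norm a b g * L2_norm a b h" by simp
qed

text \<open>Suppose \<open>z p \<noteq> z q\<close>. The difference of two smooth steps starting at
  \<open>p\<close> and \<open>q\<close> is a test function whose derivative is the difference of two
  nonnegative bumps of equal mass. The hypothesis then equates the two local averages of
  \<open>z\<close>, which for narrow bumps are close to \<open>z p\<close> and
  \<open>z q\<close>.\<close>

lemma du_bois_reymond:
  fixes z :: "real \<Rightarrow> complex"
  assumes z: "continuous_on {a..b} z"
    and 0: "\<And>\<phi>. \<phi> \<in> test_functions a b \<Longrightarrow> (LINT x|M. z x * vector_derivative \<phi> (at x)) = 0"
    and x: "x \<in> {a..b}"
  shows "z x = z a"
proof -
  obtain B \<beta> where step: "smooth (\<lambda>x. of_real (B x))" "\<forall>x. (B has_real_derivative \<beta> x) (at x)"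
    "continuous_on UNIV \<beta>" "\<forall>x. \<beta> x \<ge> 0" "\<forall>x. x \<notin> {0..1} \<longrightarrow> \<beta> x = 0"
    "\<forall>x\<le>0. B x = 0" "\<forall>x\<ge>1. B x = B 1" and Bpos: "B 1 > 0"
    using smooth_step_exists by blast
  have B: "smooth (\<lambda>x. of_real (B x))" "\<And>x. (B has_real_derivative \<beta> x) (at x)"
    and \<beta>: "continuous_on UNIV \<beta>" "\<And>x. \<beta> x \<ge> 0" "\<And>x. x \<notin> {0..1} \<Longrightarrow> \<beta> x = 0"
    and B0: "\<And>x. x \<le> 0 \<Longrightarrow> B x = 0" and B1: "\<And>x. x \<ge> 1 \<Longrightarrow> B x = B 1"
    using step by blast+
  have eq: "z p = z q" if pq: "a < p" "p < q" "q < b" for p q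
  proof (rule ccontr)
    assume ne: "z p \<noteq> z q"
    \<comment> \<open>A third suffices: each average errs by at most \<delta> per unit mass, so
      \<open>z p\<close> and \<open>z q\<close> would be within \<open>2 * \<delta>\<close>, whereas
      their distance is \<open>3 * \<delta>\<close>.\<close>
    define \<delta> where "\<delta> = norm (z p - z q) / 3"
    have \<delta>: "\<delta> > 0" using ne by (simp add: \<delta>_def)
    have close: "\<exists>d>0. \<forall>t. dist t r < d \<longrightarrow> dist (z t) (z r) < \<delta>" if "a < r" "r < b" for r
    proof -
      have "continuous_on {a<..<b} z" by (rule continuous_on_subset[OF z]) auto
      then have "isCont z r" using that by (simp add: continuous_on_eq_continuous_at)
      then show ?thesis using \<delta> unfolding continuous_at_eps_delta dist_norm by blast
    qed
    obtain d1 where d1: "d1 > 0" "\<And>t. dist t p < d1 \<Longrightarrow> dist (z t) (z p) < \<delta>"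
      using close[of p] pq by (meson order.strict_trans)
    obtain d2 where d2: "d2 > 0" "\<And>t. dist t q < d2 \<Longrightarrow> dist (z t) (z q) < \<delta>"
      using close[of q] pq by (meson order.strict_trans)
    \<comment> \<open>The bump at \<open>r\<close> lives on \<open>{r..r + \<epsilon>}\<close>. It
      has to stay within the radii given by continuity at \<open>p\<close> and \<open>q\<close> and
      left of \<open>b\<close>; halving makes these inequalities strict.\<close>
    define \<epsilon> where "\<epsilon> = min (min d1 d2) (b - q) / 2"
    have "\<epsilon> \<le> (b - q) / 2" by (simp add: \<epsilon>_def)
    then have "q + \<epsilon> < b" using pq by simp
    moreover have "\<epsilon> > 0" "\<epsilon> < d1" "\<epsilon> < d2" using d1(1) d2(1) pq by (auto simp: \<epsilon>_def)
    ultimately have \<epsilon>: "\<epsilon> > 0" "\<epsilon> < d1" "\<epsilon> < d2" "q + \<epsilon> < b" by simp_all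
    define k where "k r x = \<beta> ((x - r) / \<epsilon>) / \<epsilon>" for r x
    have dk: "((\<lambda>x. B ((x - r) / \<epsilon>)) has_real_derivative k r x) (at x)" for r x
    proof -
      have "((\<lambda>x. (x - r) / \<epsilon>) has_real_derivative 1 / \<epsilon>) (at x)"
        using \<epsilon>(1) by (auto intro!: derivative_eq_intros)
      from DERIV_chain2[OF B(2) this] show ?thesis by (simp add: k_def)
    qed
    have ck: "continuous_on UNIV (k r)" for r
    proof -
      have "continuous_on UNIV (\<lambda>x. \<beta> ((x - r) / \<epsilon>))"
        by (rule continuous_on_compose2[OF \<beta>(1)]) (use \<epsilon> in \<open>auto intro!: continuous_intros\<close>)
      then show ?thesis using \<epsilon> unfolding k_def by (intro continuous_intros) auto
    qed
    have ck': "continuous_on {a..b} (k r)" for r using ck by (rule continuous_on_subset) simp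
    have ik: "integral\<^sup>L M (k r) = B 1" if "a < r" "r + \<epsilon> < b" for r
    proof -
      have "AC (\<lambda>x. B ((x - r) / \<epsilon>)) (k r)"
        by (rule AC_C1) (use dk ck in \<open>auto simp: has_real_derivative_iff_has_vector_derivative\<close>)
      from AC_prim_eq[OF this, of b] a_less_b
      have "B ((b - r) / \<epsilon>) = B ((a - r) / \<epsilon>) + integral\<^sup>L M (k r)" by (simp add: prim_b)
      moreover have "B ((a - r) / \<epsilon>) = 0" using that \<epsilon> by (intro B0) (simp add: divide_le_0_iff)
      moreover have "B ((b - r) / \<epsilon>) = B 1" using that \<epsilon> by (intro B1) (simp add: field_simps)
      ultimately show ?thesis by simp
    qed
    have close: "norm ((LINT x|M. z x * of_real (k r x)) - z r * of_real (B 1)) \<le> \<delta> * B 1"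
      if r: "a < r" "r + \<epsilon> < b" and zr: "\<And>t. dist t r < d \<Longrightarrow> dist (z t) (z r) < \<delta>" and d: "\<epsilon> < d" for r d
    proof -
      have i1: "integrable M (\<lambda>x. z x * of_real (k r x))"
        by (intro integrable_cont continuous_intros z ck')
      have i2: "integrable M (\<lambda>x. z r * of_real (k r x))"
        by (intro integrable_cont continuous_intros ck')
      have "(LINT x|M. z x * of_real (k r x)) - z r * of_real (B 1)
          = (LINT x|M. z x * of_real (k r x)) - (LINT x|M. z r * of_real (k r x))"
        using ik[OF r] by simp
      also have "\<dots> = (LINT x|M. (z x - z r) * of_real (k r x))"
        using i1 i2 by (simp add: left_diff_distrib)
      also have "norm \<dots> \<le> (LINT x|M. \<delta> * k r x)"
      proof (rule Bochner_Integration.integral_norm_bound_integral)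
        show "integrable M (\<lambda>x. (z x - z r) * of_real (k r x))" "integrable M (\<lambda>x. \<delta> * k r x)"
          by (intro integrable_cont continuous_intros z ck')+
        fix x
        have k0: "k r x \<ge> 0" using \<beta>(2) \<epsilon> by (simp add: k_def)
        show "norm ((z x - z r) * of_real (k r x)) \<le> \<delta> * k r x"
        proof (cases "(x - r) / \<epsilon> \<in> {0..1}")
          case True
          then have "dist x r < d" using \<epsilon> d by (auto simp: dist_real_def field_simps)
          then have "norm (z x - z r) \<le> \<delta>" using zr by (force simp: dist_norm)
          then show ?thesis using k0 by (simp add: norm_mult mult_right_mono)
        next
          case False
          then show ?thesis using \<beta>(3) by (simp add: k_def)
        qed
      qed
      also have "\<dots> = \<delta> * B 1" using ik[OF r] by simp
      finally show ?thesis .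
    qed
    \<comment> \<open>To the left of \<open>p\<close> both steps vanish, and to the right of
      \<open>q + \<epsilon>\<close> both have reached the height \<open>B 1\<close> and
      cancel.\<close>
    define \<phi> where "\<phi> x = complex_of_real (B ((x - p) / \<epsilon>)) - of_real (B ((x - q) / \<epsilon>))" for x
    have "smooth \<phi>"
      unfolding \<phi>_def using smooth_affine[OF B(1)] by (intro smooth_diff) auto
    moreover have "closure {x. \<phi> x \<noteq> 0} \<subseteq> {p..q + \<epsilon>}"
    proof (rule closure_minimal)
      show "{x. \<phi> x \<noteq> 0} \<subseteq> {p..q + \<epsilon>}"
      proof safe
        fix x assume nz: "\<phi> x \<noteq> 0"
        have "\<phi> x = 0" if "x < p"
          using that pq \<epsilon> by (simp add: \<phi>_def B0 divide_le_0_iff)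
        moreover have "\<phi> x = 0" if "x > q + \<epsilon>"
        proof -
          have "(x - p) / \<epsilon> \<ge> 1" "(x - q) / \<epsilon> \<ge> 1" using that pq \<epsilon> by (auto simp: field_simps)
          then show ?thesis using B1[of "(x - p) / \<epsilon>"] B1[of "(x - q) / \<epsilon>"] by (simp add: \<phi>_def)
        qed
        ultimately show "x \<in> {p..q + \<epsilon>}" using nz by force
      qed
    qed simp
    ultimately have "\<phi> \<in> test_functions a b" using pq \<epsilon> by (force simp: test_functions_def)
    from 0[OF this] have "(LINT x|M. z x * vector_derivative \<phi> (at x)) = 0" .
    moreover have "vector_derivative \<phi> (at x) = of_real (k p x) - of_real (k q x)" for x
      unfolding \<phi>_def
      by (intro vector_derivative_at has_vector_derivative_diff has_vector_derivative_of_real dk)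
    ultimately have "(LINT x|M. z x * of_real (k p x) - z x * of_real (k q x)) = 0"
      by (simp add: right_diff_distrib)
    moreover have "integrable M (\<lambda>x. z x * of_real (k r x))" for r
      by (intro integrable_cont continuous_intros z ck')
    ultimately have same: "(LINT x|M. z x * of_real (k p x)) = (LINT x|M. z x * of_real (k q x))"
      by simp
    have "norm (z p * of_real (B 1) - z q * of_real (B 1)) \<le> \<delta> * B 1 + \<delta> * B 1"
      using close[OF _ _ d1(2) \<epsilon>(2)] close[OF _ _ d2(2) \<epsilon>(3)] pq \<epsilon>
        norm_triangle_ineq4[of "(LINT x|M. z x * of_real (k q x)) - z q * of_real (B 1)"
          "(LINT x|M. z x * of_real (k p x)) - z p * of_real (B 1)"]
      unfolding same by (simp add: algebra_simps)
    also have "norm (z p * of_real (B 1) - z q * of_real (B 1)) = 3 * \<delta> * B 1"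
      using Bpos by (simp add: \<delta>_def norm_mult flip: left_diff_distrib)
    finally show False using \<delta> Bpos by simp
  qed
  \<comment> \<open>Interior values are compared with the midpoint; continuity carries the constancy
    to the end points.\<close>
  define m where "m = (a + b) / 2"
  have m: "a < m" "m < b" using a_less_b by (auto simp: m_def)
  have const: "z t = z m" if "t \<in> {a<..<b}" for t
  proof (cases t m rule: linorder_cases)
    case less
    then show ?thesis using that m by (intro eq) auto
  next
    case greater
    then show ?thesis using that m by (intro eq[symmetric]) auto
  qed simp
  have cl: "closure {a<..<b} = {a..b}" using a_less_b by simp
  have "z t = z m" if "t \<in> {a..b}" for t
  proof (rule continuous_constant_on_closure[of "{a<..<b}"])
    show "continuous_on (closure {a<..<b}) z" "t \<in> closure {a<..<b}" using cl z that by simp_all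
  qed (rule const)
  note zm = this
  have "z a = z m" by (rule zm) (use a_less_b in simp)
  with zm[OF x] show ?thesis by (rule trans[OF _ sym])
qed

end

section \<open>The Sobolev space and its dual\<close>

context bounded_interval
begin

section \<open>Uniqueness of derivatives almost everywhere\<close>

text \<open>The sets over which \<open>g\<close> integrates to zero form a Dynkin system containing
  all half-lines \<open>{..x}\<close>, hence all Borel sets; null sets extend this to Lebesgue sets,
  and a density with all integrals zero vanishes almost everywhere.\<close>

lemma prim_zero_AE:
  fixes g :: "real \<Rightarrow> complex"
  assumes g: "integrable M g" and 0: "\<And>x. x \<in> {a..b} \<Longrightarrow> prim g x = 0"
  shows "AE t in M. g t = 0"
proof -
  \<comment> \<open>Extension by zero moves the integrals to the whole line, where the half-lines
    generate the Borel sets.\<close>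
  define G where "G t = indicat_real {a<..<b} t *\<^sub>R g t" for t
  have G: "integrable lebesgue G"
    using g unfolding G_def by (subst (asm) integrable_restrict_space) auto
  have G_M: "(LINT t|lebesgue. k t *\<^sub>R G t) = (LINT t|M. k t *\<^sub>R g t)" for k :: "real \<Rightarrow> real"
    unfolding G_def by (subst integral_restrict_space) (auto simp: mult.commute)
  have borel: "(LINT t:A|lebesgue. G t) = 0" if "A \<in> sets borel" for A
  proof -
    have Q: "Int_stable (range (\<lambda>x::real. {..x}))"
      by (auto simp: Int_stable_def)
    have subset_Pow: "range (\<lambda>x::real. {..x}) \<subseteq> Pow UNIV" by simp
    have iG: "integrable lebesgue (\<lambda>t. indicat_real A t *\<^sub>R G t)" if "A \<in> sets borel" for A
      using that by (intro integrable_mult_indicator G) auto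
    have tot: "integral\<^sup>L lebesgue G = 0"
      using G_M[of "\<lambda>_. 1"] 0[of b] a_less_b by (simp add: prim_b)
    from that have "A \<in> sigma_sets UNIV (range (\<lambda>x. {..x}))"
      by (simp add: borel_eq_atMost)
    with Q subset_Pow show ?thesis
    proof (induction rule: sigma_sets_induct_disjoint)
      case (basic A)
      then obtain x where x: "A = {..x}" by auto
      have "(LINT t:A|lebesgue. G t) = prim g x"
        unfolding set_lebesgue_integral_def G_M prim_def x
        by (rule Bochner_Integration.integral_cong) (auto simp: indicator_def)
      also have "\<dots> = 0"
      \<comment> \<open>A cut outside the closed interval removes everything or nothing, so these
        half-lines reduce to 0 or to the total integral.\<close>
      proof (cases "x \<in> {a..b}")
        case False
        then have "(\<forall>t\<in>{a<..<b}. \<not> t \<le> x) \<or> (\<forall>t\<in>{a<..<b}. t \<le> x)" by auto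
        then show ?thesis
        proof
          assume "\<forall>t\<in>{a<..<b}. \<not> t \<le> x"
          then show ?thesis unfolding prim_def by (intro integral_eq_zero_AE AE_M_I) auto
        next
          assume "\<forall>t\<in>{a<..<b}. t \<le> x"
          then have "prim g x = integral\<^sup>L M g"
            unfolding prim_def by (intro Bochner_Integration.integral_cong) auto
          then show ?thesis using 0[of b] a_less_b by (simp add: prim_b)
        qed
      qed (rule 0)
      finally show ?case .
    next
      case empty
      show ?case by (simp add: set_lebesgue_integral_def)
    next
      case (compl A)
      then have "A \<in> sets borel" by (simp add: borel_eq_atMost)
      have "(LINT t:UNIV - A|lebesgue. G t) = (LINT t|lebesgue. G t - indicat_real A t *\<^sub>R G t)"
        unfolding set_lebesgue_integral_def
        by (rule Bochner_Integration.integral_cong) (auto simp: indicator_def)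
      also have "\<dots> = 0"
        using G iG[OF \<open>A \<in> sets borel\<close>] compl.IH tot by (simp add: set_lebesgue_integral_def)
      finally show ?case .
    next
      case (union A)
      then have A: "A i \<in> sets borel" for i by (auto simp: borel_eq_atMost)
      have "(LINT t:(\<Union>i. A i)|lebesgue. G t) = (\<Sum>i. (LINT t:A i|lebesgue. G t))"
      proof (rule lebesgue_integral_countable_add)
        show "A i \<inter> A j = {}" if "i \<noteq> j" for i j
          using union(1) that by (auto simp: disjoint_family_on_def)
        show "set_integrable lebesgue (\<Union>i. A i) G"
          unfolding set_integrable_def using A by (intro iG) auto
      qed (use A in auto)
      then show ?case using union.IH by simp
    qed
  qed
  show ?thesis
  proof (rule M.density_zero[OF g])
    fix A assume "A \<in> sets M"
    then have A: "A \<in> sets lebesgue" by (auto simp: sets_restrict_space)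
    \<comment> \<open>A Lebesgue set differs from a Borel set by a subset of a Borel null set, which
      does not affect the integral.\<close>
    then obtain S N N' where S: "A = S \<union> N" "S \<in> sets lborel" "N \<subseteq> N'" "N' \<in> null_sets lborel"
      by (auto elim: sets_completionE)
    then have S': "S \<in> sets borel" "S \<in> sets lebesgue" by auto
    have "AE t in lebesgue. t \<notin> N'"
      using S(4) by (intro AE_not_in null_sets_completionI)
    then have *: "AE t in lebesgue. indicat_real A t *\<^sub>R G t = indicat_real S t *\<^sub>R G t"
      by eventually_elim (use S in \<open>auto simp: indicator_def\<close>)
    have "(LINT t:A|M. g t) = (LINT t|lebesgue. indicat_real A t *\<^sub>R G t)"
      by (simp add: set_lebesgue_integral_def G_M)
    also have "\<dots> = (LINT t|lebesgue. indicat_real S t *\<^sub>R G t)"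
      using integrable_mult_indicator[OF A G] integrable_mult_indicator[OF S'(2) G]
      by (intro Bochner_Integration.integral_cong_AE * borel_measurable_integrable)
    also have "\<dots> = 0" using borel[OF S'(1)] by (simp add: set_lebesgue_integral_def)
    finally show "(LINT t:A|M. g t) = 0" .
  qed
qed

lemma AC_unique:
  fixes u :: "real \<Rightarrow> complex"
  assumes "AC u g" "AC u h"
  shows "AE t in M. g t = h t"
proof -
  have d: "AC (\<lambda>_. 0) (\<lambda>x. g x - h x)" using AC_diff[OF assms] by simp
  have "AE t in M. g t - h t = 0"
    by (rule prim_zero_AE) (use d in \<open>auto simp: AC_def\<close>)
  then show ?thesis by eventually_elim simp
qed

lemma AC_weak_deriv: "AC y g \<Longrightarrow> weak_deriv a b y g"
  unfolding weak_deriv_def using AC_by_parts[OF _ test_function_AC(1)] test_function_AC(3,4) by blast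

text \<open>\<open>y\<close> and \<open>prim g\<close> give the same value against the derivative of
  every test function, the one by assumption and the other by integration by parts, so their
  difference is constant.\<close>

lemma weak_deriv_AC:
  assumes y: "continuous_on {a..b} y" and g: "g \<in> L2 a b" and w: "weak_deriv a b y g"
  shows "AC y g"
proof -
  have P: "AC (prim g) g" using L2_integrable[OF g] by (rule AC_prim)
  have const: "y x - prim g x = y a - prim g a" if x: "x \<in> {a..b}" for x
  proof (rule du_bois_reymond[OF _ _ x])
    show "continuous_on {a..b} (\<lambda>x. y x - prim g x)"
      by (intro continuous_intros y AC_continuous[OF P])
    fix \<phi> assume \<phi>: "\<phi> \<in> test_functions a b"
    note d = test_function_AC[OF \<phi>]
    have c: "continuous_on {a..b} (\<lambda>x. vector_derivative \<phi> (at x))"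
      using d(2) by (rule continuous_on_subset) simp
    have i: "integrable M (\<lambda>x. y x * vector_derivative \<phi> (at x))"
      "integrable M (\<lambda>x. prim g x * vector_derivative \<phi> (at x))"
      by (intro integrable_cont continuous_intros y c AC_continuous[OF P])+
    have "(LINT x|M. y x * vector_derivative \<phi> (at x)) = - (LINT x|M. g x * \<phi> x)"
      using w \<phi> by (auto simp: weak_deriv_def)
    moreover have "(LINT x|M. prim g x * vector_derivative \<phi> (at x)) = - (LINT x|M. g x * \<phi> x)"
      by (rule AC_by_parts[OF P d(1,3,4)])
    ultimately show "(LINT x|M. (y x - prim g x) * vector_derivative \<phi> (at x)) = 0"
      using i by (simp add: left_diff_distrib)
  qed
  have "y x = y a + prim_from a g x" if "x \<in> {a..b}" for x
    using const[OF that] by (simp add: prim_from_a diff_eq_eq add.commute)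
  with L2_integrable[OF g] show ?thesis by (rule ACI)
qed

lemma W12I:
  assumes "AC y g" "g \<in> L2 a b"
  shows "y \<in> W12 a b"
  using assms AC_weak_deriv AC_continuous L2_cont unfolding W12_def by blast

lemma W12_wderiv:
  assumes "y \<in> W12 a b"
  shows "AC y (wderiv a b y)" "wderiv a b y \<in> L2 a b" "continuous_on {a..b} y"
proof -
  have y: "continuous_on {a..b} y" "\<exists>g. g \<in> L2 a b \<and> weak_deriv a b y g"
    using assms by (auto simp: W12_def)
  have "wderiv a b y \<in> L2 a b \<and> weak_deriv a b y (wderiv a b y)"
    unfolding wderiv_def by (rule someI_ex[OF y(2)])
  then show "AC y (wderiv a b y)" "wderiv a b y \<in> L2 a b"
    using weak_deriv_AC y by auto
qed (use assms in \<open>simp add: W12_def\<close>)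

text \<open>This makes the choice in \<open>wderiv\<close> harmless: any derivative found with the
  calculus of \<open>AC\<close> may replace it under an integral.\<close>

lemma wderiv_AE:
  assumes "AC y g" "g \<in> L2 a b"
  shows "AE t in M. wderiv a b y t = g t"
  using AC_unique[OF W12_wderiv(1)[OF W12I[OF assms]] assms(1)] .

lemma W12_norm_AC:
  assumes "AC y g" "g \<in> L2 a b"
  shows "W12_norm a b y = sqrt ((L2_norm a b y)\<^sup>2 + (L2_norm a b g)\<^sup>2)"
proof -
  have "L2_norm a b (wderiv a b y) = L2_norm a b g"
    using wderiv_AE[OF assms] W12_wderiv(2)[OF W12I[OF assms]] assms(2)
    by (intro L2_norm_cong_AE) (auto simp: L2_def)
  then show ?thesis by (simp add: W12_norm_def)
qed

lemma W12_norm_nonneg [simp]: "W12_norm a b y \<ge> 0"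
  by (simp add: W12_norm_def)

lemma W12_norm_le:
  assumes "AC y g" "g \<in> L2 a b"
  shows "W12_norm a b y \<le> L2_norm a b y + L2_norm a b g"
  unfolding W12_norm_AC[OF assms] by (intro sqrt_sum_squares_le_sum) auto

lemma L2_norm_le_W12_norm:
  "L2_norm a b y \<le> W12_norm a b y" "L2_norm a b (wderiv a b y) \<le> W12_norm a b y"
  by (simp_all add: W12_norm_def real_le_rsqrt)

text \<open>Formal powers and \<open>ef\<close> are identified with explicit expressions only on the
  closed interval; these rules carry such identities into norms and functionals of total
  functions.\<close>

lemma W12_cong:
  assumes "\<And>x. x \<in> {a..b} \<Longrightarrow> y x = z x"
  shows "wderiv a b y = wderiv a b z" "W12_norm a b y = W12_norm a b z"
    "second_deriv a b y = second_deriv a b z" "y \<in> W12 a b \<longleftrightarrow> z \<in> W12 a b"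
proof -
  have "weak_deriv a b y g = weak_deriv a b z g" for g
    unfolding weak_deriv_def
    by (intro ball_cong refl arg_cong2[where f = "(=)"] Bochner_Integration.integral_cong)
      (use assms in auto)
  then show w: "wderiv a b y = wderiv a b z" by (simp add: wderiv_def)
  have "L2_norm a b y = L2_norm a b z"
    unfolding L2_norm_def
    by (intro arg_cong[where f = sqrt] Bochner_Integration.integral_cong) (use assms in auto)
  with w show "W12_norm a b y = W12_norm a b z" by (simp add: W12_norm_def)
  show "second_deriv a b y = second_deriv a b z" by (simp add: second_deriv_def w fun_eq_iff)
  show "y \<in> W12 a b \<longleftrightarrow> z \<in> W12 a b"
    using AC_cong[of y _ z] AC_cong[of z _ y] assms W12I W12_wderiv(1,2) by metis
qed

text \<open>The bound \<open>norm (y x) \<le> norm (y t) + I\<close>, where \<open>I\<close> is the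
  integral of the norm of the derivative, is averaged over \<open>t\<close>. Both resulting
  integrals are estimated by Cauchy-Schwarz against the constant 1.\<close>

lemma W12_sup_bound:
  assumes y: "y \<in> W12 a b" and x: "x \<in> {a..b}"
  shows "(b - a) * norm (y x) \<le> L2_norm a b (\<lambda>_. 1) * (1 + (b - a)) * W12_norm a b y"
proof -
  let ?g = "wderiv a b y" and ?c = "L2_norm a b (\<lambda>_. 1)"
  note g = W12_wderiv[OF y]
  have one: "(\<lambda>_. 1) \<in> L2 a b" by (rule L2_cont) simp
  have yL: "y \<in> L2 a b" by (rule L2_cont[OF g(3)])
  have bd: "(LINT t|M. norm (k t)) \<le> ?c * L2_norm a b k" if "k \<in> L2 a b" for k
    using L2_Cauchy_Schwarz(1)[OF one that] by simp
  have ik: "integrable M (\<lambda>t. norm (k t))" if "k \<in> L2 a b" for k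
    using L2_integrable[OF that] by simp
  define I where "I = (LINT t|M. norm (?g t))"
  have I: "I \<le> ?c * W12_norm a b y"
    unfolding I_def by (rule order_trans[OF bd[OF g(2)]]) (simp add: mult_left_mono L2_norm_le_W12_norm)
  have "norm (y x) \<le> norm (y t) + I" if t: "t \<in> {a<..<b}" for t
  proof -
    have nonneg: "0 \<le> prim (\<lambda>t. norm (?g t)) s" for s
      unfolding prim_def by (rule Bochner_Integration.integral_nonneg) auto
    have le: "prim (\<lambda>t. norm (?g t)) s \<le> I" for s
      unfolding prim_def I_def
      by (rule integral_mono) (use integrable_le[OF ik[OF g(2)]] ik[OF g(2)] in auto)
    have "norm (prim_from t ?g x) \<le> \<bar>prim_from t (\<lambda>t. norm (?g t)) x\<bar>"
      by (rule prim_from_bound) (use g(2) ik L2_integrable in auto)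
    also have "\<dots> \<le> I"
      unfolding prim_from_def using nonneg[of x] nonneg[of t] le[of x] le[of t] by linarith
    finally have "norm (prim_from t ?g x) \<le> I" .
    moreover have "y x = y t + prim_from t ?g x" using AC_from[OF g(1) _ x, of t] t by simp
    ultimately show ?thesis using norm_triangle_ineq[of "y t" "prim_from t ?g x"] by simp
  qed
  then have "(LINT t|M. norm (y x)) \<le> (LINT t|M. norm (y t) + I)"
    by (intro integral_mono_AE AE_M_I) (use ik[OF yL] in auto)
  also have "\<dots> = (LINT t|M. norm (y t)) + (b - a) * I"
    using ik[OF yL] a_less_b by (simp add: measure_restrict_space)
  also have "(LINT t|M. norm (y t)) \<le> ?c * W12_norm a b y"
    by (rule order_trans[OF bd[OF yL]]) (simp add: mult_left_mono L2_norm_le_W12_norm)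
  also have "(LINT t|M. norm (y x)) = (b - a) * norm (y x)"
    using a_less_b by (simp add: measure_restrict_space)
  finally have "(b - a) * norm (y x) \<le> ?c * W12_norm a b y + (b - a) * I" by simp
  also have "\<dots> \<le> ?c * W12_norm a b y + (b - a) * (?c * W12_norm a b y)"
    using I a_less_b by simp
  finally show ?thesis by (simp add: algebra_simps)
qed

section \<open>The closure of the test functions\<close>

lemma test_function_W12:
  assumes "\<phi> \<in> test_functions a b" shows "\<phi> \<in> W12 a b"
proof -
  have "(\<lambda>x. vector_derivative \<phi> (at x)) \<in> L2 a b"
    using test_function_AC(2)[OF assms] by (intro L2_cont) (rule continuous_on_subset, auto)
  then show ?thesis using test_function_AC(1)[OF assms] by (rule W12I[rotated])
qed

lemma W12_norm_0: "W12_norm a b (\<lambda>_. 0) = 0"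
proof -
  have "(\<lambda>_. 0) \<in> L2 a b" by (rule L2_cont) simp
  then show ?thesis using W12_norm_AC[OF AC_const] by (simp add: L2_norm_def)
qed

lemma test_function_W12_0:
  assumes "\<phi> \<in> test_functions a b" shows "\<phi> \<in> W12_0 a b"
  unfolding W12_0_def
  using assms test_function_W12[OF assms] by (auto intro!: exI[of _ "\<lambda>_. \<phi>"] simp: W12_norm_0)

lemma W12_diff: "y \<in> W12 a b \<Longrightarrow> z \<in> W12 a b \<Longrightarrow> (\<lambda>x. y x - z x) \<in> W12 a b"
  by (rule W12I[OF AC_diff L2_diff]) (rule W12_wderiv, assumption)+

text \<open>By \<open>W12_sup_bound\<close> convergence in the W12 norm is uniform on the closed
  interval, so the zero end values of test functions survive in the limit.\<close>

lemma W12_0_ends: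
  assumes "\<phi> \<in> W12_0 a b"
  shows "\<phi> \<in> W12 a b" "\<phi> a = 0" "\<phi> b = 0"
proof -
  show \<phi>: "\<phi> \<in> W12 a b" using assms by (simp add: W12_0_def)
  obtain \<psi> where \<psi>: "\<And>n. \<psi> n \<in> test_functions a b"
    and lim: "(\<lambda>n. W12_norm a b (\<lambda>x. \<psi> n x - \<phi> x)) \<longlonglongrightarrow> 0"
    using assms by (auto simp: W12_0_def)
  define C where "C = L2_norm a b (\<lambda>_. 1) * (1 + (b - a))"
  have z: "\<phi> x = 0" if x: "x \<in> {a..b}" and e: "\<And>n. \<psi> n x = 0" for x
  proof -
    have "(b - a) * norm (\<psi> n x - \<phi> x) \<le> C * W12_norm a b (\<lambda>x. \<psi> n x - \<phi> x)" for n
      unfolding C_def by (rule W12_sup_bound[OF W12_diff[OF test_function_W12[OF \<psi>] \<phi>] x])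
    then have "(b - a) * norm (\<phi> x) \<le> C * W12_norm a b (\<lambda>x. \<psi> n x - \<phi> x)" for n
      by (simp add: e)
    moreover have "(\<lambda>n. C * W12_norm a b (\<lambda>x. \<psi> n x - \<phi> x)) \<longlonglongrightarrow> C * 0"
      by (intro tendsto_intros lim)
    ultimately have "(b - a) * norm (\<phi> x) \<le> C * 0"
      by (intro LIMSEQ_le_const) auto
    then show ?thesis using a_less_b by (simp add: mult_le_0_iff)
  qed
  show "\<phi> a = 0" "\<phi> b = 0"
    using z[of a] z[of b] a_less_b test_function_AC(3,4)[OF \<psi>] by auto
qed

text \<open>This makes the set over which \<open>Wm12_norm\<close> takes its supremum
  nonempty.\<close>

lemma zero_W12_0: "(\<lambda>_. 0) \<in> W12_0 a b"
proof (rule test_function_W12_0)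
  have "smooth (\<lambda>_. 0)"
    by (rule smooth_coinduct[where X = "\<lambda>f. f = (\<lambda>_. 0)"]) auto
  then show "(\<lambda>_. 0) \<in> test_functions a b" by (simp add: test_functions_def)
qed

section \<open>The second derivative as a bounded functional\<close>

lemma second_deriv_AC:
  assumes "AC y g" "g \<in> L2 a b" "AC \<phi> h" "h \<in> L2 a b"
  shows "second_deriv a b y \<phi> = - (LINT x|M. g x * h x)"
  unfolding second_deriv_def
proof (intro arg_cong[where f = uminus] Bochner_Integration.integral_cong_AE)
  show "AE x in M. wderiv a b y x * wderiv a b \<phi> x = g x * h x"
    using wderiv_AE[OF assms(1,2)] wderiv_AE[OF assms(3,4)] by eventually_elim simp
  have [measurable]: "wderiv a b y \<in> borel_measurable M" "wderiv a b \<phi> \<in> borel_measurable M"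
    "g \<in> borel_measurable M" "h \<in> borel_measurable M"
    using W12_wderiv(2)[OF W12I[OF assms(1,2)]] W12_wderiv(2)[OF W12I[OF assms(3,4)]] assms(2,4)
    by (auto simp: L2_def)
  show "(\<lambda>x. wderiv a b y x * wderiv a b \<phi> x) \<in> borel_measurable M"
    "(\<lambda>x. g x * h x) \<in> borel_measurable M" by measurable
qed

lemma second_deriv_bound:
  assumes "y \<in> W12 a b" "\<phi> \<in> W12 a b"
  shows "norm (second_deriv a b y \<phi>) \<le> W12_norm a b y * W12_norm a b \<phi>"
proof -
  have "norm (second_deriv a b y \<phi>) \<le> L2_norm a b (wderiv a b y) * L2_norm a b (wderiv a b \<phi>)"
    unfolding second_deriv_def norm_minus_cancel
    by (rule L2_Cauchy_Schwarz(2)) (use assms W12_wderiv in auto)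
  also have "\<dots> \<le> W12_norm a b y * W12_norm a b \<phi>"
    by (intro mult_mono L2_norm_le_W12_norm) auto
  finally show ?thesis .
qed

lemma second_deriv_Wm12:
  assumes y: "y \<in> W12 a b"
  shows "second_deriv a b y \<in> Wm12 a b"
  unfolding Wm12_def
proof (intro CollectI conjI ballI allI exI[of _ "W12_norm a b y"])
  note g = W12_wderiv[OF y]
  fix \<phi> \<psi> assume "\<phi> \<in> W12_0 a b" "\<psi> \<in> W12_0 a b"
  then have W: "\<phi> \<in> W12 a b" "\<psi> \<in> W12 a b" by (auto dest: W12_0_ends)
  note h = W12_wderiv[OF W(1)] and k = W12_wderiv[OF W(2)]
  show "second_deriv a b y (\<lambda>x. \<phi> x + \<psi> x) = second_deriv a b y \<phi> + second_deriv a b y \<psi>"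
    using L2_mult_integrable(2)[OF g(2) h(2)] L2_mult_integrable(2)[OF g(2) k(2)]
    by (subst second_deriv_AC[OF g(1,2) AC_add[OF h(1) k(1)] L2_add[OF h(2) k(2)]])
      (simp add: second_deriv_def distrib_left)
next
  note g = W12_wderiv[OF y]
  fix c \<phi> assume "\<phi> \<in> W12_0 a b"
  then have W: "\<phi> \<in> W12 a b" by (auto dest: W12_0_ends)
  note h = W12_wderiv[OF W]
  show "second_deriv a b y (\<lambda>x. c * \<phi> x) = c * second_deriv a b y \<phi>"
    using L2_mult_integrable(2)[OF g(2) h(2)]
    by (subst second_deriv_AC[OF g(1,2) AC_cmult[OF h(1)] L2_cmult[OF h(2)]])
      (simp add: second_deriv_def mult.left_commute)
next
  fix \<phi> assume "\<phi> \<in> W12_0 a b"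
  then show "norm (second_deriv a b y \<phi>) \<le> W12_norm a b y * W12_norm a b \<phi>"
    using second_deriv_bound y W12_0_ends(1) by blast
qed

text \<open>\<open>T\<close> is compared with a second derivative only on \<open>W12_0\<close>,
  since this is how the remainder functionals of the series are known. A real supremum is meaningful
  for nonempty sets bounded above: the zero function gives the first, the estimate by the norm of
  \<open>w\<close> the second.\<close>

lemma Wm12_norm_second_deriv:
  assumes w: "w \<in> W12 a b" and T: "\<And>\<phi>. \<phi> \<in> W12_0 a b \<Longrightarrow> T \<phi> = second_deriv a b w \<phi>"
  shows "0 \<le> Wm12_norm a b T" "Wm12_norm a b T \<le> W12_norm a b w"
proof -
  have zero: "(\<lambda>_. 0) \<in> {\<phi> \<in> W12_0 a b. W12_norm a b \<phi> \<le> 1}"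
    by (simp add: zero_W12_0 W12_norm_0)
  have bd: "norm (T \<phi>) \<le> W12_norm a b w" if "\<phi> \<in> {\<phi> \<in> W12_0 a b. W12_norm a b \<phi> \<le> 1}" for \<phi>
  proof -
    have "norm (T \<phi>) \<le> W12_norm a b w * W12_norm a b \<phi>"
      using that T second_deriv_bound[OF w] W12_0_ends(1) by simp
    also have "\<dots> \<le> W12_norm a b w * 1"
      using that by (intro mult_left_mono) auto
    finally show ?thesis by simp
  qed
  show "Wm12_norm a b T \<le> W12_norm a b w"
    unfolding Wm12_norm_def using zero bd by (intro cSUP_least) auto
  have "norm (T (\<lambda>_. 0)) \<le> Wm12_norm a b T"
    unfolding Wm12_norm_def using zero bd
    by (intro cSUP_upper bdd_aboveI2[where M = "W12_norm a b w"]) auto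
  then show "0 \<le> Wm12_norm a b T" using norm_ge_zero order_trans by blast
qed

text \<open>\<open>wderiv\<close> is a choice and need not be additive at every point; linearity is
  recovered under the integral, where almost everywhere equality is enough.\<close>

lemma second_deriv_diff_sum:
  assumes y: "y \<in> W12 a b" and u: "\<And>k. u k \<in> W12 a b" and \<phi>: "\<phi> \<in> W12 a b"
  shows "second_deriv a b y \<phi> - (\<Sum>k<n. second_deriv a b (u k) \<phi>)
    = second_deriv a b (\<lambda>x. y x - (\<Sum>k<n. u k x)) \<phi>"
proof -
  note g = W12_wderiv[OF y] and h = W12_wderiv[OF \<phi>] and k = W12_wderiv[OF u]
  have "second_deriv a b (\<lambda>x. y x - (\<Sum>k<n. u k x)) \<phi>
      = - (LINT x|M. (wderiv a b y x - (\<Sum>k<n. wderiv a b (u k) x)) * wderiv a b \<phi> x)"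
    by (intro second_deriv_AC AC_diff AC_sum L2_diff L2_sum g h k)
  also have "\<dots> = - (LINT x|M. wderiv a b y x * wderiv a b \<phi> x
      - (\<Sum>k<n. wderiv a b (u k) x * wderiv a b \<phi> x))"
    by (simp add: left_diff_distrib sum_distrib_right)
  also have "\<dots> = second_deriv a b y \<phi> - (\<Sum>k<n. second_deriv a b (u k) \<phi>)"
    using L2_mult_integrable(2)[OF g(2) h(2)] L2_mult_integrable(2)[OF k(2) h(2)]
    by (simp add: second_deriv_def sum_negf)
  finally show ?thesis ..
qed

end

section \<open>The equivalent first-order system\<close>

locale nonvanishing_W12 = bounded_interval a b for a b :: real +
  fixes f :: "real \<Rightarrow> complex" and x0 :: real
  assumes x0: "x0 \<in> {a..b}" and f: "f \<in> W12 a b"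
    and f_nz: "x \<in> {a..b} \<Longrightarrow> f x \<noteq> 0" and f_x0: "f x0 = 1"
begin

abbreviation f' :: "real \<Rightarrow> complex" where
  "f' \<equiv> wderiv a b f"

lemma f_AC: "AC f f'" and f'_L2: "f' \<in> L2 a b" and f_cont: "continuous_on {a..b} f"
  using W12_wderiv[OF f] by auto

lemma inv_f_cont: "continuous_on {a..b} (\<lambda>x. 1 / f x)" "continuous_on {a..b} (\<lambda>x. 1 / (f x)\<^sup>2)"
  using f_nz by (auto intro!: continuous_intros f_cont)

lemma inv_f_AC: "AC (\<lambda>x. 1 / f x) (\<lambda>x. - f' x / (f x)\<^sup>2)"
  using AC_inverse[OF f_AC f_nz] .

lemma L2_divide_f: "g \<in> L2 a b \<Longrightarrow> (\<lambda>x. g x / f x) \<in> L2 a b"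
  "g \<in> L2 a b \<Longrightarrow> (\<lambda>x. g x / (f x)\<^sup>2) \<in> L2 a b"
  using L2_mult_cont[OF _ inv_f_cont(1)] L2_mult_cont[OF _ inv_f_cont(2)] by auto

lemma cont_mult_L2: "g \<in> L2 a b \<Longrightarrow> continuous_on {a..b} h \<Longrightarrow> (\<lambda>x. h x * g x) \<in> L2 a b"
  using L2_mult_cont[of g h] by (simp add: mult.commute)

text \<open>Here \<open>u\<close> stands for \<open>Dop a b f y\<close>. Substituting it cancels the
  quadratic term of the potential, and what remains is the weak form of the factorisation of the
  operator into two first-order ones. Agreement of \<open>u\<close> almost everywhere is enough, so
  its continuous representative may be inserted.\<close>

lemma Sop_eq:
  assumes y: "AC y g" "g \<in> L2 a b" and \<phi>: "AC \<phi> h" "h \<in> L2 a b"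
    and u: "AE x in M. u x = g x - f' x / f x * y x" "u \<in> L2 a b"
  shows "Sop a b f y \<phi> = (LINT x|M. u x * h x) - (LINT x|M. f' x / f x * u x * \<phi> x)"
proof -
  let ?q = "\<lambda>x. f' x / f x"
  have q: "?q \<in> L2 a b" by (rule L2_divide_f(1)[OF f'_L2])
  have cy: "continuous_on {a..b} y" "continuous_on {a..b} \<phi>" using y \<phi> by (auto intro: AC_continuous)
  note p = AC_mult[OF y(1) \<phi>(1)]
  have pL: "(\<lambda>x. g x * \<phi> x + y x * h x) \<in> L2 a b"
    by (intro L2_add L2_mult_cont cont_mult_L2 y \<phi> cy)
  have [measurable]: "g \<in> borel_measurable M" "h \<in> borel_measurable M" "u \<in> borel_measurable M"
    "?q \<in> borel_measurable M" "y \<in> borel_measurable M" "\<phi> \<in> borel_measurable M"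
    "wderiv a b y \<in> borel_measurable M" "wderiv a b \<phi> \<in> borel_measurable M"
    "wderiv a b (\<lambda>x. y x * \<phi> x) \<in> borel_measurable M"
    using y(2) \<phi>(2) u(2) q cy W12_wderiv(2)[OF W12I[OF y]] W12_wderiv(2)[OF W12I[OF \<phi>]]
      W12_wderiv(2)[OF W12I[OF p pL]] by (auto intro: cont_measurable_M L2_measurable)
  have i1: "integrable M (\<lambda>x. g x * h x)" by (rule L2_mult_integrable(2)[OF y(2) \<phi>(2)])
  have i2: "integrable M (\<lambda>x. u x * h x)" by (rule L2_mult_integrable(2)[OF u(2) \<phi>(2)])
  have i3: "integrable M (\<lambda>x. ?q x * (u x * \<phi> x))"
    by (rule L2_mult_integrable(2)[OF q L2_mult_cont[OF u(2) cy(2)]])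
  have i4: "integrable M (\<lambda>x. ?q x * (y x * h x))"
    by (rule L2_mult_integrable(2)[OF q cont_mult_L2[OF \<phi>(2) cy(1)]])
  \<comment> \<open>The terms are grouped so that each becomes a product of two L2 functions:
    \<open>?q\<close> with \<open>u * \<phi>\<close>, and \<open>?q\<close> with
    \<open>y * h\<close>.\<close>
  have alg: "Q\<^sup>2 * (Y * P) - Q * (G * P + Y * H) = - (Q * ((G - Q * Y) * P)) - Q * (Y * H)"
    for Q Y P G H :: complex
    by (simp add: power2_eq_square algebra_simps)
  have "(LINT x|M. wderiv a b y x * wderiv a b \<phi> x) = (LINT x|M. g x * h x)"
    using second_deriv_AC[OF y \<phi>] by (simp add: second_deriv_def)
  moreover have "potential a b f (\<lambda>x. y x * \<phi> x)
     = (LINT x|M. - (?q x * (u x * \<phi> x)) - ?q x * (y x * h x))"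
    unfolding potential_def
  proof (rule Bochner_Integration.integral_cong_AE)
    show "AE x in M. (?q x)\<^sup>2 * (y x * \<phi> x) - ?q x * wderiv a b (\<lambda>x. y x * \<phi> x) x
       = - (?q x * (u x * \<phi> x)) - ?q x * (y x * h x)"
      using wderiv_AE[OF p pL] u(1)
      by eventually_elim (simp only: alg)
  qed measurable
  moreover have "\<dots> = (LINT x|M. - (?q x * (u x * \<phi> x))) - (LINT x|M. ?q x * (y x * h x))"
    using i3 i4 by (intro Bochner_Integration.integral_diff) auto
  ultimately have "Sop a b f y \<phi> = (LINT x|M. g x * h x) - (LINT x|M. ?q x * (y x * h x))
      - (LINT x|M. ?q x * (u x * \<phi> x))"
    by (simp add: Sop_def)
  also have "(LINT x|M. g x * h x) - (LINT x|M. ?q x * (y x * h x)) = (LINT x|M. g x * h x - ?q x * (y x * h x))"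
    using i1 i4 by simp
  also have "\<dots> = (LINT x|M. u x * h x)"
  proof (rule Bochner_Integration.integral_cong_AE)
    show "AE x in M. g x * h x - ?q x * (y x * h x) = u x * h x"
      using u(1) by eventually_elim algebra
  qed measurable
  finally show ?thesis by (simp add: mult.assoc)
qed

lemma AC_divide_f:
  assumes y: "AC y g" and gL: "g \<in> L2 a b"
  shows "AC (\<lambda>x. y x / f x) (\<lambda>x. (g x - f' x / f x * y x) / f x)"
    and "(\<lambda>x. (g x - f' x / f x * y x) / f x) \<in> L2 a b"
proof -
  have "AC (\<lambda>x. y x * (1 / f x)) (\<lambda>x. g x * (1 / f x) + y x * (- f' x / (f x)\<^sup>2))"
    by (rule AC_mult[OF y inv_f_AC])
  then have "AC (\<lambda>x. y x / f x) (\<lambda>x. g x * (1 / f x) + y x * (- f' x / (f x)\<^sup>2))" by simp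
  then show "AC (\<lambda>x. y x / f x) (\<lambda>x. (g x - f' x / f x * y x) / f x)"
    by (rule AC_cong_deriv) (use f_nz in \<open>simp add: field_simps power2_eq_square\<close>)
  show "(\<lambda>x. (g x - f' x / f x * y x) / f x) \<in> L2 a b"
    by (intro L2_divide_f L2_diff L2_mult_cont gL f'_L2 AC_continuous[OF y])
qed

text \<open>The continuous representative of \<open>Dop a b f y\<close> is \<open>U / f\<close>,
  with derivative \<open>- (\<rho>\<^sup>2 * f * Y)\<close> minus \<open>f' / f\<close> times
  itself. After one integration by parts in \<open>Sop_eq\<close> the terms with
  \<open>f' / f\<close> cancel and leave \<open>\<rho>\<^sup>2 * y\<close>.\<close>

lemma ef_solutionI:
  assumes Y: "AC Y (\<lambda>x. U x / (f x)\<^sup>2)" and U: "AC U (\<lambda>x. - (\<rho>\<^sup>2 * (f x)\<^sup>2 * Y x))"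
    and init: "Y x0 = 1" "U x0 = \<i> * \<rho>" and y: "\<And>x. x \<in> {a..b} \<Longrightarrow> y x = f x * Y x"
  shows "ef_solution a b f x0 \<rho> y"
proof -
  let ?q = "\<lambda>x. f' x / f x"
  let ?g = "\<lambda>x. f' x * Y x + U x / f x" and ?u = "\<lambda>x. U x / f x"
  let ?u' = "\<lambda>x. - (\<rho>\<^sup>2 * f x * Y x) - ?q x * ?u x"
  have c: "continuous_on {a..b} Y" "continuous_on {a..b} U" using Y U by (auto intro: AC_continuous)
  have cu: "continuous_on {a..b} ?u" using f_nz by (intro continuous_intros c f_cont) auto
  have "AC (\<lambda>x. f x * Y x) (\<lambda>x. f' x * Y x + f x * (U x / (f x)\<^sup>2))" by (rule AC_mult[OF f_AC Y])
  then have "AC (\<lambda>x. f x * Y x) ?g"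
    by (rule AC_cong_deriv) (use f_nz in \<open>simp add: field_simps power2_eq_square\<close>)
  then have yAC: "AC y ?g" by (rule AC_cong) (simp add: y)
  have gL: "?g \<in> L2 a b" by (intro L2_add L2_mult_cont f'_L2 L2_cont c cu)
  have yW: "y \<in> W12 a b" using yAC gL by (rule W12I)
  have "AC (\<lambda>x. U x * (1 / f x)) (\<lambda>x. - (\<rho>\<^sup>2 * (f x)\<^sup>2 * Y x) * (1 / f x) + U x * (- f' x / (f x)\<^sup>2))"
    by (rule AC_mult[OF U inv_f_AC])
  then have "AC ?u (\<lambda>x. - (\<rho>\<^sup>2 * (f x)\<^sup>2 * Y x) * (1 / f x) + U x * (- f' x / (f x)\<^sup>2))" by simp
  then have uAC: "AC ?u ?u'"
    by (rule AC_cong_deriv) (use f_nz in \<open>simp add: field_simps power2_eq_square\<close>)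
  have u'L: "?u' \<in> L2 a b"
    by (intro L2_diff L2_mult_cont L2_divide_f f'_L2 cu) (intro L2_cont continuous_intros c f_cont)
  have uL: "?u \<in> L2 a b" by (rule L2_cont[OF cu])
  have cy: "continuous_on {a..b} y" using yAC by (rule AC_continuous)
  have given: "given_by a b (Sop a b f y) (\<lambda>x. \<rho>\<^sup>2 * y x)"
    unfolding given_by_def
  proof (intro conjI ballI)
    show "(\<lambda>x. \<rho>\<^sup>2 * y x) \<in> L2 a b" by (intro L2_cont continuous_intros cy)
    fix \<phi> assume \<phi>: "\<phi> \<in> W12_0 a b"
    note h = W12_wderiv[OF W12_0_ends(1)[OF \<phi>]]
    have ae: "AE x in M. ?u x = ?g x - ?q x * y x"
      by (rule AE_M_I) (use f_nz y in \<open>simp add: field_simps\<close>)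
    have i1: "integrable M (\<lambda>x. ?u' x * \<phi> x)"
      by (rule integrable_mult_cont[OF L2_integrable[OF u'L] h(3)])
    have i2: "integrable M (\<lambda>x. ?q x * ?u x * \<phi> x)"
      by (rule integrable_mult_cont[OF L2_integrable[OF L2_mult_cont[OF L2_divide_f(1)[OF f'_L2] cu]] h(3)])
    have "Sop a b f y \<phi> = (LINT x|M. ?u x * wderiv a b \<phi> x) - (LINT x|M. ?q x * ?u x * \<phi> x)"
      by (rule Sop_eq[OF yAC gL h(1,2) ae uL])
    also have "(LINT x|M. ?u x * wderiv a b \<phi> x) = - (LINT x|M. ?u' x * \<phi> x)"
      by (rule AC_by_parts[OF uAC h(1) W12_0_ends(2,3)[OF \<phi>]])
    also have "- (LINT x|M. ?u' x * \<phi> x) - (LINT x|M. ?q x * ?u x * \<phi> x)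
        = - (LINT x|M. ?u' x * \<phi> x + ?q x * ?u x * \<phi> x)"
      using i1 i2 by simp
    also have "\<dots> = (LINT x|M. - (?u' x * \<phi> x + ?q x * ?u x * \<phi> x))"
      by (rule Bochner_Integration.integral_minus[symmetric])
    also have "\<dots> = (LINT x|M. \<rho>\<^sup>2 * y x * \<phi> x)"
      by (rule Bochner_Integration.integral_cong) (auto simp: y algebra_simps)
    finally show "Sop a b f y \<phi> = (LINT x|M. \<rho>\<^sup>2 * y x * \<phi> x)" .
  qed
  have "AC (\<lambda>t. y t / f t) (\<lambda>x. U x / (f x)\<^sup>2)"
    by (rule AC_cong[OF Y]) (use y f_nz in auto)
  moreover have "(\<lambda>x. U x / (f x)\<^sup>2) \<in> L2 a b" by (intro L2_divide_f L2_cont c)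
  ultimately have "AE t in M. wderiv a b (\<lambda>t. y t / f t) t = U t / (f t)\<^sup>2" by (rule wderiv_AE)
  moreover have "AE t in M. f t \<noteq> 0" by (rule AE_M_I) (use f_nz in auto)
  ultimately have "AE t in M. ?u t = Dop a b f y t"
    by eventually_elim (simp add: Dop_def power2_eq_square)
  \<comment> \<open>At the base point \<open>U / f\<close> equals \<open>U\<close>, because
    \<open>f x0 = 1\<close>.\<close>
  then have "Dop_value a b f y x0 (\<i> * \<rho>)"
    unfolding Dop_value_def using W12I[OF uAC u'L] init(2) f_x0 by (intro bexI[of _ ?u]) auto
  then show ?thesis
    unfolding ef_solution_def Sop_domain_def using yW given y[OF x0] init(1) f_x0 by auto
qed

text \<open>\<open>r\<close> is the residual of the equation in strong form. Testing shows that it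
  vanishes almost everywhere, and then \<open>U = f * u\<close> has derivative
  \<open>f * (r - \<rho>\<^sup>2 * y)\<close>, which is the second equation of the system.\<close>

lemma ef_solutionD:
  assumes y: "ef_solution a b f x0 \<rho> y"
  obtains U where "AC (\<lambda>x. y x / f x) (\<lambda>x. U x / (f x)\<^sup>2)"
    "AC U (\<lambda>x. - (\<rho>\<^sup>2 * (f x)\<^sup>2 * (y x / f x)))" "U x0 = \<i> * \<rho>"
proof -
  let ?q = "\<lambda>x. f' x / f x"
  have yW: "y \<in> W12 a b" and given: "given_by a b (Sop a b f y) (\<lambda>x. \<rho>\<^sup>2 * y x)"
    and "Dop_value a b f y x0 (\<i> * \<rho>)"
    using y by (auto simp: ef_solution_def Sop_domain_def)
  then obtain u where u: "u \<in> W12 a b" "AE t in M. u t = Dop a b f y t" "u x0 = \<i> * \<rho>"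
    by (auto simp: Dop_value_def)
  note g = W12_wderiv[OF yW] and u' = W12_wderiv[OF u(1)]
  have nz: "AE t in M. f t \<noteq> 0" by (rule AE_M_I) (use f_nz in auto)
  note dy = AC_divide_f[OF g(1,2)]
  have ae: "AE t in M. u t = wderiv a b y t - ?q t * y t"
    using u(2) wderiv_AE[OF dy] nz by eventually_elim (simp add: Dop_def)
  have uL: "u \<in> L2 a b" using u'(3) by (rule L2_cont)
  define r where "r x = wderiv a b u x + ?q x * u x + \<rho>\<^sup>2 * y x" for x
  have rL: "r \<in> L2 a b"
    unfolding r_def by (intro L2_add u' L2_mult_cont L2_divide_f f'_L2 L2_cmult L2_cont[OF g(3)])
  \<comment> \<open>That \<open>r\<close> annihilates all test functions is expressed as being a
    weak derivative of zero, so uniqueness of derivatives gives \<open>r = 0\<close>.\<close>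
  have "weak_deriv a b (\<lambda>_. 0) r"
    unfolding weak_deriv_def
  proof
    fix \<phi> assume \<phi>: "\<phi> \<in> test_functions a b"
    note h = W12_wderiv[OF test_function_W12[OF \<phi>]] and e = test_function_AC(3,4)[OF \<phi>]
    have "(LINT x|M. \<rho>\<^sup>2 * y x * \<phi> x) = Sop a b f y \<phi>"
      using given test_function_W12_0[OF \<phi>] by (simp add: given_by_def)
    also have "\<dots> = (LINT x|M. u x * wderiv a b \<phi> x) - (LINT x|M. ?q x * u x * \<phi> x)"
      by (rule Sop_eq[OF g(1,2) h(1,2) ae uL])
    also have "(LINT x|M. u x * wderiv a b \<phi> x) = - (LINT x|M. wderiv a b u x * \<phi> x)"
      by (rule AC_by_parts[OF u'(1) h(1) e])
    finally have "(LINT x|M. wderiv a b u x * \<phi> x) + (LINT x|M. ?q x * u x * \<phi> x)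
        + (LINT x|M. \<rho>\<^sup>2 * y x * \<phi> x) = 0" by simp
    moreover have "integrable M (\<lambda>x. wderiv a b u x * \<phi> x)"
      by (rule integrable_mult_cont[OF L2_integrable[OF u'(2)] h(3)])
    moreover have "integrable M (\<lambda>x. ?q x * u x * \<phi> x)"
      by (rule integrable_mult_cont[OF L2_integrable[OF L2_mult_cont[OF L2_divide_f(1)[OF f'_L2] u'(3)]] h(3)])
    moreover have "integrable M (\<lambda>x. \<rho>\<^sup>2 * y x * \<phi> x)"
      by (intro integrable_cont continuous_intros g h)
    ultimately have "(LINT x|M. r x * \<phi> x) = 0"
      by (simp add: r_def distrib_right)
    then show "(LINT x|M. 0 * vector_derivative \<phi> (at x)) = - (LINT x|M. r x * \<phi> x)" by simp
  qed
  then have "AC (\<lambda>_. 0) r" using rL by (intro weak_deriv_AC) auto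
  then have r0: "AE t in M. r t = 0" by (rule AC_unique) (rule AC_const)
  define U where "U x = f x * u x" for x
  have "AC U (\<lambda>x. f' x * u x + f x * wderiv a b u x)"
    unfolding U_def by (rule AC_mult[OF f_AC u'(1)])
  moreover have "AE t in M. f' t * u t + f t * wderiv a b u t = - (\<rho>\<^sup>2 * (f t)\<^sup>2 * (y t / f t))"
    using r0 nz
  proof eventually_elim
    case (elim t)
    have "f' t * u t + f t * wderiv a b u t = f t * (r t - \<rho>\<^sup>2 * y t)"
      using elim(2) by (simp add: r_def field_simps)
    then show ?case using elim by (simp add: power2_eq_square)
  qed
  moreover have "(\<lambda>x. - (\<rho>\<^sup>2 * (f x)\<^sup>2 * (y x / f x))) \<in> borel_measurable M"
    using f_nz by (intro cont_measurable_M continuous_intros f_cont g) auto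
  ultimately have "AC U (\<lambda>x. - (\<rho>\<^sup>2 * (f x)\<^sup>2 * (y x / f x)))" by (rule AC_cong_AE)
  moreover have "AC (\<lambda>x. y x / f x) (\<lambda>x. U x / (f x)\<^sup>2)"
  proof (rule AC_cong_AE[OF dy(1)])
    show "AE x in M. (wderiv a b y x - ?q x * y x) / f x = U x / (f x)\<^sup>2"
      using ae nz by eventually_elim (simp add: U_def power2_eq_square)
    show "(\<lambda>x. U x / (f x)\<^sup>2) \<in> borel_measurable M"
      unfolding U_def using f_nz by (intro cont_measurable_M continuous_intros f_cont u') auto
  qed
  moreover have "U x0 = \<i> * \<rho>" by (simp add: U_def f_x0 u)
  ultimately show ?thesis using that by blast
qed

text \<open>The differences \<open>Y\<close> and \<open>W\<close> of the two components solve the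
  homogeneous system with zero data at \<open>x0\<close>; Gronwall's lemma applies to the sum of
  their norms with the sum of the two coefficient norms as weight.\<close>

lemma ef_solution_unique:
  assumes y: "ef_solution a b f x0 \<rho> y" and z: "ef_solution a b f x0 \<rho> z" and x: "x \<in> {a..b}"
  shows "y x = z x"
proof -
  obtain U where U: "AC (\<lambda>x. y x / f x) (\<lambda>x. U x / (f x)\<^sup>2)"
    "AC U (\<lambda>x. - (\<rho>\<^sup>2 * (f x)\<^sup>2 * (y x / f x)))" "U x0 = \<i> * \<rho>"
    by (rule ef_solutionD[OF y])
  obtain V where V: "AC (\<lambda>x. z x / f x) (\<lambda>x. V x / (f x)\<^sup>2)"
    "AC V (\<lambda>x. - (\<rho>\<^sup>2 * (f x)\<^sup>2 * (z x / f x)))" "V x0 = \<i> * \<rho>"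
    by (rule ef_solutionD[OF z])
  define Y where "Y x = y x / f x - z x / f x" for x
  define W where "W x = U x - V x" for x
  have Y: "AC Y (\<lambda>x. W x / (f x)\<^sup>2)"
    using AC_diff[OF U(1) V(1)] unfolding Y_def W_def by (simp add: diff_divide_distrib)
  have "AC W (\<lambda>x. - (\<rho>\<^sup>2 * (f x)\<^sup>2 * (y x / f x)) - - (\<rho>\<^sup>2 * (f x)\<^sup>2 * (z x / f x)))"
    unfolding W_def by (rule AC_diff[OF U(2) V(2)])
  then have W: "AC W (\<lambda>x. - (\<rho>\<^sup>2 * (f x)\<^sup>2 * Y x))"
    by (rule AC_cong_deriv) (simp add: Y_def right_diff_distrib)
  have 0: "Y x0 = 0" "W x0 = 0"
    using y z U(3) V(3) by (auto simp: Y_def W_def ef_solution_def)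
  have c: "continuous_on {a..b} Y" "continuous_on {a..b} W" using Y W by (auto intro: AC_continuous)
  define k where "k x = norm (1 / (f x)\<^sup>2) + norm (\<rho>\<^sup>2 * (f x)\<^sup>2)" for x
  define m where "m x = norm (Y x) + norm (W x)" for x
  have cm: "continuous_on {a..b} m" unfolding m_def by (intro continuous_intros c)
  have ck: "continuous_on {a..b} k"
    unfolding k_def using f_nz by (intro continuous_intros f_cont) auto
  have ikm: "integrable M (\<lambda>t. k t * m t)" by (intro integrable_cont continuous_intros ck cm)
  have i1: "integrable M (\<lambda>t. norm (1 / (f t)\<^sup>2) * norm (W t))"
    and i2: "integrable M (\<lambda>t. norm (\<rho>\<^sup>2 * (f t)\<^sup>2) * norm (Y t))"
    using f_nz by (auto intro!: integrable_cont continuous_intros f_cont c)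
  have "m x = 0"
  proof (rule gronwall_zero[OF integrable_cont[OF ck] _ x0 cm _ _ x])
    fix x assume x: "x \<in> {a..b}"
    let ?k1 = "\<lambda>t. norm (1 / (f t)\<^sup>2) * norm (W t)" and ?k2 = "\<lambda>t. norm (\<rho>\<^sup>2 * (f t)\<^sup>2) * norm (Y t)"
    have "norm (Y x) \<le> \<bar>prim_from x0 ?k1 x\<bar>"
    proof -
      have "norm (prim_from x0 (\<lambda>x. W x / (f x)\<^sup>2) x) \<le> \<bar>prim_from x0 ?k1 x\<bar>"
        by (rule prim_from_bound[OF AC_integrable[OF Y] i1]) (simp add: norm_divide)
      then show ?thesis using AC_from[OF Y x0 x] 0 by simp
    qed
    moreover have "norm (W x) \<le> \<bar>prim_from x0 ?k2 x\<bar>"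
    proof -
      have "norm (prim_from x0 (\<lambda>x. - (\<rho>\<^sup>2 * (f x)\<^sup>2 * Y x)) x) \<le> \<bar>prim_from x0 ?k2 x\<bar>"
        by (rule prim_from_bound[OF AC_integrable[OF W] i2]) (simp add: norm_mult)
      then show ?thesis using AC_from[OF W x0 x] 0 by simp
    qed
    \<comment> \<open>Both integrands are nonnegative, so on either side of \<open>x0\<close> their
      primitives have the same sign and the absolute values add up.\<close>
    moreover have "\<bar>prim_from x0 ?k1 x\<bar> + \<bar>prim_from x0 ?k2 x\<bar> = \<bar>prim_from x0 (\<lambda>t. ?k1 t + ?k2 t) x\<bar>"
    proof -
      have s: "prim_from x0 (\<lambda>t. ?k1 t + ?k2 t) x = prim_from x0 ?k1 x + prim_from x0 ?k2 x"
        using i1 i2 by (simp add: prim_from_def prim_add)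
      have nn: "prim_from c h x' \<ge> 0" if "c \<le> x'" "integrable M h" "\<And>t. h t \<ge> 0" for c x' and h :: "real \<Rightarrow> real"
        using that by (subst prim_from_le) (auto intro!: Bochner_Integration.integral_nonneg)
      show ?thesis
      proof (cases "x0 \<le> x")
        case True
        then show ?thesis using nn[OF True i1] nn[OF True i2] s by simp
      next
        case False
        then have "x \<le> x0" by simp
        from nn[OF this i1] nn[OF this i2] show ?thesis
          using s prim_from_swap[of x0 ?k1 x] prim_from_swap[of x0 ?k2 x] by simp
      qed
    qed
    \<comment> \<open>Expanding \<open>k t * m t\<close> gives the two integrands and two
      nonnegative cross terms.\<close>
    moreover have "\<bar>prim_from x0 (\<lambda>t. ?k1 t + ?k2 t) x\<bar> \<le> \<bar>prim_from x0 (\<lambda>t. k t * m t) x\<bar>"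
    proof -
      have "norm (prim_from x0 (\<lambda>t. ?k1 t + ?k2 t) x) \<le> \<bar>prim_from x0 (\<lambda>t. k t * m t) x\<bar>"
      proof (rule prim_from_bound[OF _ ikm])
        show "integrable M (\<lambda>t. ?k1 t + ?k2 t)" using i1 i2 by simp
      qed (simp add: k_def m_def algebra_simps)
      then show ?thesis by simp
    qed
    ultimately show "m x \<le> \<bar>prim_from x0 (\<lambda>t. k t * m t) x\<bar>" unfolding m_def by linarith
  qed (auto simp: k_def m_def)
  then have "Y x = 0" by (simp add: m_def add_nonneg_eq_0_iff)
  then show ?thesis using f_nz[OF x] by (simp add: Y_def)
qed

end

section \<open>The series of formal powers\<close>

text \<open>The hypotheses bound both the terms and the remainders directly, so \<open>N\<close>
  need not be known to satisfy a triangle inequality. One rule thus covers point evaluation, the W12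
  norm and the dual norm.\<close>

lemma abs_uniform_seriesI:
  assumes c: "summable c"
    and t: "\<And>\<rho> k. \<rho> \<in> K \<Longrightarrow> 0 \<le> N (t \<rho> k) \<and> N (t \<rho> k) \<le> c k"
    and s: "\<And>\<rho> n. \<rho> \<in> K \<Longrightarrow> 0 \<le> N (\<lambda>x. s \<rho> x - (\<Sum>k<n. t \<rho> k x)) \<and>
      N (\<lambda>x. s \<rho> x - (\<Sum>k<n. t \<rho> k x)) \<le> (\<Sum>k. c (k + n))"
  shows "abs_uniform_series N K t s"
  unfolding abs_uniform_series_def
proof
  show "uniformly_convergent_on K (\<lambda>n \<rho>. \<Sum>k<n. N (t \<rho> k))"
    by (rule Weierstrass_m_test'[OF _ c]) (use t in force)
  show "uniform_limit K (\<lambda>n \<rho>. N (\<lambda>x. s \<rho> x - (\<Sum>k<n. t \<rho> k x))) (\<lambda>_. 0) sequentially"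
  proof (rule uniform_limitI)
    fix e :: real assume "e > 0"
    then obtain n0 where n0: "\<And>n. n \<ge> n0 \<Longrightarrow> norm (\<Sum>k. c (k + n)) < e"
      using suminf_exist_split[OF _ c] by blast
    show "\<forall>\<^sub>F n in sequentially. \<forall>\<rho>\<in>K. dist (N (\<lambda>x. s \<rho> x - (\<Sum>k<n. t \<rho> k x))) 0 < e"
      unfolding eventually_sequentially
    proof (intro exI[of _ n0] allI impI ballI)
      fix n \<rho> assume "n0 \<le> n" "\<rho> \<in> K"
      with n0[of n] s[of \<rho> n] show "dist (N (\<lambda>x. s \<rho> x - (\<Sum>k<n. t \<rho> k x))) 0 < e"
        by (simp add: dist_real_def)
    qed
  qed
qed

lemma abs_uniform_series_tendsto:
  assumes "abs_uniform_series N K t s" "\<rho> \<in> K"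
  shows "(\<lambda>n. N (\<lambda>x. s \<rho> x - (\<Sum>k<n. t \<rho> k x))) \<longlonglongrightarrow> 0"
  using assms unfolding abs_uniform_series_def by (auto dest: tendsto_uniform_limitI)

context bounded_interval
begin

lemma prim_from_cong:
  "(\<And>t. t \<in> {a<..<b} \<Longrightarrow> g t = h t) \<Longrightarrow> prim_from c g x = prim_from c h x"
  unfolding prim_from_def prim_def
  by (intro arg_cong2[where f = "(-)"] Bochner_Integration.integral_cong) auto

text \<open>Over a finite measure the constants \<open>c k\<close> dominate the derivatives, so sum
  and integral may be exchanged in every primitive.\<close>

lemma AC_series:
  fixes u g :: "nat \<Rightarrow> real \<Rightarrow> complex"
  assumes AC: "\<And>k. AC (u k) (g k)" and c: "summable c"
    and u: "\<And>k x. x \<in> {a..b} \<Longrightarrow> norm (u k x) \<le> c k"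
    and g: "\<And>k x. x \<in> {a..b} \<Longrightarrow> norm (g k x) \<le> c k"
  shows "AC (\<lambda>x. \<Sum>k. u k x) (\<lambda>x. \<Sum>k. g k x)"
proof -
  have ig: "integrable M (g k)" for k using AC by (rule AC_integrable)
  have su: "summable (\<lambda>k. u k x)" if "x \<in> {a..b}" for x
    by (rule summable_comparison_test'[OF c]) (use u that in auto)
  \<comment> \<open>The predicate \<open>Q\<close> lets one estimate serve the full integral
    (\<open>Q\<close> true) and the primitive at \<open>x\<close> (cut-off at
    \<open>x\<close>).\<close>
  have sg: "summable (\<lambda>k. norm (if Q t then g k t else 0))" if "t \<in> {a<..<b}" for t and Q :: "real \<Rightarrow> bool"
    by (rule summable_comparison_test'[OF c])
      (use g[of t] that order_trans[OF norm_ge_zero g[of t]] in auto)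
  have si: "summable (\<lambda>k. LINT t|M. norm (if Q t then g k t else 0))" if "Measurable.pred M Q" for Q
  proof (rule summable_comparison_test')
    show "summable (\<lambda>k. c k * measure M (space M))" using c by (rule summable_mult2)
    fix k
    have "0 \<le> (LINT t|M. norm (if Q t then g k t else 0))" by (rule Bochner_Integration.integral_nonneg) auto
    moreover have "(LINT t|M. norm (if Q t then g k t else 0)) \<le> (LINT t|M. c k)"
      by (rule integral_mono_AE)
        (use g[of _ k] order_trans[OF norm_ge_zero g[of a k]] a_less_b integrable_if[OF ig that, of k] in \<open>auto intro!: AE_M_I\<close>)
    ultimately show "norm (LINT t|M. norm (if Q t then g k t else 0)) \<le> c k * measure M (space M)"
      by (simp add: mult.commute)
  qed
  have T: "Measurable.pred M (\<lambda>_. True)" by simp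
  have i: "integrable M (\<lambda>x. \<Sum>k. g k x)"
    by (rule integrable_suminf[OF ig]) (use sg[of _ "\<lambda>_. True"] si[OF T] in \<open>auto intro!: AE_M_I\<close>)
  have p: "prim (\<lambda>x. \<Sum>k. g k x) x = (\<Sum>k. prim (g k) x)" for x
  proof -
    have le: "Measurable.pred M (\<lambda>t. t \<le> x)" by measurable
    have "prim (\<lambda>x. \<Sum>k. g k x) x = (LINT t|M. (\<Sum>k. (if t \<le> x then g k t else 0)))"
      unfolding prim_def by (rule Bochner_Integration.integral_cong) auto
    also have "\<dots> = (\<Sum>k. LINT t|M. (if t \<le> x then g k t else 0))"
      by (rule integral_suminf[OF integrable_le[OF ig]])
        (use sg[of _ "\<lambda>t. t \<le> x"] si[OF le] in \<open>auto intro!: AE_M_I\<close>)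
    finally show ?thesis by (simp add: prim_def)
  qed
  have "(\<Sum>k. u k x) - (\<Sum>k. u k a) = prim (\<lambda>x. \<Sum>k. g k x) x" if x: "x \<in> {a..b}" for x
  proof -
    have "a \<in> {a..b}" using a_less_b by simp
    then have "(\<Sum>k. u k x) - (\<Sum>k. u k a) = (\<Sum>k. u k x - u k a)"
      using su x by (intro suminf_diff)
    also have "\<dots> = (\<Sum>k. prim (g k) x)" using AC x by (simp add: AC_def)
    finally show ?thesis by (simp add: p)
  qed
  with i show ?thesis by (simp add: AC_def)
qed

end

context nonvanishing_W12
begin

section \<open>Iterated integrals with alternating weights\<close>

text \<open>The recursive call swaps the weights, so the derivative of
  \<open>iter (Suc k) p q\<close> is \<open>p\<close> times \<open>iter k q p\<close>. The two
  orders of the weights supply the two components of the system.\<close>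

primrec iter :: "nat \<Rightarrow> (real \<Rightarrow> complex) \<Rightarrow> (real \<Rightarrow> complex) \<Rightarrow> real \<Rightarrow> complex" where
  "iter 0 = (\<lambda>p q x. 1)"
| "iter (Suc k) = (\<lambda>p q. prim_from x0 (\<lambda>t. p t * iter k q p t))"

definition iter' :: "nat \<Rightarrow> (real \<Rightarrow> complex) \<Rightarrow> (real \<Rightarrow> complex) \<Rightarrow> real \<Rightarrow> complex" where
  "iter' k p q x = (case k of 0 \<Rightarrow> 0 | Suc j \<Rightarrow> p x * iter j q p x)"

lemma iter_cont:
  "continuous_on {a..b} p \<Longrightarrow> continuous_on {a..b} q \<Longrightarrow> continuous_on {a..b} (iter k p q)"
proof (induction k arbitrary: p q)
  case (Suc k)
  have "integrable M (\<lambda>t. p t * iter k q p t)" by (intro integrable_cont continuous_intros Suc)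
  then show ?case using AC_continuous[OF AC_prim_from] by simp
qed simp

lemma iter_AC:
  assumes "continuous_on {a..b} p" "continuous_on {a..b} q"
  shows "AC (iter k p q) (iter' k p q)"
proof (cases k)
  case 0
  then show ?thesis using AC_const[of 1] by (simp add: iter'_def[abs_def])
next
  case (Suc j)
  have "integrable M (\<lambda>t. p t * iter j q p t)" by (intro integrable_cont continuous_intros assms iter_cont)
  then show ?thesis using Suc AC_prim_from by (simp add: iter'_def[abs_def])
qed

lemma iter'_cont:
  assumes "continuous_on {a..b} p" "continuous_on {a..b} q"
  shows "continuous_on {a..b} (iter' k p q)"
  by (cases k) (auto simp: iter'_def intro!: continuous_intros assms iter_cont)

text \<open>A common bound \<open>C\<close> makes the swap of weights invisible.
  \<open>prim_from_iterate\<close> is used with the constant weight \<open>C\<close>, whose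
  primitive from \<open>x0\<close> is at most \<open>C * (b - a)\<close> in absolute value.\<close>

lemma iter_bound:
  assumes "continuous_on {a..b} p" "continuous_on {a..b} q"
    and "\<And>t. t \<in> {a..b} \<Longrightarrow> norm (p t) \<le> C" "\<And>t. t \<in> {a..b} \<Longrightarrow> norm (q t) \<le> C"
    and x: "x \<in> {a..b}"
  shows "norm (iter k p q x) \<le> (C * (b - a)) ^ k / fact k"
proof -
  have C: "C \<ge> 0" using order_trans[OF norm_ge_zero assms(3)[OF x]] .
  have *: "norm (iter k p q t) \<le> 1 * \<bar>prim_from x0 (\<lambda>_. C) t\<bar> ^ k / fact k" if "t \<in> {a..b}" for t
    using assms(1-4) that
  proof (induction k arbitrary: p q t)
    case (Suc k)
    have "norm (prim_from x0 (\<lambda>t. p t * iter k q p t) t) \<le> 1 * \<bar>prim_from x0 (\<lambda>_. C) t\<bar> ^ Suc k / fact (Suc k)"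
    proof (rule prim_from_iterate)
      show "integrable M (\<lambda>t. p t * iter k q p t)" by (intro integrable_cont continuous_intros Suc.prems iter_cont)
      fix t assume "t \<in> {a<..<b}"
      then have t: "t \<in> {a..b}" by simp
      show "norm (p t * iter k q p t) \<le> C * (1 * \<bar>prim_from x0 (\<lambda>_. C) t\<bar> ^ k / fact k)"
        unfolding norm_mult by (intro mult_mono Suc.prems(3) Suc.IH Suc.prems t C) auto
    qed (use C x0 Suc.prems in auto)
    then show ?case by simp
  qed simp
  have "\<bar>prim_from x0 (\<lambda>_. C) x\<bar> \<le> C * (b - a)"
    using x x0 C by (subst prim_from_const) (auto simp: abs_mult intro!: mult_left_mono)
  then have "\<bar>prim_from x0 (\<lambda>_. C) x\<bar> ^ k / fact k \<le> (C * (b - a)) ^ k / fact k"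
    by (intro divide_right_mono power_mono) auto
  with *[OF x] show ?thesis by simp
qed

text \<open>The derivative is a weight times the previous iterate and has only
  \<open>(k - 1)!\<close> below. The missing factor \<open>k\<close> is absorbed by
  \<open>2 ^ k\<close>, and the weight without a length factor by \<open>b - a + 1\<close>, so one
  geometric base serves function and derivative.\<close>

lemma iter_bounds:
  assumes "continuous_on {a..b} p" "continuous_on {a..b} q"
    and "\<And>t. t \<in> {a..b} \<Longrightarrow> norm (p t) \<le> C" "\<And>t. t \<in> {a..b} \<Longrightarrow> norm (q t) \<le> C"
    and x: "x \<in> {a..b}"
  shows "norm (iter k p q x) \<le> (2 * (C * (b - a + 1))) ^ k / fact k"
    and "norm (iter' k p q x) \<le> (2 * (C * (b - a + 1))) ^ k / fact k"
proof -
  have C: "C \<ge> 0" using order_trans[OF norm_ge_zero assms(3)[OF x]] .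
  have L0: "0 \<le> C * (b - a)" using C a_less_b by simp
  have C1: "C \<le> C * (b - a + 1)" unfolding distrib_left[of C] using L0 by simp
  have L: "C * (b - a) \<le> 2 * (C * (b - a + 1))"
    unfolding distrib_left[of C] using L0 C by simp
  have "(C * (b - a)) ^ k / fact k \<le> (2 * (C * (b - a + 1))) ^ k / fact k"
    using L L0 by (intro divide_right_mono power_mono) auto
  then show "norm (iter k p q x) \<le> (2 * (C * (b - a + 1))) ^ k / fact k"
    using iter_bound[OF assms, of k] by simp
  show "norm (iter' k p q x) \<le> (2 * (C * (b - a + 1))) ^ k / fact k"
  proof (cases k)
    case (Suc j)
    have "norm (p x * iter j q p x) \<le> C * ((C * (b - a)) ^ j / fact j)"
      unfolding norm_mult using iter_bound[of q p C x j] assms C by (intro mult_mono) auto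
    also have "(C * (b - a)) ^ j \<le> (C * (b - a + 1)) ^ j"
      using C a_less_b by (intro power_mono mult_left_mono) auto
    then have "C * ((C * (b - a)) ^ j / fact j) \<le> (C * (b - a + 1)) * ((C * (b - a + 1)) ^ j / fact j)"
      by (intro mult_mono divide_right_mono C1 order_trans[OF C C1] divide_nonneg_nonneg zero_le_power L0)
        simp_all
    also have "\<dots> = real (Suc j) * (C * (b - a + 1)) ^ Suc j / fact (Suc j)"
      by (simp add: divide_simps)
    also have "\<dots> \<le> 2 ^ Suc j * (C * (b - a + 1)) ^ Suc j / fact (Suc j)"
      by (intro divide_right_mono mult_right_mono less_imp_le[OF of_nat_less_two_power]
          zero_le_power order_trans[OF C C1]) simp
    also have "2 ^ Suc j * (C * (b - a + 1)) ^ Suc j = (2 * (C * (b - a + 1))) ^ Suc j"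
      by (rule power_mult_distrib[symmetric])
    finally show ?thesis using Suc by (simp add: iter'_def)
  next
    case 0
    then show ?thesis by (simp add: iter'_def)
  qed
qed

abbreviation p :: "real \<Rightarrow> complex" where "p \<equiv> \<lambda>t. 1 / (f t)\<^sup>2"
abbreviation q :: "real \<Rightarrow> complex" where "q \<equiv> \<lambda>t. (f t)\<^sup>2"

lemma p_cont: "continuous_on {a..b} p" and q_cont: "continuous_on {a..b} q"
  by (auto intro!: inv_f_cont continuous_intros f_cont)

text \<open>The recursion of formal powers advances by two, that is by one weight of each kind: the
  explicit \<open>f\<close> in the inner integrand and the \<open>f\<close> contained in the lower
  formal power combine to \<open>q\<close>, and the prefactors build up
  \<open>fact k\<close>.\<close>

lemma formal_power_eq:
  "x \<in> {a..b} \<Longrightarrow> formal_power f x0 k x = fact k * f x * iter k p q x"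
proof (induction k arbitrary: x rule: induct_nat_012)
  case 0
  then show ?case by simp
next
  case 1
  then show ?case using x0 p_cont by (simp add: interval_integral_eq_prim_from)
next
  case (ge2 k)
  have inner: "(LBINT s=x0..t. f s * formal_power f x0 k s) = fact k * iter (Suc k) q p t"
    if t: "t \<in> {a..b}" for t
  proof -
    have eq: "fact k * (q s * iter k p q s) = f s * formal_power f x0 k s" if "s \<in> {a..b}" for s
      using ge2.IH(1)[OF that] by (simp add: power2_eq_square)
    have "continuous_on {a..b} (\<lambda>s. fact k * (q s * iter k p q s))"
      by (intro continuous_intros q_cont iter_cont p_cont f_cont)
    then have c: "continuous_on {a..b} (\<lambda>s. f s * formal_power f x0 k s)"
      by (rule continuous_on_eq) (rule eq)
    have "(LBINT s=x0..t. f s * formal_power f x0 k s) = prim_from x0 (\<lambda>s. f s * formal_power f x0 k s) t"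
      by (rule interval_integral_eq_prim_from[OF c x0 t])
    also have "\<dots> = prim_from x0 (\<lambda>s. fact k * (q s * iter k p q s)) t"
      by (rule prim_from_cong) (simp add: eq)
    also have "\<dots> = fact k * iter (Suc k) q p t"
      unfolding prim_from_def prim_cmult iter.simps by (rule right_diff_distrib[symmetric])
    finally show ?thesis .
  qed
  have eq: "fact k * (p t * iter (Suc k) q p t) = p t * (LBINT s=x0..t. f s * formal_power f x0 k s)"
    if "t \<in> {a..b}" for t
    using inner[OF that] by simp
  have "continuous_on {a..b} (\<lambda>t. fact k * (p t * iter (Suc k) q p t))"
    by (intro continuous_on_mult continuous_on_const p_cont iter_cont q_cont)
  then have c: "continuous_on {a..b} (\<lambda>t. p t * (LBINT s=x0..t. f s * formal_power f x0 k s))"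
    by (rule continuous_on_eq) (rule eq)
  have "(LBINT t=x0..x. p t * (LBINT s=x0..t. f s * formal_power f x0 k s))
      = prim_from x0 (\<lambda>t. p t * (LBINT s=x0..t. f s * formal_power f x0 k s)) x"
    by (rule interval_integral_eq_prim_from[OF c x0 ge2.prems])
  also have "\<dots> = prim_from x0 (\<lambda>t. fact k * (p t * iter (Suc k) q p t)) x"
    by (rule prim_from_cong) (simp only: eq greaterThanLessThan_iff atLeastAtMost_iff less_imp_le)
  also have "\<dots> = fact k * iter (Suc (Suc k)) p q x"
    unfolding prim_from_def prim_cmult iter.simps by (rule right_diff_distrib[symmetric])
  finally show ?case by (simp add: algebra_simps)
qed

section \<open>The power series solution and its tails\<close>

text \<open>With both weights equal to 1 this is \<open>exp (z * (x - x0))\<close> on the interval;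
  in general it is the analogue of the exponential for alternating weights.\<close>

definition sol :: "(real \<Rightarrow> complex) \<Rightarrow> (real \<Rightarrow> complex) \<Rightarrow> complex \<Rightarrow> real \<Rightarrow> complex" where
  "sol r s z x = (\<Sum>k. z ^ k * iter k r s x)"

definition weight_bound :: real where
  "weight_bound = (SOME C. \<forall>t\<in>{a..b}. norm (p t) \<le> C \<and> norm (q t) \<le> C)"

definition bnd :: "real \<Rightarrow> nat \<Rightarrow> real" where
  "bnd R k = (2 * (weight_bound * (b - a + 1)) * R) ^ k / fact k"

lemma bnd_summable: "summable (bnd R)"
  unfolding bnd_def using summable_exp by (simp add: divide_inverse mult.commute)

lemma iter_le_bnd:
  assumes "norm z \<le> R" "x \<in> {a..b}"
  shows "norm (z ^ k * iter k p q x) \<le> bnd R k" "norm (z ^ k * iter' k p q x) \<le> bnd R k"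
    "norm (z ^ k * iter k q p x) \<le> bnd R k" "norm (z ^ k * iter' k q p x) \<le> bnd R k"
proof -
  define C where "C = weight_bound"
  obtain P Q where "\<And>t. t \<in> {a..b} \<Longrightarrow> norm (p t) \<le> P" "\<And>t. t \<in> {a..b} \<Longrightarrow> norm (q t) \<le> Q"
    using continuous_bound[OF p_cont] continuous_bound[OF q_cont] by metis
  then have "\<forall>t\<in>{a..b}. norm (p t) \<le> max P Q \<and> norm (q t) \<le> max P Q"
    by (simp add: le_max_iff_disj)
  then have "\<forall>t\<in>{a..b}. norm (p t) \<le> C \<and> norm (q t) \<le> C"
    unfolding C_def weight_bound_def by (rule someI)
  then have C: "\<And>t. t \<in> {a..b} \<Longrightarrow> norm (p t) \<le> C" "\<And>t. t \<in> {a..b} \<Longrightarrow> norm (q t) \<le> C" by auto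
  have *: "norm (z ^ k * w) \<le> bnd R k" if "norm w \<le> (2 * (C * (b - a + 1))) ^ k / fact k" for w
  proof -
    have "norm (z ^ k * w) \<le> R ^ k * ((2 * (C * (b - a + 1))) ^ k / fact k)"
      unfolding norm_mult norm_power using assms(1) that
      by (intro mult_mono power_mono zero_le_power) (auto intro: order_trans[OF norm_ge_zero])
    then show ?thesis by (simp add: bnd_def C_def power_mult_distrib mult.commute)
  qed
  show "norm (z ^ k * iter k p q x) \<le> bnd R k" "norm (z ^ k * iter' k p q x) \<le> bnd R k"
    "norm (z ^ k * iter k q p x) \<le> bnd R k" "norm (z ^ k * iter' k q p x) \<le> bnd R k"
    by (intro * iter_bounds p_cont q_cont C assms(2); assumption)+
qed

text \<open>The tails are treated for every \<open>n\<close> at once: \<open>n = 0\<close> is the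
  solution itself, and the other cases are the remainders to be estimated.\<close>

lemma tail_AC:
  "AC (\<lambda>x. \<Sum>k. z ^ (k + n) * iter (k + n) p q x) (\<lambda>x. \<Sum>k. z ^ (k + n) * iter' (k + n) p q x)"
  "AC (\<lambda>x. \<Sum>k. z ^ (k + n) * iter (k + n) q p x) (\<lambda>x. \<Sum>k. z ^ (k + n) * iter' (k + n) q p x)"
  by (rule AC_series[where c = "\<lambda>k. bnd (norm z) (k + n)"];
      intro AC_cmult iter_AC p_cont q_cont summable_ignore_initial_segment bnd_summable iter_le_bnd order_refl;
      assumption)+

lemma tail_bound:
  assumes "norm z \<le> R" "x \<in> {a..b}"
  shows "norm (\<Sum>k. z ^ (k + n) * iter (k + n) p q x) \<le> (\<Sum>k. bnd R (k + n))"
    "norm (\<Sum>k. z ^ (k + n) * iter' (k + n) p q x) \<le> (\<Sum>k. bnd R (k + n))"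
  by (rule norm_suminf_le;
      intro summable_ignore_initial_segment bnd_summable iter_le_bnd assms)+

lemma iter_summable:
  assumes "x \<in> {a..b}"
  shows "summable (\<lambda>k. z ^ k * iter k p q x)" "summable (\<lambda>k. z ^ k * iter' k p q x)"
    "summable (\<lambda>k. z ^ k * iter k q p x)" "summable (\<lambda>k. z ^ k * iter' k q p x)"
  by (rule summable_comparison_test'[OF bnd_summable[of "norm z"]], intro iter_le_bnd assms order_refl)+

text \<open>In the differentiated series the term for \<open>k = 0\<close> vanishes; shifting the
  index takes out \<open>z\<close> and the outer weight and leaves the series with the weights
  swapped.\<close>

lemma sol_AC:
  "AC (sol p q z) (\<lambda>x. z * p x * sol q p z x)" "AC (sol q p z) (\<lambda>x. z * q x * sol p q z x)"
proof -
  have split: "(\<Sum>k. z ^ k * iter' k r s x) = z * r x * sol s r z x"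
    if "summable (\<lambda>k. z ^ k * iter' k r s x)" "summable (\<lambda>k. z ^ k * iter k s r x)" for r s x
  proof -
    have "(\<Sum>k. z ^ k * iter' k r s x) = (\<Sum>k. z ^ Suc k * iter' (Suc k) r s x)"
      using suminf_split_head[OF that(1)] by (simp add: iter'_def)
    also have "\<dots> = (\<Sum>k. (z * r x) * (z ^ k * iter k s r x))"
      by (simp add: iter'_def mult_ac)
    also have "\<dots> = z * r x * sol s r z x" unfolding sol_def by (rule suminf_mult[OF that(2)])
    finally show ?thesis .
  qed
  have "AC (sol p q z) (\<lambda>x. \<Sum>k. z ^ k * iter' k p q x)"
    using tail_AC(1)[of z 0] by (simp add: sol_def[abs_def])
  then show "AC (sol p q z) (\<lambda>x. z * p x * sol q p z x)"
    by (rule AC_cong_deriv) (rule split[of p q]; rule iter_summable; simp)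
  have "AC (sol q p z) (\<lambda>x. \<Sum>k. z ^ k * iter' k q p x)"
    using tail_AC(2)[of z 0] by (simp add: sol_def[abs_def])
  then show "AC (sol q p z) (\<lambda>x. z * q x * sol p q z x)"
    by (rule AC_cong_deriv) (rule split[of q p]; rule iter_summable; simp)
qed

lemma sol_x0: "sol r s z x0 = 1"
proof -
  have "(\<Sum>k. z ^ k * iter k r s x0) = (\<Sum>k\<in>{0}. z ^ k * iter k r s x0)"
  proof (rule suminf_finite)
    fix k :: nat assume "k \<notin> {0}"
    then show "z ^ k * iter k r s x0 = 0" by (cases k) auto
  qed simp
  then show ?thesis by (simp add: sol_def)
qed

lemma ef_solution_ex1:
  "\<exists>!y. ef_solution a b f x0 \<rho> y \<and> (\<forall>x. x \<notin> {a..b} \<longrightarrow> y x = 0)"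
  and ef_eq: "x \<in> {a..b} \<Longrightarrow> ef a b f x0 \<rho> x = f x * sol p q (\<i> * \<rho>) x"
proof -
  let ?z = "\<i> * \<rho>"
  define y where "y x = (if x \<in> {a..b} then f x * sol p q ?z x else 0)" for x
  have sol: "ef_solution a b f x0 \<rho> y"
  proof (rule ef_solutionI)
    show "AC (sol p q ?z) (\<lambda>x. ?z * sol q p ?z x / (f x)\<^sup>2)"
      using sol_AC(1)[of ?z] by simp
    \<comment> \<open>The factor \<open>?z\<close> in the second component gives it the value
      \<open>\<i> * \<rho>\<close> at \<open>x0\<close>, and its square
      \<open>- \<rho>\<^sup>2\<close> is the sign required by the second equation.\<close>
    have "AC (\<lambda>x. ?z * sol q p ?z x) (\<lambda>x. ?z * (?z * q x * sol p q ?z x))"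
      by (rule AC_cmult[OF sol_AC(2)])
    then show "AC (\<lambda>x. ?z * sol q p ?z x) (\<lambda>x. - (\<rho>\<^sup>2 * (f x)\<^sup>2 * sol p q ?z x))"
      by (rule AC_cong_deriv) (simp add: power2_eq_square algebra_simps)
  qed (simp_all add: sol_x0 y_def)
  have uniq: "y' = y" if "ef_solution a b f x0 \<rho> y'" "\<forall>x. x \<notin> {a..b} \<longrightarrow> y' x = 0" for y'
  proof
    fix x
    show "y' x = y x"
    proof (cases "x \<in> {a..b}")
      case True
      then show ?thesis by (rule ef_solution_unique[OF that(1) sol])
    next
      case False
      then have "y' x = 0" "y x = 0" using that(2) unfolding y_def by (blast, meson)
      then show ?thesis by simp
    qed
  qed
  have y: "ef_solution a b f x0 \<rho> y \<and> (\<forall>x. x \<notin> {a..b} \<longrightarrow> y x = 0)"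
    using sol by (auto simp: y_def)
  then show "\<exists>!y. ef_solution a b f x0 \<rho> y \<and> (\<forall>x. x \<notin> {a..b} \<longrightarrow> y x = 0)"
    using uniq by blast
  have "ef a b f x0 \<rho> = y"
    unfolding ef_def by (rule the_equality, rule y) (use uniq in blast)
  then show "ef a b f x0 \<rho> x = f x * sol p q (\<i> * \<rho>) x" if "x \<in> {a..b}"
    using that by (simp only: y_def if_True)
qed

section \<open>Convergence of the series in the three norms\<close>

text \<open>By the product rule the derivative is at most \<open>s\<close> times
  \<open>norm (f' x) + norm (f x)\<close>, an L2 function independent of \<open>V\<close>. A uniform
  bound on a tail and its derivative thus becomes a W12 bound with a fixed constant.\<close>

lemma W12_norm_f_mult:
  assumes V: "AC V V'" and bd: "\<And>x. x \<in> {a..b} \<Longrightarrow> norm (V x) \<le> s" "\<And>x. x \<in> {a..b} \<Longrightarrow> norm (V' x) \<le> s"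
  shows "(\<lambda>x. f x * V x) \<in> W12 a b"
    and "W12_norm a b (\<lambda>x. f x * V x)
      \<le> (L2_norm a b f + L2_norm a b (\<lambda>x. of_real (norm (f' x) + norm (f x)))) * s"
proof -
  have s: "s \<ge> 0" using order_trans[OF norm_ge_zero bd(1)[OF x0]] .
  have cV: "continuous_on {a..b} V" using V by (rule AC_continuous)
  have fL: "f \<in> L2 a b" by (rule L2_cont[OF f_cont])
  have V'm: "V' \<in> borel_measurable M" using AC_integrable[OF V] by simp
  note d = AC_mult[OF f_AC V]
  have fV: "(\<lambda>x. f x * V x) \<in> L2 a b" by (intro L2_cont continuous_intros f_cont cV)
  have dL: "(\<lambda>x. f' x * V x + f x * V' x) \<in> L2 a b"
  proof (rule L2_add[OF L2_mult_cont[OF f'_L2 cV]])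
    show "(\<lambda>x. f x * V' x) \<in> L2 a b"
    proof (rule L2_bounded_mult[OF fL])
      show "(\<lambda>x. f x * V' x) \<in> borel_measurable M"
        using L2_measurable[OF fL] V'm by measurable
      fix x assume "x \<in> {a<..<b}"
      then show "norm (f x * V' x) \<le> s * norm (f x)"
        using bd(2)[of x] by (simp add: norm_mult mult.commute[of s] mult_left_mono)
    qed
  qed
  have mL: "(\<lambda>x. complex_of_real (norm (f' x) + norm (f x))) \<in> L2 a b"
  proof -
    have "(\<lambda>x. complex_of_real (norm (f' x))) \<in> L2 a b"
      by (rule L2_bounded_mult[OF f'_L2, of _ 1]) (use L2_measurable[OF f'_L2] in auto)
    moreover have "(\<lambda>x. complex_of_real (norm (f x))) \<in> L2 a b"
      by (intro L2_cont continuous_intros f_cont)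
    ultimately show ?thesis using L2_add by simp
  qed
  show "(\<lambda>x. f x * V x) \<in> W12 a b" using d dL by (rule W12I)
  have "L2_norm a b (\<lambda>x. f x * V x) \<le> s * L2_norm a b f"
  proof (rule L2_norm_mono[OF fL fV s])
    fix x assume "x \<in> {a<..<b}"
    then show "norm (f x * V x) \<le> s * norm (f x)"
      using bd(1)[of x] by (simp add: norm_mult mult.commute[of s] mult_left_mono)
  qed
  moreover have "L2_norm a b (\<lambda>x. f' x * V x + f x * V' x)
      \<le> s * L2_norm a b (\<lambda>x. of_real (norm (f' x) + norm (f x)))"
  proof (rule L2_norm_mono[OF mL dL s])
    fix x assume "x \<in> {a<..<b}"
    then have x: "x \<in> {a..b}" by simp
    have "norm (f' x * V x + f x * V' x) \<le> norm (f' x) * norm (V x) + norm (f x) * norm (V' x)"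
      by (metis norm_triangle_ineq norm_mult)
    also have "\<dots> \<le> norm (f' x) * s + norm (f x) * s"
      using bd[OF x] by (intro add_mono mult_left_mono) auto
    also have "\<dots> = s * norm (complex_of_real (norm (f' x) + norm (f x)))"
      unfolding norm_of_real by (simp add: algebra_simps)
    finally show "norm (f' x * V x + f x * V' x) \<le> s * norm (complex_of_real (norm (f' x) + norm (f x)))" .
  qed
  ultimately show "W12_norm a b (\<lambda>x. f x * V x)
      \<le> (L2_norm a b f + L2_norm a b (\<lambda>x. of_real (norm (f' x) + norm (f x)))) * s"
    using W12_norm_le[OF d dL] by (simp add: algebra_simps)
qed

lemma ef_term_eq: "x \<in> {a..b} \<Longrightarrow> ef_term f x0 \<rho> k x = f x * ((\<i> * \<rho>) ^ k * iter k p q x)"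
  by (simp add: ef_term_def formal_power_eq)

text \<open>Writing the remainder as \<open>f\<close> times a tail reduces remainders to the same
  estimate as single terms.\<close>

lemma ef_remainder_eq:
  assumes x: "x \<in> {a..b}"
  shows "ef a b f x0 \<rho> x - (\<Sum>k<n. ef_term f x0 \<rho> k x)
    = f x * (\<Sum>k. (\<i> * \<rho>) ^ (k + n) * iter (k + n) p q x)"
proof -
  have "(\<Sum>k. (\<i> * \<rho>) ^ (k + n) * iter (k + n) p q x)
      = sol p q (\<i> * \<rho>) x - (\<Sum>k<n. (\<i> * \<rho>) ^ k * iter k p q x)"
    unfolding sol_def by (rule suminf_minus_initial_segment[OF iter_summable(1)[OF x]])
  then show ?thesis
    using x by (simp add: ef_eq ef_term_eq sum_distrib_left right_diff_distrib)
qed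

definition W12_const :: real where
  "W12_const = L2_norm a b f + L2_norm a b (\<lambda>x. of_real (norm (f' x) + norm (f x)))"

lemma ef_term_W12: "ef_term f x0 \<rho> k \<in> W12 a b"
  and ef_term_norm: "norm \<rho> \<le> R \<Longrightarrow> W12_norm a b (ef_term f x0 \<rho> k) \<le> W12_const * bnd R k"
proof -
  have z: "norm (\<i> * \<rho>) = norm \<rho>" by (simp add: norm_mult)
  have V: "AC (\<lambda>x. (\<i> * \<rho>) ^ k * iter k p q x) (\<lambda>x. (\<i> * \<rho>) ^ k * iter' k p q x)"
    by (intro AC_cmult iter_AC p_cont q_cont)
  have c: "W12_norm a b (ef_term f x0 \<rho> k) = W12_norm a b (\<lambda>x. f x * ((\<i> * \<rho>) ^ k * iter k p q x))"
    "ef_term f x0 \<rho> k \<in> W12 a b \<longleftrightarrow> (\<lambda>x. f x * ((\<i> * \<rho>) ^ k * iter k p q x)) \<in> W12 a b"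
    by (rule W12_cong; erule ef_term_eq)+
  show "ef_term f x0 \<rho> k \<in> W12 a b"
    unfolding c by (rule W12_norm_f_mult(1)[OF V iter_le_bnd(1,2)[OF order_refl]])
  show "W12_norm a b (ef_term f x0 \<rho> k) \<le> W12_const * bnd R k" if "norm \<rho> \<le> R"
    unfolding c W12_const_def by (rule W12_norm_f_mult(2)[OF V iter_le_bnd(1,2)]) (simp_all only: z that)
qed

lemma ef_remainder_W12: "(\<lambda>x. ef a b f x0 \<rho> x - (\<Sum>k<n. ef_term f x0 \<rho> k x)) \<in> W12 a b"
  and ef_remainder_norm: "norm \<rho> \<le> R \<Longrightarrow>
    W12_norm a b (\<lambda>x. ef a b f x0 \<rho> x - (\<Sum>k<n. ef_term f x0 \<rho> k x)) \<le> W12_const * (\<Sum>k. bnd R (k + n))"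
proof -
  have z: "norm (\<i> * \<rho>) = norm \<rho>" by (simp add: norm_mult)
  let ?V = "\<lambda>x. \<Sum>k. (\<i> * \<rho>) ^ (k + n) * iter (k + n) p q x"
  have c: "W12_norm a b (\<lambda>x. ef a b f x0 \<rho> x - (\<Sum>k<n. ef_term f x0 \<rho> k x)) = W12_norm a b (\<lambda>x. f x * ?V x)"
    "(\<lambda>x. ef a b f x0 \<rho> x - (\<Sum>k<n. ef_term f x0 \<rho> k x)) \<in> W12 a b \<longleftrightarrow> (\<lambda>x. f x * ?V x) \<in> W12 a b"
    by (rule W12_cong; erule ef_remainder_eq)+
  show "(\<lambda>x. ef a b f x0 \<rho> x - (\<Sum>k<n. ef_term f x0 \<rho> k x)) \<in> W12 a b"
    unfolding c by (rule W12_norm_f_mult(1)[OF tail_AC(1) tail_bound[OF order_refl]])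
  show "W12_norm a b (\<lambda>x. ef a b f x0 \<rho> x - (\<Sum>k<n. ef_term f x0 \<rho> k x)) \<le> W12_const * (\<Sum>k. bnd R (k + n))"
    if "norm \<rho> \<le> R"
    unfolding c W12_const_def
    by (rule W12_norm_f_mult(2)[OF tail_AC(1) tail_bound]) (simp_all only: z that)
qed

lemma ef_W12: "ef a b f x0 \<rho> \<in> W12 a b"
  using ef_remainder_W12[of \<rho> 0] by simp

lemma formal_power_W12: "formal_power f x0 k \<in> W12 a b"
proof -
  have V: "AC (\<lambda>x. fact k * iter k p q x) (\<lambda>x. fact k * iter' k p q x)"
    by (intro AC_cmult iter_AC p_cont q_cont)
  have L: "(\<lambda>x. f' x * (fact k * iter k p q x) + f x * (fact k * iter' k p q x)) \<in> L2 a b"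
    by (intro L2_add L2_mult_cont f'_L2 L2_cont continuous_intros f_cont iter_cont iter'_cont p_cont q_cont)
  have "(\<lambda>x. f x * (fact k * iter k p q x)) \<in> W12 a b"
    by (rule W12I[OF AC_mult[OF f_AC V] L])
  then show ?thesis
    by (subst W12_cong(4)[of _ "\<lambda>x. f x * (fact k * iter k p q x)"]) (simp_all add: formal_power_eq)
qed

lemma bnd_tail_mult:
  "summable (\<lambda>k. A * bnd R k)" "(\<Sum>k. A * bnd R (k + n)) = A * (\<Sum>k. bnd R (k + n))"
  by (rule summable_mult[OF bnd_summable])
    (rule suminf_mult[OF summable_ignore_initial_segment[OF bnd_summable]])

text \<open>A compact \<open>K\<close> lies in a disc of radius \<open>R\<close>, and
  \<open>bnd R\<close> majorises the series for all parameters in that disc.\<close>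

lemma series_pointwise:
  assumes "compact K" and x: "x \<in> {a..b}"
  shows "abs_uniform_series (\<lambda>y. norm (y x)) K (ef_term f x0) (ef a b f x0)"
proof -
  obtain R where R: "\<And>\<rho>. \<rho> \<in> K \<Longrightarrow> norm \<rho> \<le> R" 
    using compact_imp_bounded[OF assms(1)] unfolding bounded_iff by blast
  have z: "norm (\<i> * \<rho>) \<le> R" if "\<rho> \<in> K" for \<rho> using R[OF that] by (simp add: norm_mult)
  show ?thesis
  proof (rule abs_uniform_seriesI)
    show "summable (\<lambda>k. norm (f x) * bnd R k)" by (rule bnd_tail_mult)
    fix \<rho> :: complex and k n :: nat assume "\<rho> \<in> K"
    note z = z[OF this]
    show "0 \<le> norm (ef_term f x0 \<rho> k x) \<and> norm (ef_term f x0 \<rho> k x) \<le> norm (f x) * bnd R k"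
      unfolding ef_term_eq[OF x] norm_mult[of "f x"] using iter_le_bnd(1)[OF z x] by (simp add: mult_left_mono)
    show "0 \<le> norm (ef a b f x0 \<rho> x - (\<Sum>k<n. ef_term f x0 \<rho> k x)) \<and>
      norm (ef a b f x0 \<rho> x - (\<Sum>k<n. ef_term f x0 \<rho> k x)) \<le> (\<Sum>k. norm (f x) * bnd R (k + n))"
      unfolding ef_remainder_eq[OF x] norm_mult[of "f x"] bnd_tail_mult
      using tail_bound(1)[OF z x] by (simp add: mult_left_mono)
  qed
qed

lemma series_W12:
  assumes "compact K"
  shows "abs_uniform_series (W12_norm a b) K (ef_term f x0) (ef a b f x0)"
proof -
  obtain R where R: "\<And>\<rho>. \<rho> \<in> K \<Longrightarrow> norm \<rho> \<le> R" 
    using compact_imp_bounded[OF assms] unfolding bounded_iff by blast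
  show ?thesis
    by (rule abs_uniform_seriesI[OF bnd_tail_mult(1)[of W12_const R]])
      (simp_all only: bnd_tail_mult ef_term_norm[OF R] ef_remainder_norm[OF R] W12_norm_nonneg conj_absorb simp_thms)
qed

lemma second_deriv_remainder:
  assumes "\<phi> \<in> W12_0 a b"
  shows "second_deriv a b (ef a b f x0 \<rho>) \<phi> - (\<Sum>k<n. second_deriv a b (ef_term f x0 \<rho> k) \<phi>)
    = second_deriv a b (\<lambda>x. ef a b f x0 \<rho> x - (\<Sum>k<n. ef_term f x0 \<rho> k x)) \<phi>"
  by (rule second_deriv_diff_sum[OF ef_W12 ef_term_W12 W12_0_ends(1)[OF assms]])

lemma series_Wm12:
  assumes "compact K"
  shows "abs_uniform_series (Wm12_norm a b) K
            (\<lambda>\<rho> k. second_deriv a b (ef_term f x0 \<rho> k))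
            (\<lambda>\<rho>. second_deriv a b (ef a b f x0 \<rho>))"
proof -
  obtain R where R: "\<And>\<rho>. \<rho> \<in> K \<Longrightarrow> norm \<rho> \<le> R" 
    using compact_imp_bounded[OF assms] unfolding bounded_iff by blast
  show ?thesis
  proof (rule abs_uniform_seriesI[OF bnd_tail_mult(1)[of W12_const R]])
    fix \<rho> :: complex and k n :: nat assume "\<rho> \<in> K"
    note R = R[OF this]
    show "0 \<le> Wm12_norm a b (second_deriv a b (ef_term f x0 \<rho> k)) \<and>
        Wm12_norm a b (second_deriv a b (ef_term f x0 \<rho> k)) \<le> W12_const * bnd R k"
      \<comment> \<open>The dual norm of a second derivative is at most the W12 norm, so the
        majorant of \<open>series_W12\<close> is used again.\<close>
      using Wm12_norm_second_deriv[OF ef_term_W12 refl] ef_term_norm[OF R] order_trans by blast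
    show "0 \<le> Wm12_norm a b (\<lambda>\<phi>. second_deriv a b (ef a b f x0 \<rho>) \<phi>
          - (\<Sum>k<n. second_deriv a b (ef_term f x0 \<rho> k) \<phi>)) \<and>
        Wm12_norm a b (\<lambda>\<phi>. second_deriv a b (ef a b f x0 \<rho>) \<phi>
          - (\<Sum>k<n. second_deriv a b (ef_term f x0 \<rho> k) \<phi>)) \<le> (\<Sum>k. W12_const * bnd R (k + n))"
      unfolding bnd_tail_mult
      using Wm12_norm_second_deriv[OF ef_remainder_W12 second_deriv_remainder, of \<rho> n]
        ef_remainder_norm[OF R, of n] order_trans by blast
  qed
qed

lemma series_sums:
  assumes x: "x \<in> {a..b}"
  shows "(\<lambda>k. (\<i> * \<rho>) ^ k * formal_power f x0 k x / fact k) sums ef a b f x0 \<rho> x"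
proof -
  have "(\<lambda>k. f x * ((\<i> * \<rho>) ^ k * iter k p q x)) sums (f x * sol p q (\<i> * \<rho>) x)"
    unfolding sol_def by (intro sums_mult summable_sums iter_summable(1) x)
  then show ?thesis using x by (simp add: ef_eq formal_power_eq mult.left_commute[of "f x"])
qed

end

theorem theorem14:
  fixes a b x0 :: real and f :: "real \<Rightarrow> complex"
  assumes "a < b"
    and "x0 \<in> {a..b}"
    and "f \<in> W12 a b"
    and "\<forall>x\<in>{a..b}. f x \<noteq> 0"
    and "f x0 = 1"
  shows "(\<forall>\<rho>. \<exists>!y. ef_solution a b f x0 \<rho> y \<and> (\<forall>x. x \<notin> {a..b} \<longrightarrow> y x = 0))
    \<and> (\<forall>\<rho>. \<forall>x\<in>{a..b}. (\<lambda>k. (\<i> * \<rho>) ^ k * formal_power f x0 k x / fact k) sums ef a b f x0 \<rho> x)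
    \<and> (\<forall>k. formal_power f x0 k \<in> W12 a b)
    \<and> (\<forall>\<rho>. (\<lambda>n. W12_norm a b (\<lambda>x. ef a b f x0 \<rho> x - (\<Sum>k<n. ef_term f x0 \<rho> k x))) \<longlonglongrightarrow> 0)
    \<and> (\<forall>k. second_deriv a b (formal_power f x0 k) \<in> Wm12 a b)
    \<and> (\<forall>\<rho>. second_deriv a b (ef a b f x0 \<rho>) \<in> Wm12 a b)
    \<and> (\<forall>\<rho>. (\<lambda>n. Wm12_norm a b (\<lambda>\<phi>. second_deriv a b (ef a b f x0 \<rho>) \<phi>
                  - (\<Sum>k<n. second_deriv a b (ef_term f x0 \<rho> k) \<phi>))) \<longlonglongrightarrow> 0)
    \<and> (\<forall>K. compact K \<longrightarrow>
          (\<forall>x\<in>{a..b}. abs_uniform_series (\<lambda>y. norm (y x)) K (ef_term f x0) (ef a b f x0))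
        \<and> abs_uniform_series (W12_norm a b) K (ef_term f x0) (ef a b f x0)
        \<and> abs_uniform_series (Wm12_norm a b) K
            (\<lambda>\<rho> k. second_deriv a b (ef_term f x0 \<rho> k))
            (\<lambda>\<rho>. second_deriv a b (ef a b f x0 \<rho>)))"
proof -
  interpret nonvanishing_W12 a b f x0
    using assms by unfold_locales auto
  \<comment> \<open>Convergence for a single parameter is uniform convergence over the compact set
    consisting of that parameter.\<close>
  have "compact {\<rho>}" "\<rho> \<in> {\<rho>}" for \<rho> :: complex by auto
  note lim = abs_uniform_series_tendsto[OF series_W12 this(2)] abs_uniform_series_tendsto[OF series_Wm12 this(2)]
  show ?thesis
    by (intro conjI allI ballI impI ef_solution_ex1 series_sums formal_power_W12 lim second_deriv_Wm12
        ef_W12 series_pointwise series_W12 series_Wm12; simp)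
qed

end
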